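(* Let $S$ and $T$ be countable (discrete) strongly Morita equivalent inverse semigroups. Then the universal $C^*$-algebras $C^*(S)$ and $C^*(T)$ are strongly Morita equivalent, and the reduced $C^*$-algebras $C^*_r(S)$ and $C^*_r(T)$ are strongly Morita equivalent.
   Context: An inverse semigroup is a semigroup $S$ such that for each $s\in S$ there is a unique $s^*\in S$ with $ss^*s=s$ and $s^*ss^*=s^*$. A Morita context is a 5-tuple $(S,T,X,\langle\ ,\ \rangle,[\ ,\ ])$ where $S,T$ are inverse semigroups, $X$ is a set with a left action of $S$ and a right action of $T$ that commute, and $\langle\ ,\ \rangle\colon X\times X\to S$, $[\ ,\ ]\colon X\times X\to T$ are surjective functions such that for all $x,y,z\in X$, $s\in S$, $t\in T$: (1) $\langle sx,y\rangle=s\langle x,y\rangle$; (2) $\langle y,x\rangle=\langle x,y\rangle^*$; (3) $\langle x,x\rangle x=x$; (4) $[x,yt]=[x,y]t$; (5) $[y,x]=[x,y]^*$; (6) $x[x,x]=x$; (7) $\langle x,y\rangle z=x[y,z]$. The inverse semigroups $S$ and $T$ are strongly Morita equivalent if such a Morita context exists. $C^*(S)$ is the universal $C^*$-algebra for $*$-representations of $S$ by partial isometries on Hilbert spaces. $C^*_r(S)$ is the $C^*$-algebra generated by the image of the left regular representation $\lambda$ of $S$ on $\ell^2(S)$, where $\lambda(s)\delta_t=\delta_{st}$ if $tt^*\le s^*s$ (i.e. $s^*stt^*=tt^*$) and $\lambda(s)\delta_t=0$ otherwise. Strong Morita equivalence of $C^*$-algebras is in the sense of Rieffel (existence of an imprimitivity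 bimodule). *)

theory Defs
  imports "HOL-Analysis.Analysis"
begin

section \<open>Inverse semigroups and Morita contexts\<close>

class inverse_semigroup = semigroup_mult +
  assumes ex1_inverse: "\<exists>!t. s * t * s = s \<and> t * s * t = t"

definition sinv :: "'s::inverse_semigroup \<Rightarrow> 's"  (\<open>_\<^sup>\<star>\<close> [1000] 999)
  where "s\<^sup>\<star> = (THE t. s * t * s = s \<and> t * s * t = t)"

lemma sinv: "s * s\<^sup>\<star> * s = s" "s\<^sup>\<star> * s * s\<^sup>\<star> = s\<^sup>\<star>"
  using theI'[OF ex1_inverse[of s]] unfolding sinv_def by auto

locale morita_context =
  fixes lact :: "'s::inverse_semigroup \<Rightarrow> 'x \<Rightarrow> 'x"
    and ract :: "'x \<Rightarrow> 't::inverse_semigroup \<Rightarrow> 'x"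
    and lpair :: "'x \<Rightarrow> 'x \<Rightarrow> 's"
    and rpair :: "'x \<Rightarrow> 'x \<Rightarrow> 't"
  assumes lact_mult: "lact (s * s') x = lact s (lact s' x)"
    and ract_mult: "ract x (t * t') = ract (ract x t) t'"
    and lact_ract_commute: "ract (lact s x) t = lact s (ract x t)"
    and lpair_surj: "surj (\<lambda>(x, y). lpair x y)"
    and rpair_surj: "surj (\<lambda>(x, y). rpair x y)"
    and lpair_lact: "lpair (lact s x) y = s * lpair x y"
    and lpair_swap: "lpair y x = (lpair x y)\<^sup>\<star>"
    and lpair_self: "lact (lpair x x) x = x"
    and rpair_ract: "rpair x (ract y t) = rpair x y * t"
    and rpair_swap: "rpair y x = (rpair x y)\<^sup>\<star>"
    and rpair_self: "ract x (rpair x x) = x"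
    and lpair_rpair: "lact (lpair x y) z = ract x (rpair y z)"


section \<open>Complex vector spaces, Hilbert spaces and C*-algebras\<close>

class scaleC =
  fixes scaleC :: "complex \<Rightarrow> 'a \<Rightarrow> 'a"  (infixr \<open>*\<^sub>C\<close> 75)

class complex_vector = real_vector + scaleC +
  assumes scaleC_add_right: "c *\<^sub>C (x + y) = c *\<^sub>C x + c *\<^sub>C y"
    and scaleC_add_left: "(c + d) *\<^sub>C x = c *\<^sub>C x + d *\<^sub>C x"
    and scaleC_scaleC: "c *\<^sub>C (d *\<^sub>C x) = (c * d) *\<^sub>C x"
    and scaleR_scaleC: "r *\<^sub>R x = complex_of_real r *\<^sub>C x"

text \<open>The inner product of a Hilbert space is conjugate linear in its first argument.\<close>

class chilbert_space = complex_vector + banach +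
  fixes cinner :: "'a \<Rightarrow> 'a \<Rightarrow> complex"
  assumes cinner_commute: "cinner x y = cnj (cinner y x)"
    and cinner_add_right: "cinner x (y + z) = cinner x y + cinner x z"
    and cinner_scaleC_right: "cinner x (c *\<^sub>C y) = c * cinner x y"
    and cinner_self: "cinner x x = complex_of_real ((norm x)\<^sup>2)"

class cstar_algebra = complex_vector + real_normed_algebra + banach +
  fixes adj :: "'a \<Rightarrow> 'a"
  assumes norm_scaleC: "norm (c *\<^sub>C a) = cmod c * norm a"
    and mult_scaleC_left: "(c *\<^sub>C a) * b = c *\<^sub>C (a * b)"
    and mult_scaleC_right: "a * (c *\<^sub>C b) = c *\<^sub>C (a * b)"
    and adj_adj: "adj (adj a) = a"
    and adj_add: "adj (a + b) = adj a + adj b"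
    and adj_scaleC: "adj (c *\<^sub>C a) = cnj c *\<^sub>C adj a"
    and adj_mult: "adj (a * b) = adj b * adj a"
    and norm_adj_mult_self: "norm (adj a * a) = (norm a)\<^sup>2"

lemma scaleC_one [simp]: "1 *\<^sub>C (x::'a::complex_vector) = x"
  using scaleR_scaleC[of 1 x] by simp

lemma scaleC_zero_left [simp]: "0 *\<^sub>C (x::'a::complex_vector) = 0"
  using scaleR_scaleC[of 0 x] by simp

lemma scaleC_zero_right [simp]: "c *\<^sub>C 0 = (0::'a::complex_vector)"
  using scaleC_add_right[of c "0::'a" 0] by simp

lemma scaleC_minus_left: "(- c) *\<^sub>C (x::'a::complex_vector) = - (c *\<^sub>C x)"
  using scaleC_add_left[of c "- c" x] by (simp add: scaleC_zero_left eq_neg_iff_add_eq_0 add.commute)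

lemma scaleC_minus_right: "c *\<^sub>C (- (x::'a::complex_vector)) = - (c *\<^sub>C x)"
  using scaleC_add_right[of c x "- x"] by (simp add: scaleC_zero_right eq_neg_iff_add_eq_0 add.commute)

lemma scaleC_diff_right: "c *\<^sub>C ((x::'a::complex_vector) - y) = c *\<^sub>C x - c *\<^sub>C y"
  using scaleC_add_right[of c x "- y"] by (simp add: scaleC_minus_right)

lemma scaleC_minus1: "(- 1) *\<^sub>C (x::'a::complex_vector) = - x"
  by (simp add: scaleC_minus_left scaleC_one)

lemma adj_zero: "adj 0 = (0 :: 'a::cstar_algebra)"
  using adj_scaleC[of 0 "0 :: 'a"] by simp

lemma norm_adj: "norm (adj a) = norm (a :: 'a::cstar_algebra)"
proof -
  have *: "norm b \<le> norm (adj b)" for b :: 'a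
  proof (cases "b = 0")
    case False
    have "norm b * norm b \<le> norm (adj b) * norm b"
      using norm_mult_ineq[of "adj b" b] by (simp add: norm_adj_mult_self power2_eq_square)
    then show ?thesis using False by simp
  qed simp
  show ?thesis using *[of a] *[of "adj a"] by (simp add: adj_adj)
qed

lemma bounded_linear_adj: "bounded_linear (adj :: 'a::cstar_algebra \<Rightarrow> 'a)"
  by (rule bounded_linear_intro[of _ 1]) (auto simp: adj_add adj_scaleC norm_adj scaleR_scaleC)

lemma bounded_linear_scaleC_cstar: "bounded_linear (scaleC c :: 'a::cstar_algebra \<Rightarrow> 'a)"
  by (rule bounded_linear_intro[of _ "cmod c"])
    (auto simp: scaleC_add_right scaleR_scaleC scaleC_scaleC norm_scaleC mult.commute)

lemma cinner_add_left: "cinner (x + y) z = cinner x z + cinner y z"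
  by (metis cinner_commute cinner_add_right complex_cnj_add)

lemma cinner_scaleC_left: "cinner (c *\<^sub>C x) y = cnj c * cinner x y"
  by (metis cinner_commute cinner_scaleC_right complex_cnj_mult)

lemma cinner_zero_right [simp]: "cinner x 0 = 0"
  using cinner_add_right[of x 0 0] by simp

lemma cinner_zero_left [simp]: "cinner 0 x = 0"
  using cinner_add_left[of 0 0 x] by simp

lemma cinner_minus_right: "cinner x (- y) = - cinner x y"
  using cinner_add_right[of x y "- y"] by (simp add: eq_neg_iff_add_eq_0 add.commute)

lemma cinner_minus_left: "cinner (- x) y = - cinner x y"
  using cinner_add_left[of x "- x" y] by (simp add: eq_neg_iff_add_eq_0 add.commute)

lemma cinner_diff_right: "cinner x (y - z) = cinner x y - cinner x z"
  using cinner_add_right[of x y "- z"] by (simp add: cinner_minus_right)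

lemma cinner_diff_left: "cinner (x - y) z = cinner x z - cinner y z"
  using cinner_add_left[of x "- y" z] by (simp add: cinner_minus_left)

lemma norm_sq_eq: "(norm x)\<^sup>2 = Re (cinner x x)"
  by (simp add: cinner_self)

lemma norm_add_sq: "(norm (x + y))\<^sup>2 = (norm x)\<^sup>2 + 2 * Re (cinner x y) + (norm y)\<^sup>2"
proof -
  have "Re (cinner y x) = Re (cinner x y)" by (subst cinner_commute) simp
  then show ?thesis unfolding norm_sq_eq by (simp add: cinner_add_left cinner_add_right)
qed

lemma norm_scaleC_hilbert: "norm (c *\<^sub>C x :: _::chilbert_space) = cmod c * norm x"
proof -
  have "complex_of_real ((norm (c *\<^sub>C x))\<^sup>2) = (c * cnj c) * cinner x x"
    unfolding cinner_self[symmetric] by (simp add: cinner_scaleC_left cinner_scaleC_right)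
  also have "\<dots> = complex_of_real ((cmod c)\<^sup>2 * (norm x)\<^sup>2)"
    unfolding cinner_self complex_norm_square[symmetric] by simp
  finally have "(norm (c *\<^sub>C x))\<^sup>2 = (cmod c * norm x)\<^sup>2"
    unfolding of_real_eq_iff by (simp add: power_mult_distrib)
  then show ?thesis by (rule power2_eq_imp_eq) auto
qed

lemma parallelogram: "(norm (x + y :: _::chilbert_space))\<^sup>2 + (norm (x - y))\<^sup>2 = 2 * (norm x)\<^sup>2 + 2 * (norm y)\<^sup>2"
  using norm_add_sq[of x y] norm_add_sq[of x "- y"] by (simp add: cinner_minus_right)

lemma cauchy_schwarz: "cmod (cinner x y) \<le> norm x * norm y"
proof (cases "x = 0")
  case False
  define c where "c = - cinner x y / of_real ((norm x)\<^sup>2)"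
  have nz: "(norm x)\<^sup>2 \<noteq> 0" using False by simp
  have "0 \<le> (norm (c *\<^sub>C x + y))\<^sup>2" by simp
  also have "\<dots> = (cmod c)\<^sup>2 * (norm x)\<^sup>2 + 2 * Re (cnj c * cinner x y) + (norm y)\<^sup>2"
    by (simp add: norm_add_sq norm_scaleC_hilbert power_mult_distrib cinner_scaleC_left)
  also have "cnj c * cinner x y = - of_real ((cmod (cinner x y))\<^sup>2 / (norm x)\<^sup>2)"
    unfolding c_def by (simp add: complex_norm_square mult.commute del: of_real_power)
  also have "cmod c = cmod (cinner x y) / (norm x)\<^sup>2"
    unfolding c_def by (simp add: norm_divide norm_power)
  finally have "0 \<le> (norm y)\<^sup>2 - (cmod (cinner x y))\<^sup>2 / (norm x)\<^sup>2"
    using nz by (simp add: power_divide power2_eq_square field_simps del: of_real_power)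
  then have "(cmod (cinner x y))\<^sup>2 \<le> (norm x * norm y)\<^sup>2"
    using nz by (simp add: field_simps power_mult_distrib)
  then show ?thesis by (rule power2_le_imp_le) simp
qed simp

lemma cinner_ext: "(\<And>z. cinner z x = cinner z y) \<Longrightarrow> x = y"
  by (metis cinner_diff_right cinner_self eq_iff_diff_eq_0 norm_eq_zero of_real_eq_0_iff power_eq_0_iff)

lemma bounded_linear_cinner_right: "bounded_linear (cinner x)"
proof (rule bounded_linear_intro[of _ "norm x"])
  show "cinner x (r *\<^sub>R y) = r *\<^sub>R cinner x y" for r y
    by (simp add: scaleR_scaleC cinner_scaleC_right scaleR_conv_of_real)
  show "norm (cinner x y) \<le> norm y * norm x" for y
    using cauchy_schwarz[of x y] by (simp add: mult.commute)
qed (simp add: cinner_add_right)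

lemma bounded_linear_cinner_left: "bounded_linear (\<lambda>y. cinner y x)"
  using bounded_linear_compose[OF bounded_linear_cnj bounded_linear_cinner_right[of x]]
  by (simp add: cinner_commute[symmetric])

lemma bounded_linear_scaleC: "bounded_linear (scaleC c :: 'a::chilbert_space \<Rightarrow> _)"
proof (rule bounded_linear_intro[of _ "cmod c"])
  show "c *\<^sub>C (r *\<^sub>R x) = r *\<^sub>R c *\<^sub>C x" for r and x :: "'a::chilbert_space"
    by (simp add: scaleR_scaleC scaleC_scaleC mult.commute)
qed (simp_all add: scaleC_add_right norm_scaleC_hilbert mult.commute)

lemma min_norm_exists:
  fixes C :: "_::chilbert_space set"
  assumes "closed C" "convex C" "C \<noteq> {}"
  obtains x where "x \<in> C" "\<And>y. y \<in> C \<Longrightarrow> norm x \<le> norm y"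
proof -
  define d where "d = (INF x\<in>C. norm x)"
  have bdd: "bdd_below (norm ` C)" by (rule bdd_belowI[of _ 0]) auto
  have d_le: "d \<le> norm y" if "y \<in> C" for y
    unfolding d_def using bdd that by (rule cINF_lower)
  have d0: "0 \<le> d" unfolding d_def using assms(3) by (intro cINF_greatest) auto
  have "\<exists>x\<in>C. norm x < d + 1 / Suc n" for n
    using cINF_less_iff[OF assms(3) bdd, of "d + 1 / Suc n"] unfolding d_def by auto
  then obtain f where f: "\<And>n. f n \<in> C" "\<And>n. norm (f n) < d + 1 / Suc n" by metis
  have lim: "(\<lambda>n. norm (f n)) \<longlonglongrightarrow> d"
  proof (rule tendsto_sandwich[of "\<lambda>_. d" _ _ "\<lambda>n. d + 1 / Suc n"])
    show "(\<lambda>n. d + 1 / Suc n) \<longlonglongrightarrow> d"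
      using tendsto_add[OF tendsto_const[of d] LIMSEQ_Suc[OF lim_1_over_n]] by simp
    show "\<forall>\<^sub>F n in sequentially. norm (f n) \<le> d + 1 / Suc n"
      using f(2) by (intro always_eventually allI less_imp_le)
  qed (use d_le f(1) in auto)
  have key: "(dist (f m) (f n))\<^sup>2 \<le> 2 * (norm (f m))\<^sup>2 + 2 * (norm (f n))\<^sup>2 - 4 * d\<^sup>2" for m n
  proof -
    have "(1/2) *\<^sub>R f m + (1/2) *\<^sub>R f n \<in> C"
      using assms(2) f(1) by (intro convexD) auto
    then have "d \<le> norm ((1/2) *\<^sub>R (f m + f n))" using d_le by (simp add: scaleR_add_right)
    then have "(2 * d)\<^sup>2 \<le> (norm (f m + f n))\<^sup>2" using d0 by (intro power_mono) auto
    then show ?thesis using parallelogram[of "f m" "f n"] by (simp add: dist_norm power_mult_distrib)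
  qed
  have "Cauchy f"
  proof (rule metric_CauchyI)
    fix e :: real assume e: "0 < e"
    have "(\<lambda>n. (norm (f n))\<^sup>2) \<longlonglongrightarrow> d\<^sup>2" using lim by (rule tendsto_power)
    then have "\<forall>\<^sub>F n in sequentially. (norm (f n))\<^sup>2 < d\<^sup>2 + e\<^sup>2 / 4"
      using e by (intro order_tendstoD(2)) auto
    then obtain M where M: "\<And>n. n \<ge> M \<Longrightarrow> (norm (f n))\<^sup>2 < d\<^sup>2 + e\<^sup>2 / 4"
      unfolding eventually_sequentially by auto
    have "dist (f m) (f n) < e" if "m \<ge> M" "n \<ge> M" for m n
    proof -
      have "(dist (f m) (f n))\<^sup>2 < e\<^sup>2" using key[of m n] M[OF that(1)] M[OF that(2)] by simp
      then show ?thesis using e by (metis power_less_imp_less_base less_imp_le)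
    qed
    then show "\<exists>M. \<forall>m\<ge>M. \<forall>n\<ge>M. dist (f m) (f n) < e" by blast
  qed
  then obtain x where x: "f \<longlonglongrightarrow> x" using Cauchy_convergent convergentD by blast
  have "x \<in> C" using assms(1) f(1) x by (rule closed_sequentially)
  moreover have "norm x = d" using tendsto_norm[OF x] lim LIMSEQ_unique by blast
  ultimately show ?thesis using d_le that by blast
qed

lemma min_norm_orthogonal:
  fixes x :: "_::chilbert_space"
  assumes "\<And>c. norm x \<le> norm (x + c *\<^sub>C z)"
  shows "cinner x z = 0"
proof (rule ccontr)
  assume nz: "cinner x z \<noteq> 0"
  then have z: "z \<noteq> 0" by auto
  define c where "c = - cinner z x / of_real ((norm z)\<^sup>2)"
  have zz: "(norm z)\<^sup>2 \<noteq> 0" using z by simp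
  have e: "cmod (cinner z x) = cmod (cinner x z)" by (subst cinner_commute) simp
  have "(norm (x + c *\<^sub>C z))\<^sup>2 = (norm x)\<^sup>2 + 2 * Re (c * cinner x z) + (cmod c)\<^sup>2 * (norm z)\<^sup>2"
    by (simp add: norm_add_sq norm_scaleC_hilbert power_mult_distrib cinner_scaleC_right)
  also have "c * cinner x z = - of_real ((cmod (cinner x z))\<^sup>2 / (norm z)\<^sup>2)"
    unfolding c_def by (subst (1) cinner_commute) (simp add: complex_norm_square mult.commute del: of_real_power)
  also have "cmod c = cmod (cinner x z) / (norm z)\<^sup>2"
    unfolding c_def by (simp add: norm_divide norm_power e)
  finally have "(norm (x + c *\<^sub>C z))\<^sup>2 = (norm x)\<^sup>2 - (cmod (cinner x z))\<^sup>2 / (norm z)\<^sup>2"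
    using zz by (simp add: power_divide power2_eq_square field_simps del: of_real_power)
  moreover have "(cmod (cinner x z))\<^sup>2 / (norm z)\<^sup>2 > 0" using nz z by simp
  ultimately have "(norm (x + c *\<^sub>C z))\<^sup>2 < (norm x)\<^sup>2" by simp
  moreover have "(norm x)\<^sup>2 \<le> (norm (x + c *\<^sub>C z))\<^sup>2" using assms[of c] by (intro power_mono) auto
  ultimately show False by simp
qed

lemma riesz_representation:
  fixes \<phi> :: "'h::chilbert_space \<Rightarrow> complex"
  assumes bl: "bounded_linear \<phi>" and cl: "\<And>c x. \<phi> (c *\<^sub>C x) = c * \<phi> x"
  shows "\<exists>y. \<forall>x. \<phi> x = cinner y x"
proof (cases "\<forall>x. \<phi> x = 0")
  case True
  then show ?thesis by (intro exI[of _ 0]) simp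
next
  case False
  then obtain w where w: "\<phi> w \<noteq> 0" by blast
  interpret bounded_linear \<phi> by (rule bl)
  define C where "C = \<phi> -` {1}"
  have "closed C" unfolding C_def
    by (rule closed_vimage) (auto intro!: linear_continuous_on[OF bl])
  moreover have "convex C" unfolding C_def convex_def
    by (auto simp: add scaleR scaleR_conv_of_real simp flip: of_real_add)
  moreover have "(1 / \<phi> w) *\<^sub>C w \<in> C" unfolding C_def using w by (simp add: cl)
  ultimately obtain x where x: "x \<in> C" "\<And>y. y \<in> C \<Longrightarrow> norm x \<le> norm y"
    using min_norm_exists[of C] by blast
  have \<phi>x: "\<phi> x = 1" using x(1) by (simp add: C_def)
  then have xnz: "x \<noteq> 0" by (metis zero zero_neq_one)
  have orth: "cinner x z = 0" if "\<phi> z = 0" for z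
    by (rule min_norm_orthogonal, rule x(2)) (simp add: C_def add cl that \<phi>x)
  have "\<phi> v = cinner ((1 / of_real ((norm x)\<^sup>2)) *\<^sub>C x) v" for v
  proof -
    have "\<phi> (v - \<phi> v *\<^sub>C x) = 0" by (simp add: diff cl \<phi>x)
    from orth[OF this] have "cinner x v = \<phi> v * of_real ((norm x)\<^sup>2)"
      by (simp add: cinner_diff_right cinner_scaleC_right cinner_self)
    then show ?thesis using xnz by (simp add: cinner_scaleC_left)
  qed
  then show ?thesis by blast
qed


section \<open>The Hilbert spaces \<open>\<ell>\<^sup>2(I)\<close>\<close>

typedef 'i ell2 = "{f :: 'i \<Rightarrow> complex. (\<lambda>i. (cmod (f i))\<^sup>2) summable_on UNIV}"
  morphisms ell2_apply Abs_ell2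
  by (rule exI[of _ "\<lambda>_. 0"]) simp

setup_lifting type_definition_ell2

lemma ell2_apply_summable: "(\<lambda>i. (cmod (ell2_apply f i))\<^sup>2) summable_on UNIV"
  using ell2_apply[of f] by simp

lemma cmod_add_sq_le: "(cmod (a + b))\<^sup>2 \<le> 2 * (cmod a)\<^sup>2 + 2 * (cmod b)\<^sup>2"
proof -
  have "(cmod (a + b))\<^sup>2 \<le> (cmod a + cmod b)\<^sup>2"
    by (intro power_mono norm_triangle_ineq) simp
  also have "\<dots> \<le> 2 * (cmod a)\<^sup>2 + 2 * (cmod b)\<^sup>2"
    using zero_le_power2[of "cmod a - cmod b"] unfolding power2_eq_square by (simp add: algebra_simps)
  finally show ?thesis .
qed

lemma summable_sq_add:
  assumes "(\<lambda>i. (cmod (f i))\<^sup>2) summable_on A" "(\<lambda>i. (cmod (g i))\<^sup>2) summable_on A"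
  shows "(\<lambda>i. (cmod (f i + g i))\<^sup>2) summable_on A"
proof (rule summable_on_comparison_test)
  show "(\<lambda>i. 2 * (cmod (f i))\<^sup>2 + 2 * (cmod (g i))\<^sup>2) summable_on A"
    by (intro summable_on_add summable_on_cmult_right assms)
qed (use cmod_add_sq_le in auto)

lemma summable_cnj_mult:
  assumes "(\<lambda>i. (cmod (f i))\<^sup>2) summable_on A" "(\<lambda>i. (cmod (g i))\<^sup>2) summable_on A"
  shows "(\<lambda>i. cnj (f i) * g i) summable_on A"
proof (rule abs_summable_summable, rule summable_on_comparison_test)
  show "(\<lambda>i. (cmod (f i))\<^sup>2 + (cmod (g i))\<^sup>2) summable_on A"
    by (intro summable_on_add assms)
  show "norm (cnj (f i) * g i) \<le> (cmod (f i))\<^sup>2 + (cmod (g i))\<^sup>2" for i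
  proof -
    have "0 \<le> cmod (f i) * cmod (g i)" by simp
    then show ?thesis
      using sum_squares_bound[of "cmod (f i)" "cmod (g i)"] unfolding norm_mult complex_mod_cnj
      by linarith
  qed
qed simp

instantiation ell2 :: (type) complex_vector
begin

lift_definition zero_ell2 :: "'a ell2" is "\<lambda>_. 0" by simp

lift_definition plus_ell2 :: "'a ell2 \<Rightarrow> 'a ell2 \<Rightarrow> 'a ell2" is "\<lambda>f g i. f i + g i"
  by (rule summable_sq_add)

lift_definition uminus_ell2 :: "'a ell2 \<Rightarrow> 'a ell2" is "\<lambda>f i. - f i" by simp

lift_definition minus_ell2 :: "'a ell2 \<Rightarrow> 'a ell2 \<Rightarrow> 'a ell2" is "\<lambda>f g i. f i - g i"
  subgoal for f g using summable_sq_add[of f UNIV "\<lambda>i. - g i"] by simp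
  done

lift_definition scaleC_ell2 :: "complex \<Rightarrow> 'a ell2 \<Rightarrow> 'a ell2" is "\<lambda>c f i. c * f i"
  by (simp add: norm_mult power_mult_distrib summable_on_cmult_right)

definition scaleR_ell2 :: "real \<Rightarrow> 'a ell2 \<Rightarrow> 'a ell2"
  where "scaleR_ell2 r f = complex_of_real r *\<^sub>C f"

instance
  by standard (simp_all only: scaleR_ell2_def, (transfer; simp add: algebra_simps fun_eq_iff)+)

end

lift_definition ell2_inner :: "'i ell2 \<Rightarrow> 'i ell2 \<Rightarrow> complex"
  is "\<lambda>f g. \<Sum>\<^sub>\<infinity>i. cnj (f i) * g i" .

lift_definition ell2_norm :: "'i ell2 \<Rightarrow> real"
  is "\<lambda>f. sqrt (\<Sum>\<^sub>\<infinity>i. (cmod (f i))\<^sup>2)" .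

lemma ell2_facts:
  fixes f g h :: "'a ell2" and X :: "nat \<Rightarrow> 'a ell2"
  shows ell2_inner_add: "ell2_inner f (g + h) = ell2_inner f g + ell2_inner f h"
    and ell2_inner_scaleC: "ell2_inner f (c *\<^sub>C g) = c * ell2_inner f g"
    and ell2_inner_commute: "ell2_inner f g = cnj (ell2_inner g f)"
    and ell2_inner_self: "ell2_inner f f = complex_of_real ((ell2_norm f)\<^sup>2)"
    and ell2_norm_eq_zero: "ell2_norm f = 0 \<longleftrightarrow> f = 0"
    and ell2_norm_triangle: "ell2_norm (f + g) \<le> ell2_norm f + ell2_norm g"
    and ell2_norm_scaleC: "ell2_norm (c *\<^sub>C f) = cmod c * ell2_norm f"
    and ell2_complete: "\<forall>e>0. \<exists>M. \<forall>m\<ge>M. \<forall>n\<ge>M. ell2_norm (X m - X n) < e \<Longrightarrow>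
      \<exists>l. \<forall>e>0. \<exists>M. \<forall>n\<ge>M. ell2_norm (X n - l) < e"
proof -
  have ip_add: "ell2_inner f (g + h) = ell2_inner f g + ell2_inner f h" for f g h :: "'a ell2"
    by transfer (simp add: distrib_left infsum_add summable_cnj_mult)
  have ip_scale: "ell2_inner f (c *\<^sub>C g) = c * ell2_inner f g" for f g :: "'a ell2" and c
    by transfer (simp add: mult.left_commute infsum_cmult_right')
  have ip_comm: "ell2_inner f g = cnj (ell2_inner g f)" for f g :: "'a ell2"
    by transfer (simp add: mult.commute flip: infsum_cnj)
  have nn: "0 \<le> (\<Sum>\<^sub>\<infinity>i. (cmod (f i))\<^sup>2)" for f :: "'a \<Rightarrow> complex"
    by (intro infsum_nonneg) simp
  have ip_self: "ell2_inner f f = complex_of_real ((ell2_norm f)\<^sup>2)" for f :: "'a ell2"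
  proof (transfer)
    fix f :: "'a \<Rightarrow> complex"
    assume f: "(\<lambda>i. (cmod (f i))\<^sup>2) summable_on UNIV"
    have "(\<Sum>\<^sub>\<infinity>i. cnj (f i) * f i) = (\<Sum>\<^sub>\<infinity>i. complex_of_real ((cmod (f i))\<^sup>2))"
      by (intro infsum_cong) (simp add: complex_norm_square mult.commute del: of_real_power)
    also have "\<dots> = complex_of_real (\<Sum>\<^sub>\<infinity>i. (cmod (f i))\<^sup>2)"
      using has_sum_of_real[OF has_sum_infsum[OF f]] by (intro infsumI)
    finally show "(\<Sum>\<^sub>\<infinity>i. cnj (f i) * f i) = complex_of_real ((sqrt (\<Sum>\<^sub>\<infinity>i. (cmod (f i))\<^sup>2))\<^sup>2)"
      using nn by simp
  qed
  have norm_nonneg: "0 \<le> ell2_norm f" for f :: "'a ell2"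
    by transfer (simp add: nn)
  have norm_sq_finite: "(\<Sum>i\<in>F. (cmod (ell2_apply f i))\<^sup>2) \<le> (ell2_norm f)\<^sup>2"
    if "finite F" for F and f :: "'a ell2"
    using that by transfer (simp add: nn finite_sum_le_infsum)
  have norm_le: "ell2_norm f \<le> c"
    if "0 \<le> c" "\<And>F. finite F \<Longrightarrow> (\<Sum>i\<in>F. (cmod (ell2_apply f i))\<^sup>2) \<le> c\<^sup>2" for c and f :: "'a ell2"
    using that
    by transfer (auto intro!: real_le_lsqrt infsum_le_finite_sums)
  have norm_coord: "cmod (ell2_apply f i) \<le> ell2_norm f" for i and f :: "'a ell2"
    by (rule power2_le_imp_le) (use norm_sq_finite[of "{i}" f] norm_nonneg[of f] in auto)
  have norm_scale: "ell2_norm (c *\<^sub>C f) = cmod c * ell2_norm f" for c and f :: "'a ell2"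
    by transfer (simp add: norm_mult power_mult_distrib infsum_cmult_right' real_sqrt_mult)
  have norm_zero: "ell2_norm f = 0 \<longleftrightarrow> f = 0" for f :: "'a ell2"
  proof
    assume "ell2_norm f = 0"
    then have "ell2_apply f i = 0" for i using norm_coord[of f i] by simp
    then show "f = 0" by transfer auto
  qed (transfer, simp)
  have ip_add_left: "ell2_inner (f + g) h = ell2_inner f h + ell2_inner g h" for f g h :: "'a ell2"
    by (metis ip_comm ip_add complex_cnj_add)
  have ip_scale_left: "ell2_inner (c *\<^sub>C f) h = cnj c * ell2_inner f h" for c and f h :: "'a ell2"
    by (metis ip_comm ip_scale complex_cnj_mult)
  have exp: "(ell2_norm (f + g))\<^sup>2 = (ell2_norm f)\<^sup>2 + 2 * Re (ell2_inner f g) + (ell2_norm g)\<^sup>2" for f g :: "'a ell2"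
  proof -
    have "(ell2_norm h)\<^sup>2 = Re (ell2_inner h h)" for h :: "'a ell2" using ip_self[of h] by simp
    moreover have "Re (ell2_inner g f) = Re (ell2_inner f g)" by (subst ip_comm) simp
    ultimately show ?thesis by (simp add: ip_add ip_add_left)
  qed
  have cs: "Re (ell2_inner f g) \<le> ell2_norm f * ell2_norm g" for f g :: "'a ell2"
  proof (cases "f = 0 \<or> g = 0")
    case True
    then have "Re (ell2_inner f g) = 0" by (elim disjE; simp; transfer; simp)
    then show ?thesis by (simp add: norm_nonneg)
  next
    case False
    then have pos: "ell2_norm f > 0" "ell2_norm g > 0"
      using norm_nonneg[of f] norm_nonneg[of g] norm_zero[of f] norm_zero[of g] by linarith+
    have "0 \<le> (ell2_norm (complex_of_real (ell2_norm g) *\<^sub>C f + complex_of_real (- ell2_norm f) *\<^sub>C g))\<^sup>2" by simp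
    also have "\<dots> = 2 * (ell2_norm f * ell2_norm g) * (ell2_norm f * ell2_norm g - Re (ell2_inner f g))"
      unfolding exp norm_scale ip_scale ip_scale_left using norm_nonneg
      by (simp add: power_mult_distrib) (simp add: algebra_simps power2_eq_square)
    finally show ?thesis using mult_pos_pos[OF pos] by (simp add: zero_le_mult_iff)
  qed
  have norm_tri: "ell2_norm (f + g) \<le> ell2_norm f + ell2_norm g" for f g :: "'a ell2"
    by (rule power2_le_imp_le) (use exp[of f g] cs[of f g] norm_nonneg in \<open>auto simp: power2_sum\<close>)
  have complete: "\<exists>l. \<forall>e>0. \<exists>M. \<forall>n\<ge>M. ell2_norm (X n - l) < e"
    if X: "\<forall>e>0. \<exists>M. \<forall>m\<ge>M. \<forall>n\<ge>M. ell2_norm (X m - X n) < e" for X :: "nat \<Rightarrow> 'a ell2"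
  proof -
    have diff: "ell2_apply (f - g) i = ell2_apply f i - ell2_apply g i" for f g :: "'a ell2" and i
      by transfer simp
    have "Cauchy (\<lambda>n. ell2_apply (X n) i)" for i
    proof (rule metric_CauchyI)
      fix e :: real assume "0 < e"
      then obtain M where "\<forall>m\<ge>M. \<forall>n\<ge>M. ell2_norm (X m - X n) < e" using X by blast
      then show "\<exists>M. \<forall>m\<ge>M. \<forall>n\<ge>M. dist (ell2_apply (X m) i) (ell2_apply (X n) i) < e"
        unfolding dist_norm diff[symmetric] using norm_coord le_less_trans by blast
    qed
    then have "\<forall>i. \<exists>l. (\<lambda>n. ell2_apply (X n) i) \<longlonglongrightarrow> l"
      using Cauchy_convergent unfolding convergent_def by blast
    from choice[OF this] obtain l where l: "\<And>i. (\<lambda>n. ell2_apply (X n) i) \<longlonglongrightarrow> l i"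
      by blast
    have bound: "(\<Sum>i\<in>F. (cmod (ell2_apply (X n) i - l i))\<^sup>2) \<le> e\<^sup>2"
      if "\<forall>m\<ge>M. \<forall>n\<ge>M. ell2_norm (X m - X n) < e" "n \<ge> M" "finite F" for e M n F
    proof (rule LIMSEQ_le_const2)
      show "(\<lambda>m. \<Sum>i\<in>F. (cmod (ell2_apply (X n) i - ell2_apply (X m) i))\<^sup>2)
          \<longlonglongrightarrow> (\<Sum>i\<in>F. (cmod (ell2_apply (X n) i - l i))\<^sup>2)"
        by (intro tendsto_intros l)
      have "(\<Sum>i\<in>F. (cmod (ell2_apply (X n) i - ell2_apply (X m) i))\<^sup>2) \<le> e\<^sup>2" if "m \<ge> M" for m
      proof -
        have "(\<Sum>i\<in>F. (cmod (ell2_apply (X n) i - ell2_apply (X m) i))\<^sup>2) \<le> (ell2_norm (X n - X m))\<^sup>2"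
          using norm_sq_finite[OF \<open>finite F\<close>, of "X n - X m"] by (simp add: diff)
        also have "\<dots> \<le> e\<^sup>2"
          using \<open>\<forall>m\<ge>M. \<forall>n\<ge>M. ell2_norm (X m - X n) < e\<close> \<open>n \<ge> M\<close> \<open>m \<ge> M\<close> norm_nonneg
          by (intro power_mono) (auto intro: less_imp_le)
        finally show ?thesis .
      qed
      then show "\<exists>N. \<forall>m\<ge>N. (\<Sum>i\<in>F. (cmod (ell2_apply (X n) i - ell2_apply (X m) i))\<^sup>2) \<le> e\<^sup>2"
        by blast
    qed
    obtain M where M: "\<forall>m\<ge>M. \<forall>n\<ge>M. ell2_norm (X m - X n) < 1" using X zero_less_one by blast
    have "(\<lambda>i. (cmod (ell2_apply (X M) i - l i))\<^sup>2) summable_on UNIV"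
      by (rule nonneg_bdd_above_summable_on) (use bound[OF M order_refl] in \<open>auto intro!: bdd_aboveI2\<close>)
    then have "(\<lambda>i. (cmod (ell2_apply (X M) i + - (ell2_apply (X M) i - l i)))\<^sup>2) summable_on UNIV"
      by (intro summable_sq_add ell2_apply_summable) (simp add: norm_minus_commute)
    then have "(\<lambda>i. (cmod (l i))\<^sup>2) summable_on UNIV" by simp
    then have lim: "ell2_apply (Abs_ell2 l) = l" by (simp add: Abs_ell2_inverse)
    show ?thesis
    proof (intro exI[of _ "Abs_ell2 l"] allI impI)
      fix e :: real assume e: "0 < e"
      then obtain M where M: "\<forall>m\<ge>M. \<forall>n\<ge>M. ell2_norm (X m - X n) < e / 2" using X half_gt_zero by blast
      have "ell2_norm (X n - Abs_ell2 l) \<le> e / 2" if "n \<ge> M" for n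
        by (rule norm_le) (use bound[OF M that] e in \<open>auto simp: diff lim\<close>)
      then show "\<exists>M. \<forall>n\<ge>M. ell2_norm (X n - Abs_ell2 l) < e" using e by (intro exI[of _ M]) fastforce
    qed
  qed
  show "ell2_inner f (g + h) = ell2_inner f g + ell2_inner f h"
    "ell2_inner f (c *\<^sub>C g) = c * ell2_inner f g"
    "ell2_inner f g = cnj (ell2_inner g f)"
    "ell2_inner f f = complex_of_real ((ell2_norm f)\<^sup>2)"
    "ell2_norm f = 0 \<longleftrightarrow> f = 0"
    "ell2_norm (f + g) \<le> ell2_norm f + ell2_norm g"
    "ell2_norm (c *\<^sub>C f) = cmod c * ell2_norm f"
    by (fact ip_add ip_scale ip_comm ip_self norm_zero norm_tri norm_scale)+
  show "\<exists>l. \<forall>e>0. \<exists>M. \<forall>n\<ge>M. ell2_norm (X n - l) < e"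
    if "\<forall>e>0. \<exists>M. \<forall>m\<ge>M. \<forall>n\<ge>M. ell2_norm (X m - X n) < e"
    using that by (rule complete)
qed

instantiation ell2 :: (type) real_normed_vector
begin

definition norm_ell2 :: "'a ell2 \<Rightarrow> real"
  where "norm_ell2 f = ell2_norm f"

definition dist_ell2 :: "'a ell2 \<Rightarrow> 'a ell2 \<Rightarrow> real"
  where "dist_ell2 f g = norm (f - g)"

definition sgn_ell2 :: "'a ell2 \<Rightarrow> 'a ell2"
  where "sgn_ell2 f = f /\<^sub>R norm f"

definition uniformity_ell2 :: "('a ell2 \<times> 'a ell2) filter"
  where "uniformity_ell2 = (INF e\<in>{0<..}. principal {(x, y). dist x y < e})"

definition open_ell2 :: "'a ell2 set \<Rightarrow> bool"
  where "open_ell2 U = (\<forall>x\<in>U. eventually (\<lambda>(x', y). x' = x \<longrightarrow> y \<in> U) uniformity)"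

instance
proof
  show "norm (r *\<^sub>R f) = \<bar>r\<bar> * norm f" for r and f :: "'a ell2"
    by (simp add: scaleR_ell2_def norm_ell2_def ell2_norm_scaleC)
  fix f g :: "'a ell2"
  show "norm f = 0 \<longleftrightarrow> f = 0" "norm (f + g) \<le> norm f + norm g"
    unfolding norm_ell2_def by (fact ell2_norm_eq_zero ell2_norm_triangle)+
qed (fact dist_ell2_def sgn_ell2_def uniformity_ell2_def open_ell2_def)+

end

instantiation ell2 :: (type) chilbert_space
begin

definition cinner_ell2 :: "'a ell2 \<Rightarrow> 'a ell2 \<Rightarrow> complex"
  where "cinner_ell2 f g = ell2_inner f g"

instance
proof
  fix X :: "nat \<Rightarrow> 'a ell2"
  assume "Cauchy X"
  then show "convergent X"
    using ell2_complete[of X]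
    unfolding Cauchy_def convergent_def lim_sequentially dist_norm norm_ell2_def by blast
next
  fix f g h :: "'a ell2" and c
  show "cinner f g = cnj (cinner g f)" "cinner f (g + h) = cinner f g + cinner f h"
    "cinner f (c *\<^sub>C g) = c * cinner f g" "cinner f f = complex_of_real ((norm f)\<^sup>2)"
    unfolding cinner_ell2_def norm_ell2_def
    by (fact ell2_inner_commute ell2_inner_add ell2_inner_scaleC ell2_inner_self)+
qed

end

lemma ell2_apply_bound: "cmod (ell2_apply f i) \<le> norm f"
proof -
  have "(cmod (ell2_apply f i))\<^sup>2 \<le> (norm f)\<^sup>2"
    unfolding norm_ell2_def
  proof transfer
    fix f :: "'a \<Rightarrow> complex" and i
    assume "(\<lambda>i. (cmod (f i))\<^sup>2) summable_on UNIV"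
    then show "(cmod (f i))\<^sup>2 \<le> (sqrt (\<Sum>\<^sub>\<infinity>i. (cmod (f i))\<^sup>2))\<^sup>2"
      using finite_sum_le_infsum[of "\<lambda>i. (cmod (f i))\<^sup>2" UNIV "{i}"] by (simp add: infsum_nonneg)
  qed
  then show ?thesis by (rule power2_le_imp_le) simp
qed

lemma ell2_norm_sq: "(norm f)\<^sup>2 = (\<Sum>\<^sub>\<infinity>i. (cmod (ell2_apply f i))\<^sup>2)"
  unfolding norm_ell2_def by transfer (simp add: infsum_nonneg)

lemma ell2_apply_zero [simp]: "ell2_apply 0 i = 0"
  and ell2_apply_add [simp]: "ell2_apply (f + g) i = ell2_apply f i + ell2_apply g i"
  and ell2_apply_scaleC [simp]: "ell2_apply (c *\<^sub>C f) i = c * ell2_apply f i"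
  by (transfer; simp)+

lemma ell2_eqI: "(\<And>i. ell2_apply f i = ell2_apply g i) \<Longrightarrow> f = g"
  by (simp add: ell2_apply_inject[symmetric] fun_eq_iff)

lift_definition delta :: "'i \<Rightarrow> 'i ell2" is "\<lambda>i j. if j = i then 1 else 0"
proof -
  fix i :: 'i
  show "(\<lambda>j. (cmod (if j = i then 1 else 0))\<^sup>2) summable_on UNIV"
    by (rule finite_nonzero_values_imp_summable_on) simp
qed

lemma cinner_delta: "cinner (delta i) f = ell2_apply f i"
  unfolding cinner_ell2_def
proof transfer
  fix i and f :: "'a \<Rightarrow> complex"
  have "(\<Sum>\<^sub>\<infinity>j. cnj (if j = i then 1 else 0) * f j) = (\<Sum>\<^sub>\<infinity>j\<in>{i}. f j)"
    by (rule infsum_cong_neutral) auto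
  then show "(\<Sum>\<^sub>\<infinity>j. cnj (if j = i then 1 else 0) * f j) = f i" by simp
qed


section \<open>Bounded operators on a Hilbert space\<close>

typedef (overloaded) 'h bop =
  "{T :: 'h::chilbert_space \<Rightarrow>\<^sub>L 'h. \<forall>c x. blinfun_apply T (c *\<^sub>C x) = c *\<^sub>C blinfun_apply T x}"
  morphisms blinfun_of_bop Abs_bop
  by (rule exI[of _ 0]) simp

setup_lifting type_definition_bop

lift_definition bop_apply :: "'h::chilbert_space bop \<Rightarrow> 'h \<Rightarrow> 'h"  (infixr \<open>\<bullet>\<^sub>o\<close> 75) is blinfun_apply .

lemma bop_eqI: "(\<And>x. S \<bullet>\<^sub>o x = T \<bullet>\<^sub>o x) \<Longrightarrow> S = T"
  by transfer (rule blinfun_eqI)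

lemma bop_scaleC: "T \<bullet>\<^sub>o (c *\<^sub>C x) = c *\<^sub>C (T \<bullet>\<^sub>o x)"
  by transfer simp

lemma bounded_linear_bop: "bounded_linear (bop_apply T)"
  by transfer (rule blinfun.bounded_linear_right)

definition bop_of :: "('h \<Rightarrow> 'h) \<Rightarrow> 'h::chilbert_space bop"
  where "bop_of f = Abs_bop (Blinfun f)"

lemma bop_of_apply:
  assumes "bounded_linear f" "\<And>c x. f (c *\<^sub>C x) = c *\<^sub>C f x"
  shows "bop_of f \<bullet>\<^sub>o x = f x"
proof -
  have "blinfun_apply (Blinfun f) = f" using assms(1) by (simp add: bounded_linear_Blinfun_apply)
  then show ?thesis unfolding bop_of_def bop_apply_def
    using assms(2) by (simp add: Abs_bop_inverse)
qed

instantiation bop :: (chilbert_space) "{complex_vector, real_normed_algebra}"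
begin

lift_definition zero_bop :: "'a bop" is 0 by simp
lift_definition plus_bop :: "'a bop \<Rightarrow> 'a bop \<Rightarrow> 'a bop" is "(+)"
  by (simp add: blinfun.add_left scaleC_add_right)
lift_definition uminus_bop :: "'a bop \<Rightarrow> 'a bop" is uminus
  by (simp add: blinfun.minus_left scaleC_minus_right)
lift_definition minus_bop :: "'a bop \<Rightarrow> 'a bop \<Rightarrow> 'a bop" is "(-)"
  by (simp add: blinfun.diff_left scaleC_diff_right)
lift_definition scaleR_bop :: "real \<Rightarrow> 'a bop \<Rightarrow> 'a bop" is "(*\<^sub>R)"
  by (simp add: blinfun.scaleR_left scaleR_scaleC scaleC_scaleC mult.commute)
lift_definition times_bop :: "'a bop \<Rightarrow> 'a bop \<Rightarrow> 'a bop" is "(o\<^sub>L)" by simp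
lift_definition norm_bop :: "'a bop \<Rightarrow> real" is norm .
lift_definition dist_bop :: "'a bop \<Rightarrow> 'a bop \<Rightarrow> real" is dist .

lemma bounded_linear_scaleC_blinfun:
  "bounded_linear (\<lambda>x. c *\<^sub>C blinfun_apply (T :: 'a \<Rightarrow>\<^sub>L 'a) x)"
  by (rule bounded_linear_compose[OF bounded_linear_scaleC blinfun.bounded_linear_right])

lift_definition scaleC_bop :: "complex \<Rightarrow> 'a bop \<Rightarrow> 'a bop"
  is "\<lambda>c T. Blinfun (\<lambda>x. c *\<^sub>C blinfun_apply T x)"
  by (simp add: bounded_linear_Blinfun_apply[OF bounded_linear_scaleC_blinfun] scaleC_scaleC mult.commute)

lemma bop_add_left: "(S + T :: 'a bop) \<bullet>\<^sub>o x = S \<bullet>\<^sub>o x + T \<bullet>\<^sub>o x" by transfer (rule blinfun.add_left)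

lemma bop_scaleC_left: "(c *\<^sub>C T :: 'a bop) \<bullet>\<^sub>o x = c *\<^sub>C (T \<bullet>\<^sub>o x)"
  by transfer (simp add: bounded_linear_Blinfun_apply[OF bounded_linear_scaleC_blinfun])

lemma bop_scaleR_left: "(r *\<^sub>R T :: 'a bop) \<bullet>\<^sub>o x = r *\<^sub>R (T \<bullet>\<^sub>o x)"
  by transfer (rule blinfun.scaleR_left)

definition sgn_bop :: "'a bop \<Rightarrow> 'a bop"
  where "sgn_bop T = scaleR (inverse (norm T)) T"

definition uniformity_bop :: "('a bop \<times> 'a bop) filter"
  where "uniformity_bop = (INF e\<in>{0<..}. principal {(x, y). dist x y < e})"

definition open_bop :: "'a bop set \<Rightarrow> bool"
  where "open_bop U = (\<forall>x\<in>U. eventually (\<lambda>(x', y). x' = x \<longrightarrow> y \<in> U) uniformity)"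

instance
proof
  fix S T U :: "'a bop" and r r' :: real and c d :: complex
  show "S + T + U = S + (T + U)" "S + T = T + S" "0 + S = S" "- S + S = 0" "S - T = S + - T"
    "r *\<^sub>R (S + T) = r *\<^sub>R S + r *\<^sub>R T" "(r + r') *\<^sub>R S = r *\<^sub>R S + r' *\<^sub>R S"
    "r *\<^sub>R r' *\<^sub>R S = (r * r') *\<^sub>R S" "1 *\<^sub>R S = S"
    by (transfer; simp add: algebra_simps)+
  show "S * T * U = S * (T * U)" "(S + T) * U = S * U + T * U" "S * (T + U) = S * T + S * U"
    "r *\<^sub>R S * T = r *\<^sub>R (S * T)" "S * r *\<^sub>R T = r *\<^sub>R (S * T)"
    by (transfer; simp add: blinfun_eqI blinfun.add_left blinfun.add_right blinfun.scaleR_left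
      blinfun.scaleR_right)+
  show "c *\<^sub>C (S + T) = c *\<^sub>C S + c *\<^sub>C T"
    by (rule bop_eqI) (simp add: bop_add_left bop_scaleC_left scaleC_add_right)
  show "(c + d) *\<^sub>C S = c *\<^sub>C S + d *\<^sub>C S"
    by (rule bop_eqI) (simp add: bop_add_left bop_scaleC_left scaleC_add_left)
  show "c *\<^sub>C (d *\<^sub>C S) = (c * d) *\<^sub>C S"
    by (rule bop_eqI) (simp add: bop_scaleC_left scaleC_scaleC)
  show "r *\<^sub>R S = complex_of_real r *\<^sub>C S"
    by (rule bop_eqI) (simp add: bop_scaleR_left bop_scaleC_left scaleR_scaleC)
  show "dist S T = norm (S - T)" by transfer (rule dist_norm)
  show "norm S = 0 \<longleftrightarrow> S = 0" "norm (S + T) \<le> norm S + norm T" "norm (r *\<^sub>R S) = \<bar>r\<bar> * norm S"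
    by (transfer; simp add: norm_triangle_ineq)+
  show "norm (S * T) \<le> norm S * norm T" by transfer (rule norm_blinfun_compose)
qed (fact sgn_bop_def uniformity_bop_def open_bop_def)+

end

instance bop :: (chilbert_space) banach
proof
  fix X :: "nat \<Rightarrow> 'a bop"
  assume "Cauchy X"
  then have "Cauchy (\<lambda>n. blinfun_of_bop (X n))" unfolding Cauchy_def dist_bop.rep_eq .
  then obtain L where L: "(\<lambda>n. blinfun_of_bop (X n)) \<longlonglongrightarrow> L"
    using Cauchy_convergent convergent_def by blast
  have "blinfun_apply L (c *\<^sub>C x) = c *\<^sub>C blinfun_apply L x" for c x
  proof (rule LIMSEQ_unique)
    show "(\<lambda>n. blinfun_apply (blinfun_of_bop (X n)) (c *\<^sub>C x)) \<longlonglongrightarrow> blinfun_apply L (c *\<^sub>C x)"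
      by (intro tendsto_intros L)
    have "(\<lambda>n. c *\<^sub>C blinfun_apply (blinfun_of_bop (X n)) x) \<longlonglongrightarrow> c *\<^sub>C blinfun_apply L x"
      by (intro bounded_linear.tendsto[OF bounded_linear_scaleC] tendsto_intros L)
    then show "(\<lambda>n. blinfun_apply (blinfun_of_bop (X n)) (c *\<^sub>C x)) \<longlonglongrightarrow> c *\<^sub>C blinfun_apply L x"
      using blinfun_of_bop by (simp add: bop_scaleC[unfolded bop_apply.rep_eq])
  qed
  then have "blinfun_of_bop (Abs_bop L) = L" by (intro Abs_bop_inverse) simp
  then have "X \<longlonglongrightarrow> Abs_bop L"
    using L unfolding lim_sequentially dist_bop.rep_eq by simp
  then show "convergent X" by (rule convergentI)
qed

lemma bop_zero_left [simp]: "0 \<bullet>\<^sub>o x = 0" by transfer simp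
lemma bop_diff_left: "(S - T) \<bullet>\<^sub>o x = S \<bullet>\<^sub>o x - T \<bullet>\<^sub>o x" by transfer (rule blinfun.diff_left)
lemma bop_mult: "(S * T) \<bullet>\<^sub>o x = S \<bullet>\<^sub>o T \<bullet>\<^sub>o x" by transfer simp
lemma bop_add_right: "T \<bullet>\<^sub>o (x + y) = T \<bullet>\<^sub>o x + T \<bullet>\<^sub>o y" by transfer (rule blinfun.add_right)
lemma bop_diff_right: "T \<bullet>\<^sub>o (x - y) = T \<bullet>\<^sub>o x - T \<bullet>\<^sub>o y" by transfer (rule blinfun.diff_right)
lemma bop_zero_right [simp]: "T \<bullet>\<^sub>o 0 = 0" by transfer (rule blinfun.zero_right)
lemma norm_bop_apply: "norm (T \<bullet>\<^sub>o x) \<le> norm T * norm x" by transfer (rule norm_blinfun)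
lemma norm_bop_le: "0 \<le> b \<Longrightarrow> (\<And>x. norm (T \<bullet>\<^sub>o x) \<le> b * norm x) \<Longrightarrow> norm T \<le> b"
  by transfer (rule norm_blinfun_bound)

instantiation bop :: (chilbert_space) cstar_algebra
begin

definition adj_bop :: "'a bop \<Rightarrow> 'a bop"
  where "adj_bop T = (THE S. \<forall>x y. cinner (S \<bullet>\<^sub>o x) y = cinner x (T \<bullet>\<^sub>o y))"

lemma adj_bop_unique:
  fixes S T :: "'a bop"
  assumes "\<And>x y. cinner (S \<bullet>\<^sub>o x) y = cinner x (T \<bullet>\<^sub>o y)"
  shows "adj T = S"
  unfolding adj_bop_def
proof (rule the_equality)
  fix S' assume S': "\<forall>x y. cinner (S' \<bullet>\<^sub>o x) y = cinner x (T \<bullet>\<^sub>o y)"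
  show "S' = S"
  proof (intro bop_eqI cinner_ext)
    fix x z show "cinner z (S' \<bullet>\<^sub>o x) = cinner z (S \<bullet>\<^sub>o x)"
      using S' assms by (metis cinner_commute)
  qed
qed (use assms in blast)

lemma cinner_adj_left:
  fixes T :: "'a bop"
  shows "cinner (adj T \<bullet>\<^sub>o x) y = cinner x (T \<bullet>\<^sub>o y)"
proof -
  have "\<exists>z. \<forall>y. cinner x (T \<bullet>\<^sub>o y) = cinner z y" for x
    by (rule riesz_representation)
      (auto intro: bounded_linear_compose[OF bounded_linear_cinner_right bounded_linear_bop]
        simp: bop_scaleC cinner_scaleC_right)
  then obtain f where f: "\<And>x y. cinner x (T \<bullet>\<^sub>o y) = cinner (f x) y" by metis
  have eqI: "u = v" if "\<And>y. cinner u y = cinner v y" for u v :: 'a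
    by (rule cinner_ext) (metis that cinner_commute)
  have add: "f (x + y) = f x + f y" for x y
    by (rule eqI) (simp add: f[symmetric] cinner_add_left)
  have scale: "f (c *\<^sub>C x) = c *\<^sub>C f x" for c x
    by (rule eqI) (simp add: f[symmetric] cinner_scaleC_left)
  have bound: "norm (f x) \<le> norm x * norm T" for x
  proof (cases "f x = 0")
    case False
    have "(norm (f x))\<^sup>2 = cmod (cinner (f x) (f x))" by (simp add: cinner_self norm_power)
    also have "\<dots> = cmod (cinner x (T \<bullet>\<^sub>o f x))" by (simp add: f)
    also have "\<dots> \<le> norm x * (norm T * norm (f x))"
      by (rule order_trans[OF cauchy_schwarz]) (intro mult_left_mono norm_bop_apply norm_ge_zero)
    finally show ?thesis using False by (simp add: power2_eq_square mult.assoc)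
  qed simp
  have "bounded_linear f"
    by (rule bounded_linear_intro[OF add _ bound]) (simp add: scaleR_scaleC scale)
  then have "bop_of f \<bullet>\<^sub>o x = f x" for x using scale by (rule bop_of_apply)
  then have "adj T = bop_of f" by (intro adj_bop_unique) (simp add: f)
  then show ?thesis using \<open>\<And>x. bop_of f \<bullet>\<^sub>o x = f x\<close> f by simp
qed

lemma norm_adj_mult_self_ge: "(norm (T :: 'a bop))\<^sup>2 \<le> norm (adj T * T)"
proof -
  have "norm (T \<bullet>\<^sub>o x) \<le> sqrt (norm (adj T * T)) * norm x" for x
  proof (rule power2_le_imp_le)
    have "(norm (T \<bullet>\<^sub>o x))\<^sup>2 = cmod (cinner (T \<bullet>\<^sub>o x) (T \<bullet>\<^sub>o x))" by (simp add: cinner_self norm_power)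
    also have "\<dots> = cmod (cinner ((adj T * T) \<bullet>\<^sub>o x) x)" by (simp add: bop_mult cinner_adj_left)
    also have "\<dots> \<le> norm (adj T * T) * norm x * norm x"
      by (rule order_trans[OF cauchy_schwarz]) (intro mult_right_mono norm_bop_apply norm_ge_zero)
    finally show "(norm (T \<bullet>\<^sub>o x))\<^sup>2 \<le> (sqrt (norm (adj T * T)) * norm x)\<^sup>2"
      by (simp add: power_mult_distrib power2_eq_square[of "norm x"] mult.assoc)
  qed simp
  then have "norm T \<le> sqrt (norm (adj T * T))" by (intro norm_bop_le) auto
  then have "(norm T)\<^sup>2 \<le> (sqrt (norm (adj T * T)))\<^sup>2" by (intro power_mono) auto
  then show ?thesis by simp
qed

instance
proof
  fix S T :: "'a bop" and c
  have adjR: "cinner x (adj U \<bullet>\<^sub>o y) = cinner (U \<bullet>\<^sub>o x) y" for U :: "'a bop" and x y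
    by (metis cinner_adj_left cinner_commute)
  show adj_adj: "adj (adj T) = T" for T :: "'a bop" by (rule adj_bop_unique) (simp add: adjR)
  show "adj (S + T) = adj S + adj T"
    by (rule adj_bop_unique) (simp add: bop_add_left cinner_add_left cinner_add_right cinner_adj_left)
  show "adj (c *\<^sub>C T) = cnj c *\<^sub>C adj T"
    by (rule adj_bop_unique) (simp add: bop_scaleC_left cinner_scaleC_left cinner_scaleC_right cinner_adj_left)
  show "adj (S * T) = adj T * adj S"
    by (rule adj_bop_unique) (simp add: bop_mult cinner_adj_left)
  show "c *\<^sub>C S * T = c *\<^sub>C (S * T)" "S * c *\<^sub>C T = c *\<^sub>C (S * T)"
    by (rule bop_eqI; simp add: bop_mult bop_scaleC_left bop_scaleC)+
  show "norm (c *\<^sub>C T) = cmod c * norm T"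
  proof (cases "c = 0")
    case False
    have le: "norm (d *\<^sub>C U) \<le> cmod d * norm U" for d and U :: "'a bop"
    proof (rule norm_bop_le)
      fix x
      have "cmod d * norm (U \<bullet>\<^sub>o x) \<le> cmod d * (norm U * norm x)"
        by (intro mult_left_mono norm_bop_apply norm_ge_zero)
      then show "norm ((d *\<^sub>C U) \<bullet>\<^sub>o x) \<le> cmod d * norm U * norm x"
        by (simp add: bop_scaleC_left norm_scaleC_hilbert mult.assoc)
    qed simp
    have "norm (inverse c *\<^sub>C c *\<^sub>C T) \<le> cmod (inverse c) * norm (c *\<^sub>C T)" by (rule le)
    then have "cmod c * norm T \<le> norm (c *\<^sub>C T)"
      using False by (simp add: scaleC_scaleC norm_inverse) (simp add: field_simps)
    then show ?thesis using le[of c T] by simp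
  qed simp
  have *: "norm U \<le> norm (adj U)" for U :: "'a bop"
  proof (cases "U = 0")
    case False
    have "norm U * norm U \<le> norm (adj U) * norm U"
      using norm_adj_mult_self_ge[of U] norm_mult_ineq[of "adj U" U] by (simp add: power2_eq_square)
    then show ?thesis using False by simp
  qed simp
  have "norm (adj T) = norm T" using *[of T] *[of "adj T"] adj_adj by simp
  then show "norm (adj T * T) = (norm T)\<^sup>2"
    using norm_adj_mult_self_ge[of T] norm_mult_ineq[of "adj T" T] by (simp add: power2_eq_square)
qed

end

lemma cinner_adj_right: "cinner x (adj T \<bullet>\<^sub>o y) = cinner (T \<bullet>\<^sub>o x) y"
  by (metis cinner_adj_left cinner_commute)


section \<open>C*-subalgebras\<close>

global_interpretation complex_vector: vector_space "scaleC :: complex \<Rightarrow> 'a \<Rightarrow> 'a::complex_vector"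
  defines csubspace = complex_vector.subspace
    and cspan = complex_vector.span
  by standard (simp_all add: scaleC_add_right scaleC_add_left scaleC_scaleC)

definition cstar_subalgebra :: "'a::cstar_algebra set \<Rightarrow> bool"
  where "cstar_subalgebra A \<longleftrightarrow>
    csubspace A \<and> closed A \<and> (\<forall>a\<in>A. \<forall>b\<in>A. a * b \<in> A) \<and> (\<forall>a\<in>A. adj a \<in> A)"

definition cstar_generated :: "'a::cstar_algebra set \<Rightarrow> 'a set"
  where "cstar_generated G = \<Inter>{A. cstar_subalgebra A \<and> G \<subseteq> A}"

lemma cstar_subalgebra_generated: "cstar_subalgebra (cstar_generated G)"
  unfolding cstar_generated_def cstar_subalgebra_def complex_vector.subspace_def
  by (auto intro!: closed_Inter)

lemma subset_cstar_generated: "G \<subseteq> cstar_generated G"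
  unfolding cstar_generated_def by blast

definition partial_isometry :: "'h::chilbert_space bop \<Rightarrow> bool"
  where "partial_isometry V \<longleftrightarrow> V * adj V * V = V"

definition star_representation :: "('s::inverse_semigroup \<Rightarrow> 'h::chilbert_space bop) \<Rightarrow> bool"
  where "star_representation \<pi> \<longleftrightarrow>
    (\<forall>s. partial_isometry (\<pi> s)) \<and> (\<forall>s t. \<pi> (s * t) = \<pi> s * \<pi> t) \<and> (\<forall>s. \<pi> (s\<^sup>\<star>) = adj (\<pi> s))"

lemma partial_isometry_norm: "partial_isometry V \<Longrightarrow> norm V \<le> 1"
proof -
  assume V: "partial_isometry V"
  define P where "P = adj V * V"
  have PP: "adj P * P = P"
    using V unfolding P_def partial_isometry_def by (simp add: adj_mult adj_adj mult.assoc)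
  have "(norm P)\<^sup>2 = norm P" using norm_adj_mult_self[of P] PP by simp
  then have "norm P \<le> 1" by (cases "norm P = 0") (auto simp: power2_eq_square)
  then have "(norm V)\<^sup>2 \<le> 1\<^sup>2" using norm_adj_mult_self[of V] by (simp add: P_def)
  then show ?thesis by (rule power2_le_imp_le) simp
qed


section \<open>The universal C*-algebra of an inverse semigroup\<close>

lift_definition ell2_slice :: "'k \<Rightarrow> ('k \<times> 'i) ell2 \<Rightarrow> 'i ell2" is "\<lambda>k f i. f (k, i)"
proof -
  fix k :: 'k and f :: "'k \<times> 'i \<Rightarrow> complex"
  assume "(\<lambda>i. (cmod (f i))\<^sup>2) summable_on UNIV"
  then have "(\<lambda>i. (cmod (f i))\<^sup>2) summable_on (Pair k ` UNIV)"
    by (rule summable_on_subset_banach) simp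
  then show "(\<lambda>i. (cmod (f (k, i)))\<^sup>2) summable_on UNIV"
    by (subst (asm) summable_on_reindex) (auto simp: inj_on_def o_def)
qed

lemma ell2_slice_add: "ell2_slice k (f + g) = ell2_slice k f + ell2_slice k g"
  and ell2_slice_scaleC: "ell2_slice k (c *\<^sub>C f) = c *\<^sub>C ell2_slice k f"
  by (transfer; simp)+

text \<open>The operator on \<open>\<ell>\<^sup>2(K \<times> I)\<close>, seen as the Hilbert sum of copies of \<open>\<ell>\<^sup>2(I)\<close> indexed by \<open>K\<close>,
  that acts by \<open>T k\<close> on the \<open>k\<close>-th summand; meaningful for uniformly bounded families \<open>T\<close>.\<close>

definition direct_sum_bop :: "('k \<Rightarrow> 'i ell2 bop) \<Rightarrow> ('k \<times> 'i) ell2 bop"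
  where "direct_sum_bop T =
    bop_of (\<lambda>f. Abs_ell2 (\<lambda>(k, i). ell2_apply (T k \<bullet>\<^sub>o ell2_slice k f) i))"

lemma ell2_slice_norm:
  fixes f :: "('k \<times> 'i) ell2"
  shows "((\<lambda>k. (norm (ell2_slice k f))\<^sup>2) has_sum (norm f)\<^sup>2) UNIV"
proof -
  have "((\<lambda>p. (cmod (ell2_apply f p))\<^sup>2) has_sum (norm f)\<^sup>2) (UNIV \<times> UNIV)"
    unfolding ell2_norm_sq UNIV_Times_UNIV by (rule has_sum_infsum[OF ell2_apply_summable])
  moreover have "((\<lambda>i. (cmod (ell2_apply f (k, i)))\<^sup>2) has_sum (norm (ell2_slice k f))\<^sup>2) UNIV" for k
    using has_sum_infsum[OF ell2_apply_summable[of "ell2_slice k f"]]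
    unfolding ell2_norm_sq[symmetric] by (simp add: ell2_slice.rep_eq)
  ultimately show ?thesis
    by (rule has_sum_SigmaD[where B = "\<lambda>_. UNIV"])
qed

lemma direct_sum_bop_apply:
  fixes T :: "'k \<Rightarrow> 'i ell2 bop"
  assumes T: "\<And>k. norm (T k) \<le> C"
  shows "ell2_slice k (direct_sum_bop T \<bullet>\<^sub>o f) = T k \<bullet>\<^sub>o ell2_slice k f"
proof -
  define F where "F f = (\<lambda>(k, i). ell2_apply (T k \<bullet>\<^sub>o ell2_slice k f) i)" for f
  have C0: "0 \<le> C" using T norm_ge_zero order_trans by blast
  have le: "(norm (T k \<bullet>\<^sub>o ell2_slice k f))\<^sup>2 \<le> C\<^sup>2 * (norm (ell2_slice k f))\<^sup>2" for k f
  proof -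
    have "norm (T k \<bullet>\<^sub>o ell2_slice k f) \<le> C * norm (ell2_slice k f)"
      by (rule order_trans[OF norm_bop_apply]) (intro mult_right_mono T norm_ge_zero)
    then have "(norm (T k \<bullet>\<^sub>o ell2_slice k f))\<^sup>2 \<le> (C * norm (ell2_slice k f))\<^sup>2"
      by (intro power_mono) auto
    then show ?thesis by (simp add: power_mult_distrib)
  qed
  have sumC: "((\<lambda>k. C\<^sup>2 * (norm (ell2_slice k f))\<^sup>2) has_sum (C\<^sup>2 * (norm f)\<^sup>2)) UNIV" for f
    by (rule has_sum_cmult_right[OF ell2_slice_norm])
  have sumT: "(\<lambda>k. (norm (T k \<bullet>\<^sub>o ell2_slice k f))\<^sup>2) summable_on UNIV" for f
    by (rule summable_on_comparison_test[OF has_sum_imp_summable[OF sumC[of f]]]) (auto simp: le)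
  have inner: "((\<lambda>i. (cmod (F f (k, i)))\<^sup>2) has_sum (norm (T k \<bullet>\<^sub>o ell2_slice k f))\<^sup>2) UNIV" for f k
    unfolding F_def ell2_norm_sq prod.case by (rule has_sum_infsum[OF ell2_apply_summable])
  have F: "(\<lambda>p. (cmod (F f p))\<^sup>2) summable_on UNIV" for f
    using summable_on_SigmaI[where f = "\<lambda>p. (cmod (F f p))\<^sup>2" and A = UNIV and B = "\<lambda>_. UNIV",
        OF inner sumT] by simp
  then have app: "ell2_apply (Abs_ell2 (F f)) = F f" for f by (simp add: Abs_ell2_inverse)
  have slice: "ell2_slice k (Abs_ell2 (F f)) = T k \<bullet>\<^sub>o ell2_slice k f" for f k
    by (rule ell2_eqI) (simp add: ell2_slice.rep_eq app, simp add: F_def)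
  have add: "Abs_ell2 (F (f + g)) = Abs_ell2 (F f) + Abs_ell2 (F g)" for f g
    by (rule ell2_eqI) (simp add: app, simp add: F_def ell2_slice_add bop_add_right split: prod.split)
  have scale: "Abs_ell2 (F (c *\<^sub>C f)) = c *\<^sub>C Abs_ell2 (F f)" for c f
    by (rule ell2_eqI) (simp add: app, simp add: F_def ell2_slice_scaleC bop_scaleC split: prod.split)
  have bound: "norm (Abs_ell2 (F f)) \<le> norm f * C" for f
  proof (rule power2_le_imp_le)
    have "(norm (Abs_ell2 (F f)))\<^sup>2 \<le> C\<^sup>2 * (norm f)\<^sup>2"
      using ell2_slice_norm[of "Abs_ell2 (F f)"] sumC[of f]
      by (rule has_sum_mono) (simp add: slice le)
    then show "(norm (Abs_ell2 (F f)))\<^sup>2 \<le> (norm f * C)\<^sup>2"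
      by (simp add: power_mult_distrib mult.commute)
  qed (simp add: C0)
  have "bounded_linear (\<lambda>f. Abs_ell2 (F f))"
    by (rule bounded_linear_intro[OF add _ bound]) (simp add: scaleR_scaleC scale)
  then have "direct_sum_bop T \<bullet>\<^sub>o f = Abs_ell2 (F f)"
    unfolding direct_sum_bop_def F_def[symmetric] using scale by (rule bop_of_apply)
  then show ?thesis by (simp add: slice)
qed

text \<open>The universal representation is the Hilbert sum of all *-representations of \<open>S\<close> on
  \<open>\<ell>\<^sup>2(S \<times> \<nat>)\<close> (functions that are not *-representations contribute a zero summand). This class of
  representations is large enough: by \<open>universal_property\<close> below, the C*-algebra it generates is
  universal for the *-representations of \<open>S\<close> on arbitrary Hilbert spaces.\<close>

type_synonym 's univ_space = "(('s \<Rightarrow> ('s \<times> nat) ell2 bop) \<times> 's \<times> nat) ell2"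

definition universal_rep :: "'s::inverse_semigroup \<Rightarrow> 's univ_space bop"
  where "universal_rep s = direct_sum_bop (\<lambda>\<pi>. if star_representation \<pi> then \<pi> s else 0)"

definition full_cstar :: "'s itself \<Rightarrow> 's::inverse_semigroup univ_space bop set"
  where "full_cstar _ = cstar_generated (range (universal_rep :: 's \<Rightarrow> _))"


lemma tendsto_of_dist_less:
  fixes f g :: "nat \<Rightarrow> 'a::real_normed_vector"
  assumes "\<And>n. dist (f n) (g n) < 1 / Suc n" "g \<longlonglongrightarrow> a"
  shows "f \<longlonglongrightarrow> a"
proof -
  have lim0: "(\<lambda>n. 1 / real (Suc n)) \<longlonglongrightarrow> 0" using LIMSEQ_Suc[OF lim_1_over_n] by simp
  have "norm (norm (f n - g n)) \<le> 1 / real (Suc n)" for n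
    using assms(1)[of n] by (simp add: dist_norm)
  then have "(\<lambda>n. norm (f n - g n)) \<longlonglongrightarrow> 0"
    by (intro Lim_null_comparison[OF always_eventually lim0]) blast
  then have "(\<lambda>n. f n - g n) \<longlonglongrightarrow> 0" by (rule tendsto_norm_zero_cancel)
  from tendsto_add[OF this assms(2)] show ?thesis by simp
qed

lemma ell2_slice_eqI: "(\<And>k. ell2_slice k f = ell2_slice k g) \<Longrightarrow> f = g"
  by (rule ell2_eqI) (metis ell2_slice.rep_eq surj_pair)

lemma ell2_slice_zero [simp]: "ell2_slice k 0 = 0"
  by transfer simp

lemma cinner_ell2_slices:
  "((\<lambda>k. cinner (ell2_slice k f) (ell2_slice k g)) has_sum cinner f g) UNIV"
proof -
  have *: "((\<lambda>i. cnj (ell2_apply u i) * ell2_apply v i) has_sum cinner u v) UNIV" for u v :: "'z ell2"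
    unfolding cinner_ell2_def ell2_inner.rep_eq
    by (rule has_sum_infsum[OF summable_cnj_mult[OF ell2_apply_summable ell2_apply_summable]])
  show ?thesis
  proof (rule has_sum_SigmaD[where B = "\<lambda>_. UNIV"])
    show "((\<lambda>p. cnj (ell2_apply f p) * ell2_apply g p) has_sum cinner f g) (UNIV \<times> UNIV)"
      using *[of f g] by simp
    show "((\<lambda>i. cnj (ell2_apply f (k, i)) * ell2_apply g (k, i)) has_sum
        cinner (ell2_slice k f) (ell2_slice k g)) UNIV" for k
      using *[of "ell2_slice k f" "ell2_slice k g"] by (simp add: ell2_slice.rep_eq)
  qed
qed

lemma universal_rep_slice:
  "ell2_slice \<pi> (universal_rep s \<bullet>\<^sub>o f) =
    (if star_representation \<pi> then \<pi> s \<bullet>\<^sub>o ell2_slice \<pi> f else 0)"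
proof -
  have "norm (if star_representation \<pi> then \<pi> s else 0) \<le> 1"
    for \<pi> :: "'a \<Rightarrow> ('a \<times> nat) ell2 bop"
    by (auto simp: star_representation_def partial_isometry_norm)
  then show ?thesis
    unfolding universal_rep_def
    by (subst direct_sum_bop_apply[where T = "\<lambda>\<pi>. if star_representation \<pi> then \<pi> s else 0" and C = 1])
      auto
qed

lemma star_representation_universal_rep: "star_representation universal_rep"
proof -
  have mult: "universal_rep (s * t) = universal_rep s * universal_rep t" for s t :: 'a
    by (intro bop_eqI ell2_slice_eqI)
      (auto simp: bop_mult universal_rep_slice star_representation_def)
  have adj: "universal_rep (s\<^sup>\<star>) = adj (universal_rep s)" for s :: 'a
  proof (rule adj_bop_unique[symmetric])
    fix f g :: "'a univ_space"
    have "cinner (ell2_slice \<pi> (universal_rep (s\<^sup>\<star>) \<bullet>\<^sub>o f)) (ell2_slice \<pi> g) =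
        cinner (ell2_slice \<pi> f) (ell2_slice \<pi> (universal_rep s \<bullet>\<^sub>o g))" for \<pi>
      by (auto simp: universal_rep_slice star_representation_def cinner_adj_left)
    then show "cinner (universal_rep (s\<^sup>\<star>) \<bullet>\<^sub>o f) g = cinner f (universal_rep s \<bullet>\<^sub>o g)"
      using cinner_ell2_slices[of "universal_rep (s\<^sup>\<star>) \<bullet>\<^sub>o f" g]
        cinner_ell2_slices[of f "universal_rep s \<bullet>\<^sub>o g"] has_sum_unique by simp
  qed
  show ?thesis
    unfolding star_representation_def partial_isometry_def
    by (simp add: mult[symmetric] adj[symmetric] sinv)
qed

lemma bessel:
  fixes e :: "'i \<Rightarrow> 'h::chilbert_space"
  assumes e: "\<And>i j. cinner (e i) (e j) = (if i = j \<and> i \<in> J then 1 else 0)"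
  shows "(\<lambda>i. (cmod (cinner (e i) x))\<^sup>2) summable_on UNIV"
    and "(\<Sum>\<^sub>\<infinity>i. (cmod (cinner (e i) x))\<^sup>2) \<le> (norm x)\<^sup>2"
proof -
  have fin: "(\<Sum>i\<in>F. (cmod (cinner (e i) x))\<^sup>2) \<le> (norm x)\<^sup>2" if F: "finite F" for F
  proof -
    define c where "c i = cinner (e i) x" for i
    define y where "y = (\<Sum>i\<in>F. c i *\<^sub>C e i)"
    have sumr: "cinner u (\<Sum>i\<in>F. c i *\<^sub>C e i) = (\<Sum>i\<in>F. c i * cinner u (e i))" for u
      using F by induction (simp_all add: cinner_add_right cinner_scaleC_right)
    have c0: "c i = 0" if "i \<notin> J" for i
    proof -
      have "(norm (e i))\<^sup>2 = 0" using e[of i i] that by (simp add: cinner_self)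
      then show ?thesis by (simp add: c_def)
    qed
    have ey: "cinner (e i) y = c i" if "i \<in> F" for i
    proof -
      have "cinner (e i) y = (\<Sum>j\<in>F. if i = j then c j else 0)"
        unfolding y_def sumr e using c0 by (intro sum.cong) auto
      then show ?thesis using F that by simp
    qed
    have "cinner y x = cnj (cinner x y)" by (rule cinner_commute)
    also have "\<dots> = (\<Sum>i\<in>F. cnj (c i) * c i)"
      unfolding y_def sumr cnj_sum
      by (intro sum.cong refl) (simp add: c_def cinner_commute[of x, symmetric] cinner_commute[of _ x])
    finally have yx: "cinner y x = (\<Sum>i\<in>F. cnj (c i) * c i)" .
    have "cinner y y = (\<Sum>i\<in>F. c i * cinner y (e i))" by (subst (2) y_def) (rule sumr)
    also have "\<dots> = (\<Sum>i\<in>F. cnj (c i) * c i)"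
      by (intro sum.cong refl) (metis cinner_commute ey mult.commute)
    finally have yy: "cinner y y = cinner y x" using yx by simp
    have S: "(\<Sum>i\<in>F. (cmod (cinner (e i) x))\<^sup>2) = (norm y)\<^sup>2"
    proof -
      have "complex_of_real ((norm y)\<^sup>2) = (\<Sum>i\<in>F. cnj (c i) * c i)"
        using yx yy cinner_self by metis
      also have "\<dots> = complex_of_real (\<Sum>i\<in>F. (cmod (c i))\<^sup>2)"
        unfolding of_real_sum by (intro sum.cong refl) (simp only: complex_norm_square mult.commute)
      finally show ?thesis unfolding of_real_eq_iff c_def by simp
    qed
    have "norm y * norm y \<le> norm y * norm x"
      using cauchy_schwarz[of y x] unfolding yy[symmetric] cinner_self norm_of_real
      by (simp add: power2_eq_square)
    then have "norm y \<le> norm x" by (cases "y = 0") auto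
    then show ?thesis unfolding S by (intro power_mono) auto
  qed
  show *: "(\<lambda>i. (cmod (cinner (e i) x))\<^sup>2) summable_on UNIV"
    by (rule nonneg_bdd_above_summable_on) (use fin in \<open>auto intro!: bdd_aboveI2\<close>)
  show "(\<Sum>\<^sub>\<infinity>i. (cmod (cinner (e i) x))\<^sup>2) \<le> (norm x)\<^sup>2"
    by (rule infsum_le_finite_sums[OF *]) (use fin in auto)
qed

text \<open>The closed linear span of \<open>G\<close>, as a double orthogonal complement.\<close>

definition biorth :: "'h::chilbert_space set \<Rightarrow> 'h set"
  where "biorth G = {x. \<forall>y. (\<forall>g\<in>G. cinner y g = 0) \<longrightarrow> cinner y x = 0}"

lemma biorth_superset: "g \<in> G \<Longrightarrow> g \<in> biorth G"
  and biorth_diff: "x \<in> biorth G \<Longrightarrow> y \<in> biorth G \<Longrightarrow> x - y \<in> biorth G"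
  and biorth_scaleC: "x \<in> biorth G \<Longrightarrow> c *\<^sub>C x \<in> biorth G"
  by (auto simp: biorth_def cinner_diff_right cinner_scaleC_right)

lemma orthonormal_basis_exists:
  fixes \<gamma> :: "'s \<Rightarrow> 'h::chilbert_space"
  defines "K \<equiv> biorth (range \<gamma>)"
  obtains e :: "'s \<times> nat \<Rightarrow> 'h" and J where
    "\<And>i j. cinner (e i) (e j) = (if i = j \<and> i \<in> J then 1 else 0)"
    "\<And>i. e i \<in> K"
    "\<And>x. x \<in> K \<Longrightarrow> (\<And>i. cinner (e i) x = 0) \<Longrightarrow> x = 0"
proof -
  define ons where "ons = {M. M \<subseteq> K \<and> (\<forall>m\<in>M. \<forall>n\<in>M. cinner m n = (if m = n then 1 else 0))}"
  have "\<exists>M\<in>ons. \<forall>N\<in>ons. M \<subseteq> N \<longrightarrow> N = M"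
  proof (rule subset_Zorn')
    fix C assume C: "subset.chain ons C"
    show "\<Union>C \<in> ons"
      unfolding ons_def
    proof (intro CollectI conjI ballI)
      show "\<Union>C \<subseteq> K" using C unfolding subset.chain_def ons_def by blast
      fix m n assume "m \<in> \<Union>C" "n \<in> \<Union>C"
      then obtain M N where MN: "M \<in> C" "m \<in> M" "N \<in> C" "n \<in> N" by blast
      then have "M \<subseteq> N \<or> N \<subseteq> M" using C unfolding subset_chain_def by blast
      then obtain Q where "Q \<in> C" "m \<in> Q" "n \<in> Q" using MN by blast
      then show "cinner m n = (if m = n then 1 else 0)"
        using C unfolding subset.chain_def ons_def by blast
    qed
  qed
  then obtain M where M: "M \<in> ons" and max: "\<And>N. N \<in> ons \<Longrightarrow> M \<subseteq> N \<Longrightarrow> N = M" by blast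
  have on: "cinner m n = (if m = n then 1 else 0)" if "m \<in> M" "n \<in> M" for m n
    using M that unfolding ons_def by blast
  have MK: "M \<subseteq> K" using M unfolding ons_def by blast
  define N where "N s = {m\<in>M. cinner m (\<gamma> s) \<noteq> 0}" for s
  have countN: "countable (N s)" for s
  proof -
    define e where "e m = (if m \<in> M then m else 0)" for m
    have "cinner (e i) (e j) = (if i = j \<and> i \<in> M then 1 else 0)" for i j
      unfolding e_def using on by auto
    from bessel(1)[OF this, of "\<gamma> s"]
    have "countable {m \<in> UNIV. (cmod (cinner (e m) (\<gamma> s)))\<^sup>2 \<noteq> 0}"
      by (rule summable_countable_real)
    then show ?thesis by (rule countable_subset[rotated]) (auto simp: N_def e_def)
  qed
  have "\<exists>s. m \<in> N s" if "m \<in> M" for m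
  proof (rule ccontr)
    assume "\<nexists>s. m \<in> N s"
    then have "cinner m m = 0" using that MK unfolding K_def biorth_def N_def by blast
    then show False using on[OF that that] by simp
  qed
  then obtain \<sigma> where \<sigma>: "\<And>m. m \<in> M \<Longrightarrow> m \<in> N (\<sigma> m)" by metis
  define \<iota> where "\<iota> m = (\<sigma> m, to_nat_on (N (\<sigma> m)) m)" for m
  have inj: "inj_on \<iota> M"
  proof (rule inj_onI)
    fix m n assume mn: "m \<in> M" "n \<in> M" "\<iota> m = \<iota> n"
    then have "\<sigma> m = \<sigma> n" "to_nat_on (N (\<sigma> m)) m = to_nat_on (N (\<sigma> m)) n" by (auto simp: \<iota>_def)
    then show "m = n" using \<sigma>[OF mn(1)] \<sigma>[OF mn(2)] inj_on_to_nat_on[OF countN[of "\<sigma> m"]]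
      by (auto dest: inj_onD)
  qed
  define e where "e i = (if i \<in> \<iota> ` M then inv_into M \<iota> i else 0)" for i
  have e\<iota>: "e (\<iota> m) = m" if "m \<in> M" for m unfolding e_def using that inj by simp
  have eM: "e i \<in> M" if "i \<in> \<iota> ` M" for i using that e\<iota> by auto
  show thesis
  proof (rule that[of e "\<iota> ` M"])
    fix i j
    show "cinner (e i) (e j) = (if i = j \<and> i \<in> \<iota> ` M then 1 else 0)"
    proof (cases "i \<in> \<iota> ` M \<and> j \<in> \<iota> ` M")
      case True
      then have "e i = e j \<longleftrightarrow> i = j" using e\<iota> by auto
      then show ?thesis using True on[OF eM eM] by simp
    qed (auto simp: e_def)
    show "e i \<in> K"
    proof (cases "i \<in> \<iota> ` M")
      case True then show ?thesis using eM MK by blast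
    next
      case False then show ?thesis by (simp add: e_def K_def biorth_def)
    qed
  next
    fix x assume x: "x \<in> K" "\<And>i. cinner (e i) x = 0"
    show "x = 0"
    proof (rule ccontr)
      assume nz: "x \<noteq> 0"
      define y where "y = complex_of_real (inverse (norm x)) *\<^sub>C x"
      have mx: "cinner m x = 0" if "m \<in> M" for m using x(2)[of "\<iota> m"] e\<iota>[OF that] by simp
      have xm: "cinner x m = 0" if "m \<in> M" for m using mx[OF that] by (subst cinner_commute) simp
      have "norm y = 1" using nz unfolding y_def by (simp add: norm_scaleC_hilbert norm_inverse)
      then have yy: "cinner y y = 1" by (simp add: cinner_self)
      have "y \<notin> M" using mx[of y] yy unfolding y_def by (auto simp: cinner_scaleC_right)
      have "y \<in> K" using x(1) unfolding y_def K_def by (rule biorth_scaleC)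
      then have "insert y M \<in> ons"
        unfolding ons_def using MK on yy mx xm \<open>y \<notin> M\<close>
        by (auto simp: y_def cinner_scaleC_left cinner_scaleC_right)
      then have "insert y M = M" by (rule max) blast
      then show False using \<open>y \<notin> M\<close> by blast
    qed
  qed
qed

text \<open>The graph of the canonical homomorphism from the span of the universal representation.\<close>

inductive_set rep_graph ::
    "('s::inverse_semigroup \<Rightarrow> 'h::chilbert_space bop) \<Rightarrow> ('s univ_space bop \<times> 'h bop) set"
  for \<pi> where
  zero: "(0, 0) \<in> rep_graph \<pi>"
| gen: "(universal_rep s, \<pi> s) \<in> rep_graph \<pi>"
| add: "(a, b) \<in> rep_graph \<pi> \<Longrightarrow> (a', b') \<in> rep_graph \<pi> \<Longrightarrow> (a + a', b + b') \<in> rep_graph \<pi>"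
| scale: "(a, b) \<in> rep_graph \<pi> \<Longrightarrow> (c *\<^sub>C a, c *\<^sub>C b) \<in> rep_graph \<pi>"

lemma rep_graph_bound:
  fixes \<pi> :: "'s::inverse_semigroup \<Rightarrow> 'h::chilbert_space bop"
  assumes \<pi>: "star_representation \<pi>" and ab: "(a, b) \<in> rep_graph \<pi>"
  shows "norm b \<le> norm a"
proof (rule norm_bop_le)
  fix \<eta> :: 'h
  have \<pi>_mult: "\<pi> (s * t) = \<pi> s * \<pi> t" and \<pi>_star: "\<pi> (s\<^sup>\<star>) = adj (\<pi> s)" for s t
    using \<pi> by (auto simp: star_representation_def)
  define K where "K = biorth (range (\<lambda>s. \<pi> s \<bullet>\<^sub>o \<eta>))"
  obtain e :: "'s \<times> nat \<Rightarrow> 'h" and J where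
    e: "\<And>i j. cinner (e i) (e j) = (if i = j \<and> i \<in> J then 1 else 0)" and
    eK: "\<And>i. e i \<in> K" and
    etot: "\<And>x. x \<in> K \<Longrightarrow> (\<And>i. cinner (e i) x = 0) \<Longrightarrow> x = 0"
    using orthonormal_basis_exists[of "\<lambda>s. \<pi> s \<bullet>\<^sub>o \<eta>"] unfolding K_def by blast
  have invK: "\<pi> s \<bullet>\<^sub>o x \<in> K" if "x \<in> K" for s x
    unfolding K_def biorth_def
  proof (intro CollectI allI impI)
    fix y assume y: "\<forall>g\<in>range (\<lambda>s. \<pi> s \<bullet>\<^sub>o \<eta>). cinner y g = 0"
    have "cinner (\<pi> (s\<^sup>\<star>) \<bullet>\<^sub>o y) (\<pi> t \<bullet>\<^sub>o \<eta>) = 0" for t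
      using y by (simp add: \<pi>_star cinner_adj_left flip: bop_mult \<pi>_mult)
    then have "cinner (\<pi> (s\<^sup>\<star>) \<bullet>\<^sub>o y) x = 0" using that unfolding K_def biorth_def by blast
    then show "cinner y (\<pi> s \<bullet>\<^sub>o x) = 0" by (simp add: \<pi>_star cinner_adj_left)
  qed
  define V where "V x = Abs_ell2 (\<lambda>i. cinner (e i) x)" for x
  have V: "ell2_apply (V x) i = cinner (e i) x" for x i
    unfolding V_def using bessel(1)[OF e] by (simp add: Abs_ell2_inverse)
  have V_add: "V (x + y) = V x + V y" for x y by (rule ell2_eqI) (simp add: V cinner_add_right)
  have V_scale: "V (c *\<^sub>C x) = c *\<^sub>C V x" for c x by (rule ell2_eqI) (simp add: V cinner_scaleC_right)
  have V_norm: "norm (V x) \<le> norm x * 1" for x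
    by (rule power2_le_imp_le) (use bessel(2)[OF e] in \<open>auto simp: ell2_norm_sq[of "V x"] V\<close>)
  have V_bl: "bounded_linear V"
    by (rule bounded_linear_intro[OF V_add _ V_norm]) (simp add: scaleR_scaleC V_scale)
  have "\<exists>w. \<forall>x. cinner f (V x) = cinner w x" for f
    by (rule riesz_representation)
      (auto intro: bounded_linear_compose[OF bounded_linear_cinner_right V_bl]
        simp: V_scale cinner_scaleC_right)
  then obtain W where W: "\<And>f x. cinner f (V x) = cinner (W f) x" by metis
  have W': "cinner (V x) f = cinner x (W f)" for f x by (metis W cinner_commute)
  have ext: "u = v" if "\<And>y. cinner u y = cinner v y" for u v :: 'h
    by (rule cinner_ext) (metis that cinner_commute)
  have W_add: "W (f + g) = W f + W g" for f g by (rule ext) (simp add: W[symmetric] cinner_add_left)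
  have W_scale: "W (c *\<^sub>C f) = c *\<^sub>C W f" for c f
    by (rule ext) (simp add: W[symmetric] cinner_scaleC_left)
  have W_norm: "norm (W f) \<le> norm f * 1" for f
  proof (cases "W f = 0")
    case False
    have "(norm (W f))\<^sup>2 = cmod (cinner (W f) (W f))" by (simp add: cinner_self norm_power)
    also have "\<dots> = cmod (cinner f (V (W f)))" by (simp add: W)
    also have "\<dots> \<le> norm f * norm (W f)"
      by (rule order_trans[OF cauchy_schwarz]) (use V_norm in \<open>auto intro: mult_left_mono\<close>)
    finally show ?thesis using False by (simp add: power2_eq_square)
  qed simp
  have WK: "W f \<in> K" for f
    unfolding K_def biorth_def
  proof (intro CollectI allI impI)
    fix y assume y: "\<forall>g\<in>range (\<lambda>s. \<pi> s \<bullet>\<^sub>o \<eta>). cinner y g = 0"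
    have "cinner y (e i) = 0" for i using eK[of i] y unfolding K_def biorth_def by blast
    then have "cinner (e i) y = 0" for i by (subst cinner_commute) simp
    then have "V y = 0" by (intro ell2_eqI) (simp add: V)
    then show "cinner y (W f) = 0" by (simp add: W'[symmetric])
  qed
  have Ve: "V (e i) = (if i \<in> J then delta i else 0)" for i
    by (rule ell2_eqI) (auto simp: V e delta.rep_eq)
  have e0: "e i = 0" if "i \<notin> J" for i
    using e[of i i] that by (simp add: cinner_self)
  have VW: "V (W (V x)) = V x" for x
  proof (rule ell2_eqI)
    fix i
    have "cinner (e i) (W (V x)) = cinner (V (e i)) (V x)" by (simp add: W')
    also have "\<dots> = cinner (e i) x" using e0[of i] by (simp add: Ve cinner_delta V)
    finally show "ell2_apply (V (W (V x))) i = ell2_apply (V x) i" by (simp add: V)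
  qed
  have V_diff: "V (x - y) = V x - V y" for x y
    using bounded_linear.linear[OF V_bl] by (rule linear_diff)
  have WV: "W (V x) = x" if "x \<in> K" for x
  proof -
    have "x - W (V x) \<in> K" using that WK unfolding K_def by (intro biorth_diff) auto
    moreover have "V (x - W (V x)) = 0" by (simp add: V_diff VW)
    then have "cinner (e i) (x - W (V x)) = 0" for i by (metis V ell2_apply_zero)
    ultimately show ?thesis using etot[of "x - W (V x)"] by simp
  qed
  have V_iso: "norm (V x) = norm x" if "x \<in> K" for x
  proof -
    have "cinner (V x) (V x) = cinner x x" using WV[OF that] by (simp add: W)
    then have "(norm (V x))\<^sup>2 = (norm x)\<^sup>2" unfolding cinner_self of_real_eq_iff .
    then show ?thesis by (rule power2_eq_imp_eq) auto
  qed
  define \<rho> where "\<rho> s = bop_of (\<lambda>f. V (\<pi> s \<bullet>\<^sub>o W f))" for s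
  have W_bl: "bounded_linear W"
    by (rule bounded_linear_intro[OF W_add _ W_norm]) (simp add: scaleR_scaleC W_scale)
  have \<rho>: "\<rho> s \<bullet>\<^sub>o f = V (\<pi> s \<bullet>\<^sub>o W f)" for s f
    unfolding \<rho>_def
    by (rule bop_of_apply)
      (auto intro: bounded_linear_compose[OF V_bl bounded_linear_compose[OF bounded_linear_bop W_bl]]
        simp: W_scale bop_scaleC V_scale)
  have \<rho>_mult: "\<rho> (s * t) = \<rho> s * \<rho> t" for s t
    by (rule bop_eqI) (simp add: \<rho> bop_mult \<pi>_mult WV[OF invK[OF WK]])
  have \<rho>_star: "\<rho> (s\<^sup>\<star>) = adj (\<rho> s)" for s
    by (rule adj_bop_unique[symmetric]) (simp add: \<rho> W W' \<pi>_star cinner_adj_left)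
  have \<rho>_rep: "star_representation \<rho>"
    unfolding star_representation_def partial_isometry_def
    by (simp add: \<rho>_mult[symmetric] \<rho>_star[symmetric] sinv)
  have slice: "ell2_slice \<rho> (a \<bullet>\<^sub>o f) = V (b \<bullet>\<^sub>o W (ell2_slice \<rho> f)) \<and>
      (\<forall>x\<in>K. b \<bullet>\<^sub>o x \<in> K) \<and> ((\<forall>s. \<pi> s \<bullet>\<^sub>o z = 0) \<longrightarrow> b \<bullet>\<^sub>o z = 0)" for f z
    using ab
  proof induction
    case zero
    have "V 0 = 0" by (rule ell2_eqI) (simp add: V)
    then show ?case by (simp add: K_def biorth_def)
  next
    case (gen s)
    show ?case using \<rho>_rep invK by (simp add: universal_rep_slice \<rho>)
  next
    case (add a b a' b')
    have "u + v \<in> K" if "u \<in> K" "v \<in> K" for u v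
      using that unfolding K_def biorth_def by (simp add: cinner_add_right)
    then show ?case using add by (simp add: bop_add_left ell2_slice_add V_add)
  next
    case (scale a b c)
    then show ?case
      by (simp add: bop_scaleC_left ell2_slice_scaleC V_scale) (simp add: K_def biorth_scaleC)
  qed
  define \<xi> where "\<xi> = W (V \<eta>)"
  have \<xi>K: "\<xi> \<in> K" unfolding \<xi>_def by (rule WK)
  have "\<pi> s \<bullet>\<^sub>o (\<eta> - \<xi>) = 0" for s
  proof -
    define w where "w = \<pi> s \<bullet>\<^sub>o (\<eta> - \<xi>)"
    have "\<pi> s \<bullet>\<^sub>o \<eta> \<in> K" unfolding K_def by (rule biorth_superset) simp
    then have wK: "w \<in> K"
      unfolding w_def bop_diff_right using invK[OF \<xi>K] unfolding K_def by (intro biorth_diff)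
    have "V (\<eta> - \<xi>) = 0" unfolding \<xi>_def V_diff VW by simp
    have "cinner w w = cinner (\<pi> (s\<^sup>\<star>) \<bullet>\<^sub>o w) (\<eta> - \<xi>)"
      by (subst (2) w_def) (simp add: \<pi>_star cinner_adj_left)
    also have "\<dots> = cinner (V (\<pi> (s\<^sup>\<star>) \<bullet>\<^sub>o w)) (V (\<eta> - \<xi>))"
      by (simp add: W WV[OF invK[OF wK]])
    also have "\<dots> = 0" by (simp add: \<open>V (\<eta> - \<xi>) = 0\<close>)
    finally show ?thesis by (simp add: cinner_self w_def)
  qed
  then have "b \<bullet>\<^sub>o (\<eta> - \<xi>) = 0" using slice by blast
  then have b\<eta>: "b \<bullet>\<^sub>o \<eta> = b \<bullet>\<^sub>o \<xi>" by (simp add: bop_diff_right)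
  define F where "F = (\<lambda>(\<pi>', i). if \<pi>' = \<rho> then ell2_apply (V \<xi>) i else 0)"
  have "(\<lambda>p. (cmod (F p))\<^sup>2) summable_on (Pair \<rho> ` UNIV)"
    by (subst summable_on_reindex) (auto simp: inj_on_def o_def F_def ell2_apply_summable)
  then have "(\<lambda>p. (cmod (F p))\<^sup>2) summable_on UNIV"
    by (subst summable_on_cong_neutral[where T = "Pair \<rho> ` UNIV"]) (auto simp: F_def)
  then have F: "ell2_apply (Abs_ell2 F) = F" by (simp add: Abs_ell2_inverse)
  have Fs: "ell2_slice k (Abs_ell2 F) = (if k = \<rho> then V \<xi> else 0)" for k
    by (rule ell2_eqI) (simp add: ell2_slice.rep_eq F, simp add: F_def)
  have normF: "norm (Abs_ell2 F) = norm \<xi>"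
  proof -
    have "((\<lambda>k. (norm (ell2_slice k (Abs_ell2 F)))\<^sup>2) has_sum (norm (V \<xi>))\<^sup>2) UNIV"
      using has_sum_finite_neutralI[of "{\<rho>}" UNIV "\<lambda>k. (norm (ell2_slice k (Abs_ell2 F)))\<^sup>2"]
      by (simp add: Fs)
    then have "(norm (Abs_ell2 F))\<^sup>2 = (norm (V \<xi>))\<^sup>2" using ell2_slice_norm has_sum_unique by blast
    then show ?thesis using V_iso[OF \<xi>K] by (simp add: power2_eq_iff_nonneg)
  qed
  have slice_le: "norm (ell2_slice \<rho> g) \<le> norm g" for g
  proof (rule power2_le_imp_le)
    show "(norm (ell2_slice \<rho> g))\<^sup>2 \<le> (norm g)\<^sup>2"
      using finite_sum_le_has_sum[OF ell2_slice_norm[of g], of "{\<rho>}"] by simp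
  qed simp
  have "norm (b \<bullet>\<^sub>o \<eta>) = norm (V (b \<bullet>\<^sub>o \<xi>))" unfolding b\<eta> using V_iso slice \<xi>K by simp
  also have "V (b \<bullet>\<^sub>o \<xi>) = ell2_slice \<rho> (a \<bullet>\<^sub>o Abs_ell2 F)"
    using slice[of "Abs_ell2 F"] by (simp add: Fs WV[OF \<xi>K])
  also have "norm \<dots> \<le> norm (a \<bullet>\<^sub>o Abs_ell2 F)" by (rule slice_le)
  also have "\<dots> \<le> norm a * norm (Abs_ell2 F)" by (rule norm_bop_apply)
  also have "\<dots> \<le> norm a * norm \<eta>"
    unfolding normF \<xi>_def using W_norm[of "V \<eta>"] V_norm[of \<eta>] by (intro mult_left_mono) auto
  finally show "norm (b \<bullet>\<^sub>o \<eta>) \<le> norm a * norm \<eta>" .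
qed simp

theorem universal_property:
  fixes \<pi> :: "'s::inverse_semigroup \<Rightarrow> 'h::chilbert_space bop"
  assumes \<pi>: "star_representation \<pi>"
  obtains \<Phi> :: "'s univ_space bop \<Rightarrow> 'h bop" where
    "\<And>s. \<Phi> (universal_rep s) = \<pi> s"
    "\<And>a b. a \<in> full_cstar TYPE('s) \<Longrightarrow> b \<in> full_cstar TYPE('s) \<Longrightarrow> \<Phi> (a + b) = \<Phi> a + \<Phi> b"
    "\<And>c a. a \<in> full_cstar TYPE('s) \<Longrightarrow> \<Phi> (c *\<^sub>C a) = c *\<^sub>C \<Phi> a"
    "\<And>a b. a \<in> full_cstar TYPE('s) \<Longrightarrow> b \<in> full_cstar TYPE('s) \<Longrightarrow> \<Phi> (a * b) = \<Phi> a * \<Phi> b"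
    "\<And>a. a \<in> full_cstar TYPE('s) \<Longrightarrow> \<Phi> (adj a) = adj (\<Phi> a)"
    "\<And>a. a \<in> full_cstar TYPE('s) \<Longrightarrow> norm (\<Phi> a) \<le> norm a"
proof -
  define G where "G = rep_graph \<pi>"
  define \<Gamma> where "\<Gamma> = {(a, b). \<exists>f g. (\<forall>n::nat. (f n, g n) \<in> G) \<and> f \<longlonglongrightarrow> a \<and> g \<longlonglongrightarrow> b}"
  have rep: "universal_rep (s * t) = universal_rep s * universal_rep t" "\<pi> (s * t) = \<pi> s * \<pi> t"
    "universal_rep (s\<^sup>\<star>) = adj (universal_rep s)" "\<pi> (s\<^sup>\<star>) = adj (\<pi> s)" for s t
    using \<pi> star_representation_universal_rep[where 'a = 's] by (auto simp: star_representation_def)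
  have G_mult: "(a * a', b * b') \<in> G" if "(a, b) \<in> G" "(a', b') \<in> G" for a b a' b'
  proof -
    have gen: "(universal_rep s * a', \<pi> s * b') \<in> G" for s
      using that(2) unfolding G_def
    proof induction
      case (gen t) show ?case using rep_graph.gen[of "s * t" \<pi>] by (simp add: rep)
    qed (auto intro: rep_graph.intros simp: distrib_left mult_scaleC_right)
    show ?thesis
      using that(1) gen unfolding G_def
      by induction (auto intro: rep_graph.intros simp: distrib_right mult_scaleC_left)
  qed
  have G_adj: "(adj a, adj b) \<in> G" if "(a, b) \<in> G" for a b
    using that unfolding G_def
  proof induction
    case (gen s) show ?case using rep_graph.gen[of "s\<^sup>\<star>" \<pi>] by (simp add: rep)
  qed (auto intro: rep_graph.intros simp: adj_add adj_scaleC adj_zero)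
  have \<Gamma>I: "(a, b) \<in> \<Gamma>" if "\<And>n::nat. (f n, g n) \<in> G" "f \<longlonglongrightarrow> a" "g \<longlonglongrightarrow> b" for f g a b
    using that unfolding \<Gamma>_def by blast
  have G\<Gamma>: "(a, b) \<in> \<Gamma>" if "(a, b) \<in> G" for a b
    using that by (intro \<Gamma>I[of "\<lambda>_. a" "\<lambda>_. b"]) auto
  have \<Gamma>_add: "(a + a', b + b') \<in> \<Gamma>" and \<Gamma>_mult: "(a * a', b * b') \<in> \<Gamma>"
    if "(a, b) \<in> \<Gamma>" "(a', b') \<in> \<Gamma>" for a b a' b'
  proof -
    from that obtain f g f' g' where fg: "\<And>n::nat. (f n, g n) \<in> G" "f \<longlonglongrightarrow> a" "g \<longlonglongrightarrow> b"
      "\<And>n::nat. (f' n, g' n) \<in> G" "f' \<longlonglongrightarrow> a'" "g' \<longlonglongrightarrow> b'"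
      unfolding \<Gamma>_def by blast
    show "(a + a', b + b') \<in> \<Gamma>"
      by (rule \<Gamma>I[of "\<lambda>n. f n + f' n" "\<lambda>n. g n + g' n"])
        (use fg in \<open>auto simp: G_def intro: rep_graph.add tendsto_add\<close>)
    show "(a * a', b * b') \<in> \<Gamma>"
      by (rule \<Gamma>I[of "\<lambda>n. f n * f' n" "\<lambda>n. g n * g' n"]) (use fg in \<open>auto intro: G_mult tendsto_mult\<close>)
  qed
  have \<Gamma>_scale: "(c *\<^sub>C a, c *\<^sub>C b) \<in> \<Gamma>" and \<Gamma>_adj: "(adj a, adj b) \<in> \<Gamma>" if "(a, b) \<in> \<Gamma>" for a b c
  proof -
    from that obtain f g where fg: "\<And>n::nat. (f n, g n) \<in> G" "f \<longlonglongrightarrow> a" "g \<longlonglongrightarrow> b"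
      unfolding \<Gamma>_def by blast
    show "(c *\<^sub>C a, c *\<^sub>C b) \<in> \<Gamma>"
      by (rule \<Gamma>I[of "\<lambda>n. c *\<^sub>C f n" "\<lambda>n. c *\<^sub>C g n"])
        (use fg in \<open>auto simp: G_def intro: rep_graph.scale bounded_linear.tendsto[OF bounded_linear_scaleC_cstar]\<close>)
    show "(adj a, adj b) \<in> \<Gamma>"
      by (rule \<Gamma>I[of "\<lambda>n. adj (f n)" "\<lambda>n. adj (g n)"])
        (use fg in \<open>auto intro: G_adj bounded_linear.tendsto[OF bounded_linear_adj]\<close>)
  qed
  have \<Gamma>_norm: "norm b \<le> norm a" if "(a, b) \<in> \<Gamma>" for a b
  proof -
    from that obtain f g where fg: "\<And>n::nat. (f n, g n) \<in> G" "f \<longlonglongrightarrow> a" "g \<longlonglongrightarrow> b"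
      unfolding \<Gamma>_def by blast
    have "norm (g n) \<le> norm (f n)" for n
      using fg(1) unfolding G_def by (rule rep_graph_bound[OF \<pi>])
    then show ?thesis using tendsto_norm[OF fg(2)] tendsto_norm[OF fg(3)] by (blast intro: LIMSEQ_le)
  qed
  have \<Gamma>_diff: "(a - a', b - b') \<in> \<Gamma>" if "(a, b) \<in> \<Gamma>" "(a', b') \<in> \<Gamma>" for a b a' b'
    using \<Gamma>_add[OF that(1) \<Gamma>_scale[OF that(2), of "- 1"]] by (simp add: scaleC_minus1)
  have \<Gamma>_unique: "b = b'" if "(a, b) \<in> \<Gamma>" "(a, b') \<in> \<Gamma>" for a b b'
    using \<Gamma>_norm[OF \<Gamma>_diff[OF that]] by simp
  have "cstar_subalgebra (fst ` \<Gamma>)"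
    unfolding cstar_subalgebra_def complex_vector.subspace_def
  proof (intro conjI ballI allI)
    show "0 \<in> fst ` \<Gamma>" using G\<Gamma>[of 0 0] rep_graph.zero unfolding G_def by force
    show "closed (fst ` \<Gamma>)"
      unfolding closed_sequential_limits
    proof (intro allI impI, elim conjE)
      fix f a assume "\<forall>n. f n \<in> fst ` \<Gamma>" and lim: "f \<longlonglongrightarrow> a"
      then have "\<forall>n. \<exists>b. (f n, b) \<in> \<Gamma>" by force
      from choice[OF this] obtain g where g: "\<And>n. (f n, g n) \<in> \<Gamma>" by blast
      have "Cauchy g"
      proof (rule metric_CauchyI)
        fix e :: real assume "0 < e"
        then obtain M where M: "\<And>m n. m \<ge> M \<Longrightarrow> n \<ge> M \<Longrightarrow> dist (f m) (f n) < e"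
          using LIMSEQ_imp_Cauchy[OF lim] unfolding Cauchy_def by blast
        have "dist (g m) (g n) \<le> dist (f m) (f n)" for m n
          unfolding dist_norm by (rule \<Gamma>_norm[OF \<Gamma>_diff[OF g g]])
        then show "\<exists>M. \<forall>m\<ge>M. \<forall>n\<ge>M. dist (g m) (g n) < e" using M le_less_trans by blast
      qed
      then obtain b where b: "g \<longlonglongrightarrow> b" using Cauchy_convergent convergentD by blast
      have "\<exists>u v. (u, v) \<in> G \<and> dist u (f n) < 1 / Suc n \<and> dist v (g n) < 1 / Suc n" for n
      proof -
        obtain f' g' where fg: "\<And>k::nat. (f' k, g' k) \<in> G" "f' \<longlonglongrightarrow> f n" "g' \<longlonglongrightarrow> g n"
          using g[of n] unfolding \<Gamma>_def by blast
        have "\<forall>\<^sub>F k in sequentially. dist (f' k) (f n) < 1 / Suc n \<and> dist (g' k) (g n) < 1 / Suc n"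
          by (intro eventually_conj tendstoD fg) auto
        then obtain k where "dist (f' k) (f n) < 1 / Suc n \<and> dist (g' k) (g n) < 1 / Suc n"
          unfolding eventually_sequentially by blast
        then show ?thesis using fg(1) by blast
      qed
      then have "\<forall>n. \<exists>p. p \<in> G \<and> dist (fst p) (f n) < 1 / Suc n \<and> dist (snd p) (g n) < 1 / Suc n"
        by fastforce
      from choice[OF this] obtain p where p: "\<And>n. p n \<in> G" "\<And>n. dist (fst (p n)) (f n) < 1 / Suc n"
        "\<And>n. dist (snd (p n)) (g n) < 1 / Suc n" by blast
      have "(a, b) \<in> \<Gamma>"
        by (rule \<Gamma>I[of "\<lambda>n. fst (p n)" "\<lambda>n. snd (p n)"])
          (use p(1) tendsto_of_dist_less[OF p(2) lim] tendsto_of_dist_less[OF p(3) b] in auto)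
      then show "a \<in> fst ` \<Gamma>" by force
    qed
    have fst\<Gamma>: "a \<in> fst ` \<Gamma>" if "(a, b) \<in> \<Gamma>" for a b using that by force
    fix a a' c assume "a \<in> fst ` \<Gamma>"
    then obtain b where b: "(a, b) \<in> \<Gamma>" by auto
    show "c *\<^sub>C a \<in> fst ` \<Gamma>" by (rule fst\<Gamma>[OF \<Gamma>_scale[OF b]])
    show "adj a \<in> fst ` \<Gamma>" by (rule fst\<Gamma>[OF \<Gamma>_adj[OF b]])
    assume "a' \<in> fst ` \<Gamma>"
    then obtain b' where b': "(a', b') \<in> \<Gamma>" by auto
    show "a + a' \<in> fst ` \<Gamma>" by (rule fst\<Gamma>[OF \<Gamma>_add[OF b b']])
    show "a * a' \<in> fst ` \<Gamma>" by (rule fst\<Gamma>[OF \<Gamma>_mult[OF b b']])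
  qed
  moreover have "range universal_rep \<subseteq> fst ` \<Gamma>"
    using G\<Gamma> rep_graph.gen[of _ \<pi>] unfolding G_def by force
  ultimately have sub: "full_cstar TYPE('s) \<subseteq> fst ` \<Gamma>"
    unfolding full_cstar_def cstar_generated_def by blast
  define \<Phi> where "\<Phi> a = (THE b. (a, b) \<in> \<Gamma>)" for a
  have \<Phi>I: "\<Phi> a = b" if "(a, b) \<in> \<Gamma>" for a b
    unfolding \<Phi>_def using that \<Gamma>_unique by blast
  have \<Phi>: "(a, \<Phi> a) \<in> \<Gamma>" if "a \<in> full_cstar TYPE('s)" for a
    using that sub \<Phi>I by force
  show thesis
  proof (rule that[of \<Phi>])
    show "\<Phi> (universal_rep s) = \<pi> s" for s
      using G\<Gamma> rep_graph.gen[of s \<pi>] unfolding G_def by (intro \<Phi>I)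
  qed (auto intro!: \<Phi>I \<Gamma>_add \<Gamma>_mult \<Gamma>_scale \<Gamma>_adj \<Gamma>_norm \<Phi>)
qed


section \<open>The reduced C*-algebra of an inverse semigroup\<close>

definition left_regular_rep :: "'s::inverse_semigroup \<Rightarrow> 's ell2 bop"
  where "left_regular_rep s = (THE T. \<forall>t. T \<bullet>\<^sub>o delta t =
    (if s\<^sup>\<star> * s * (t * t\<^sup>\<star>) = t * t\<^sup>\<star> then delta (s * t) else 0))"

lemma bop_eq_on_delta:
  assumes "\<And>t. S \<bullet>\<^sub>o delta t = T \<bullet>\<^sub>o delta t"
  shows "S = T"
proof -
  have "adj S = adj T"
  proof (intro bop_eqI ell2_eqI)
    fix y t show "ell2_apply (adj S \<bullet>\<^sub>o y) t = ell2_apply (adj T \<bullet>\<^sub>o y) t"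
      unfolding cinner_delta[symmetric] cinner_adj_right by (simp add: assms)
  qed
  then show ?thesis by (metis adj_adj)
qed

lemma left_regular_rep_delta:
  "left_regular_rep s \<bullet>\<^sub>o delta t =
    (if s\<^sup>\<star> * s * (t * t\<^sup>\<star>) = t * t\<^sup>\<star> then delta (s * t) else 0)"
proof -
  let ?P = "\<lambda>T. \<forall>t. T \<bullet>\<^sub>o delta t =
    (if s\<^sup>\<star> * s * (t * t\<^sup>\<star>) = t * t\<^sup>\<star> then delta (s * t) else 0)"
  define F where "F f r = (if s * s\<^sup>\<star> * r = r then ell2_apply f (s\<^sup>\<star> * r) else 0)" for f r
  have dom: "s\<^sup>\<star> * s * (t * t\<^sup>\<star>) = t * t\<^sup>\<star> \<longleftrightarrow> s\<^sup>\<star> * s * t = t" for t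
    by (metis sinv(1) mult.assoc)
  define R where "R = {r. s * s\<^sup>\<star> * r = r}"
  have inj: "inj_on (\<lambda>r. s\<^sup>\<star> * r) R"
  proof (rule inj_onI)
    fix r r' assume "r \<in> R" "r' \<in> R" "s\<^sup>\<star> * r = s\<^sup>\<star> * r'"
    then have "r = s * (s\<^sup>\<star> * r)" "r' = s * (s\<^sup>\<star> * r')" "s * (s\<^sup>\<star> * r) = s * (s\<^sup>\<star> * r')"
      by (auto simp: R_def mult.assoc)
    then show "r = r'" by simp
  qed
  have summ: "((\<lambda>r. (cmod (F f r))\<^sup>2) summable_on UNIV)" and
    sum_le: "(\<Sum>\<^sub>\<infinity>r. (cmod (F f r))\<^sup>2) \<le> (norm f)\<^sup>2" for f
  proof -
    have s1: "(\<lambda>r. (cmod (ell2_apply f r))\<^sup>2) summable_on ((\<lambda>r. s\<^sup>\<star> * r) ` R)"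
      using ell2_apply_summable by (rule summable_on_subset_banach) simp
    then have s2: "(\<lambda>r. (cmod (ell2_apply f (s\<^sup>\<star> * r)))\<^sup>2) summable_on R"
      using summable_on_reindex[OF inj, of "\<lambda>r. (cmod (ell2_apply f r))\<^sup>2"] by (simp add: o_def)
    show "((\<lambda>r. (cmod (F f r))\<^sup>2) summable_on UNIV)"
      using s2 by (subst summable_on_cong_neutral[where T = R]) (auto simp: F_def R_def)
    have "(\<Sum>\<^sub>\<infinity>r. (cmod (F f r))\<^sup>2) = (\<Sum>\<^sub>\<infinity>r\<in>R. (cmod (ell2_apply f (s\<^sup>\<star> * r)))\<^sup>2)"
      by (rule infsum_cong_neutral) (auto simp: F_def R_def)
    also have "\<dots> = (\<Sum>\<^sub>\<infinity>r\<in>(\<lambda>r. s\<^sup>\<star> * r) ` R. (cmod (ell2_apply f r))\<^sup>2)"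
      using infsum_reindex[OF inj, of "\<lambda>r. (cmod (ell2_apply f r))\<^sup>2"] by (simp add: o_def)
    also have "\<dots> \<le> (norm f)\<^sup>2" unfolding ell2_norm_sq
      by (rule infsum_mono2[OF s1 ell2_apply_summable]) auto
    finally show "(\<Sum>\<^sub>\<infinity>r. (cmod (F f r))\<^sup>2) \<le> (norm f)\<^sup>2" .
  qed
  have app: "ell2_apply (Abs_ell2 (F f)) = F f" for f by (simp add: Abs_ell2_inverse summ)
  have add: "Abs_ell2 (F (f + g)) = Abs_ell2 (F f) + Abs_ell2 (F g)" for f g
    by (rule ell2_eqI) (simp add: app, simp add: F_def)
  have scale: "Abs_ell2 (F (c *\<^sub>C f)) = c *\<^sub>C Abs_ell2 (F f)" for c f
    by (rule ell2_eqI) (simp add: app, simp add: F_def)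
  have bound: "norm (Abs_ell2 (F f)) \<le> norm f * 1" for f
    by (rule power2_le_imp_le) (simp_all add: ell2_norm_sq[of "Abs_ell2 (F f)"] app sum_le)
  have "bounded_linear (\<lambda>f. Abs_ell2 (F f))"
    by (rule bounded_linear_intro[OF add _ bound]) (simp add: scaleR_scaleC scale)
  then have bop: "bop_of (\<lambda>f. Abs_ell2 (F f)) \<bullet>\<^sub>o f = Abs_ell2 (F f)" for f
    using scale by (rule bop_of_apply)
  have "?P (bop_of (\<lambda>f. Abs_ell2 (F f)))"
    unfolding bop
  proof (intro allI ell2_eqI)
    fix t r
    have "s * s\<^sup>\<star> * (s * t) = s * t" "s\<^sup>\<star> * s * (s\<^sup>\<star> * r) = s\<^sup>\<star> * r"
      using sinv[of s] by (simp_all add: mult.assoc[symmetric])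
    then have "(s * s\<^sup>\<star> * r = r \<and> s\<^sup>\<star> * r = t) \<longleftrightarrow> (s\<^sup>\<star> * s * t = t \<and> r = s * t)"
      by (auto simp: mult.assoc)
    then show "ell2_apply (Abs_ell2 (F (delta t))) r =
        ell2_apply (if s\<^sup>\<star> * s * (t * t\<^sup>\<star>) = t * t\<^sup>\<star> then delta (s * t) else 0) r"
      unfolding app F_def dom by (auto simp: delta.rep_eq)
  qed
  moreover have "T = T'" if "?P T" "?P T'" for T T'
    by (rule bop_eq_on_delta) (simp add: that)
  ultimately have "\<exists>!T. ?P T" by blast
  from theI'[OF this] show ?thesis unfolding left_regular_rep_def by blast
qed

definition reduced_cstar :: "'s itself \<Rightarrow> 's::inverse_semigroup ell2 bop set"
  where "reduced_cstar _ = cstar_generated (range (left_regular_rep :: 's \<Rightarrow> _))"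


section \<open>Strong Morita equivalence of C*-algebras\<close>

locale complex_space_on =
  fixes X :: "'x set" and add :: "'x \<Rightarrow> 'x \<Rightarrow> 'x" and zero :: 'x and scale :: "complex \<Rightarrow> 'x \<Rightarrow> 'x"
  assumes add_closed: "x \<in> X \<Longrightarrow> y \<in> X \<Longrightarrow> add x y \<in> X"
    and zero_closed: "zero \<in> X"
    and scale_closed: "x \<in> X \<Longrightarrow> scale c x \<in> X"
    and add_assoc: "x \<in> X \<Longrightarrow> y \<in> X \<Longrightarrow> z \<in> X \<Longrightarrow> add (add x y) z = add x (add y z)"
    and add_commute: "x \<in> X \<Longrightarrow> y \<in> X \<Longrightarrow> add x y = add y x"
    and add_zero: "x \<in> X \<Longrightarrow> add zero x = x"
    and add_inverse: "x \<in> X \<Longrightarrow> add x (scale (- 1) x) = zero"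
    and scale_add_right: "x \<in> X \<Longrightarrow> y \<in> X \<Longrightarrow> scale c (add x y) = add (scale c x) (scale c y)"
    and scale_add_left: "x \<in> X \<Longrightarrow> scale (c + d) x = add (scale c x) (scale d x)"
    and scale_scale: "x \<in> X \<Longrightarrow> scale c (scale d x) = scale (c * d) x"
    and scale_one: "x \<in> X \<Longrightarrow> scale 1 x = x"
begin

definition diff :: "'x \<Rightarrow> 'x \<Rightarrow> 'x"
  where "diff x y = add x (scale (- 1) y)"

end

definition positive_in :: "'a::cstar_algebra set \<Rightarrow> 'a \<Rightarrow> bool"
  where "positive_in A a \<longleftrightarrow> (\<exists>c\<in>A. a = adj c * c)"

locale imprimitivity_bimodule = complex_space_on X add zero scale
  for A :: "'a::cstar_algebra set" and B :: "'b::cstar_algebra set"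
    and X :: "'x set" and add zero scale +
  fixes lmul :: "'a \<Rightarrow> 'x \<Rightarrow> 'x" and rmul :: "'x \<Rightarrow> 'b \<Rightarrow> 'x"
    and linner :: "'x \<Rightarrow> 'x \<Rightarrow> 'a" and rinner :: "'x \<Rightarrow> 'x \<Rightarrow> 'b"
  assumes cstar_subalgebra_left: "cstar_subalgebra A"
    and cstar_subalgebra_right: "cstar_subalgebra B"

    and lmul_closed: "a \<in> A \<Longrightarrow> x \<in> X \<Longrightarrow> lmul a x \<in> X"
    and lmul_add_left: "a \<in> A \<Longrightarrow> a' \<in> A \<Longrightarrow> x \<in> X \<Longrightarrow> lmul (a + a') x = add (lmul a x) (lmul a' x)"
    and lmul_add_right: "a \<in> A \<Longrightarrow> x \<in> X \<Longrightarrow> y \<in> X \<Longrightarrow> lmul a (add x y) = add (lmul a x) (lmul a y)"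
    and lmul_scale_left: "a \<in> A \<Longrightarrow> x \<in> X \<Longrightarrow> lmul (c *\<^sub>C a) x = scale c (lmul a x)"
    and lmul_scale_right: "a \<in> A \<Longrightarrow> x \<in> X \<Longrightarrow> lmul a (scale c x) = scale c (lmul a x)"
    and lmul_mult: "a \<in> A \<Longrightarrow> a' \<in> A \<Longrightarrow> x \<in> X \<Longrightarrow> lmul (a * a') x = lmul a (lmul a' x)"

    and rmul_closed: "x \<in> X \<Longrightarrow> b \<in> B \<Longrightarrow> rmul x b \<in> X"
    and rmul_add_left: "x \<in> X \<Longrightarrow> y \<in> X \<Longrightarrow> b \<in> B \<Longrightarrow> rmul (add x y) b = add (rmul x b) (rmul y b)"
    and rmul_add_right: "x \<in> X \<Longrightarrow> b \<in> B \<Longrightarrow> b' \<in> B \<Longrightarrow> rmul x (b + b') = add (rmul x b) (rmul x b')"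
    and rmul_scale_left: "x \<in> X \<Longrightarrow> b \<in> B \<Longrightarrow> rmul (scale c x) b = scale c (rmul x b)"
    and rmul_scale_right: "x \<in> X \<Longrightarrow> b \<in> B \<Longrightarrow> rmul x (c *\<^sub>C b) = scale c (rmul x b)"
    and rmul_mult: "x \<in> X \<Longrightarrow> b \<in> B \<Longrightarrow> b' \<in> B \<Longrightarrow> rmul x (b * b') = rmul (rmul x b) b'"

    and lmul_rmul_commute: "a \<in> A \<Longrightarrow> x \<in> X \<Longrightarrow> b \<in> B \<Longrightarrow> lmul a (rmul x b) = rmul (lmul a x) b"

    and linner_closed: "x \<in> X \<Longrightarrow> y \<in> X \<Longrightarrow> linner x y \<in> A"
    and linner_add: "x \<in> X \<Longrightarrow> y \<in> X \<Longrightarrow> z \<in> X \<Longrightarrow> linner (add x y) z = linner x z + linner y z"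
    and linner_scale: "x \<in> X \<Longrightarrow> y \<in> X \<Longrightarrow> linner (scale c x) y = c *\<^sub>C linner x y"
    and linner_lmul: "a \<in> A \<Longrightarrow> x \<in> X \<Longrightarrow> y \<in> X \<Longrightarrow> linner (lmul a x) y = a * linner x y"
    and linner_adj: "x \<in> X \<Longrightarrow> y \<in> X \<Longrightarrow> linner y x = adj (linner x y)"
    and linner_positive: "x \<in> X \<Longrightarrow> positive_in A (linner x x)"
    and linner_definite: "x \<in> X \<Longrightarrow> linner x x = 0 \<Longrightarrow> x = zero"
    and linner_full: "closure (cspan {linner x y | x y. x \<in> X \<and> y \<in> X}) = A"
    and linner_complete:
      "Metric_space.mcomplete X (\<lambda>x y. sqrt (norm (linner (diff x y) (diff x y))))"

    and rinner_closed: "x \<in> X \<Longrightarrow> y \<in> X \<Longrightarrow> rinner x y \<in> B"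
    and rinner_add: "x \<in> X \<Longrightarrow> y \<in> X \<Longrightarrow> z \<in> X \<Longrightarrow> rinner x (add y z) = rinner x y + rinner x z"
    and rinner_scale: "x \<in> X \<Longrightarrow> y \<in> X \<Longrightarrow> rinner x (scale c y) = c *\<^sub>C rinner x y"
    and rinner_rmul: "x \<in> X \<Longrightarrow> y \<in> X \<Longrightarrow> b \<in> B \<Longrightarrow> rinner x (rmul y b) = rinner x y * b"
    and rinner_adj: "x \<in> X \<Longrightarrow> y \<in> X \<Longrightarrow> rinner y x = adj (rinner x y)"
    and rinner_positive: "x \<in> X \<Longrightarrow> positive_in B (rinner x x)"
    and rinner_definite: "x \<in> X \<Longrightarrow> rinner x x = 0 \<Longrightarrow> x = zero"
    and rinner_full: "closure (cspan {rinner x y | x y. x \<in> X \<and> y \<in> X}) = B"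
    and rinner_complete:
      "Metric_space.mcomplete X (\<lambda>x y. sqrt (norm (rinner (diff x y) (diff x y))))"

    and rinner_lmul: "a \<in> A \<Longrightarrow> x \<in> X \<Longrightarrow> y \<in> X \<Longrightarrow> rinner (lmul a x) y = rinner x (lmul (adj a) y)"
    and linner_rmul: "x \<in> X \<Longrightarrow> y \<in> X \<Longrightarrow> b \<in> B \<Longrightarrow> linner (rmul x b) y = linner x (rmul y (adj b))"
    and linner_rinner: "x \<in> X \<Longrightarrow> y \<in> X \<Longrightarrow> z \<in> X \<Longrightarrow> lmul (linner x y) z = rmul x (rinner y z)"

text \<open>Every imprimitivity bimodule \<open>X\<close> of \<open>A\<close> and \<open>B\<close> is isomorphic to one whose carrier is a set of
  sequences in \<open>A \<times> B\<close>, so fixing this carrier type is no restriction: approximating the elements of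
  a dense subset of \<open>B\<close> by finite sums of inner products gives a set \<open>Y \<subseteq> X\<close> with no more elements
  than \<open>B\<close> (if \<open>B\<close> is infinite, that is, nonzero) such that the linear span of \<open>A Y\<close> is dense
  in \<open>X\<close>; thus \<open>X\<close> has at most as many elements as there are sequences in \<open>A \<times> B\<close>.\<close>

definition strongly_morita_equivalent ::
    "'a::cstar_algebra set \<Rightarrow> 'b::cstar_algebra set \<Rightarrow> bool"
  where "strongly_morita_equivalent A B \<longleftrightarrow>
    (\<exists>(X :: (nat \<Rightarrow> 'a \<times> 'b) set) add zero scale lmul rmul linner rinner.
      imprimitivity_bimodule A B X add zero scale lmul rmul linner rinner)"

end

theory Submission
  imports Defs
begin

text \<open>
  If operators \<open>\<theta> x\<close> on a Hilbert space satisfy \<open>\<theta> x (\<theta> y)\<^sup>* = \<sigma> \<langle>x, y\<rangle>\<close> and \<open>(\<theta> x)\<^sup>* \<theta> y = \<tau> [x, y]\<close> for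
  *-representations \<open>\<sigma>\<close> of \<open>S\<close> and \<open>\<tau>\<close> of \<open>T\<close>, then the closed linear span of the \<open>\<theta> x\<close> is an
  imprimitivity bimodule between the C*-algebras generated by \<open>\<sigma>\<close> and \<open>\<tau>\<close>, with inner products
  \<open>z w\<^sup>*\<close> and \<open>z\<^sup>* w\<close>. A representation \<open>\<tau>\<close> on \<open>H\<close> yields such operators \<open>h \<mapsto> x \<otimes> h\<close> from \<open>H\<close> to the
  induced space \<open>X \<otimes> H\<close>, where \<open>S\<close> acts by the induced representation. Starting from the
  universal (regular) representation of \<open>T\<close> and, symmetrically, of \<open>S\<close>, and adding the two
  resulting families of operators, one obtains \<open>\<sigma>\<close> and \<open>\<tau>\<close> that contain the universal (regular)
  representations and are dominated by them in norm, so they generate isometric copies of the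
  given algebras. As \<open>X\<close> is countable and the projections onto the subspaces \<open>x \<otimes> H\<close> commute,
  \<open>X \<otimes> H\<close> can be realised inside \<open>\<ell>\<^sup>2(\<nat>) \<otimes> H\<close> by the Gram-Schmidt process; inducing the
  regular representation of \<open>T\<close> instead gives \<open>\<ell>\<^sup>2(X)\<close>, whose \<open>S\<close>-invariant fibres embed in \<open>\<ell>\<^sup>2(S)\<close>.
\<close>

section \<open>Inverse semigroups and Morita contexts\<close>

lemma sinv_unique: "s * t * s = s \<Longrightarrow> t * s * t = t \<Longrightarrow> s\<^sup>\<star> = t"
  using ex1_inverse[of s] sinv[of s] by blast

lemma sinv_sinv [simp]: "(s\<^sup>\<star>)\<^sup>\<star> = s"
  by (rule sinv_unique) (fact sinv)+

lemma sinv_idem: "e * e = e \<Longrightarrow> e\<^sup>\<star> = e"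
  by (rule sinv_unique) simp_all

text \<open>For \<open>a\<close> the inverse of \<open>e * f\<close>, the element
  \<open>f * a * e\<close> is also an inverse of \<open>e * f\<close>, so it equals
  \<open>a\<close>. This form makes \<open>a\<close> idempotent, hence its own inverse, hence equal
  to \<open>e * f\<close>.\<close>

lemma idem_mult_idem:
  fixes e f :: "'s::inverse_semigroup"
  assumes e: "e * e = e" and f: "f * f = f"
  shows "e * f * (e * f) = e * f"
proof -
  define a where "a = (e * f)\<^sup>\<star>"
  have a1: "e * f * a * (e * f) = e * f" and a2: "a * (e * f) * a = a"
    unfolding a_def by (fact sinv)+
  have ee: "e * (e * u) = e * u" and ff: "f * (f * u) = f * u" for u
    using e f by (metis mult.assoc)+
  have a2': "a * (e * (f * (a * u))) = a * u" for u
    using a2 by (metis mult.assoc)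
  have "a = f * a * e"
    unfolding a_def by (rule sinv_unique)
      (use a1 in \<open>simp_all add: a_def[symmetric] mult.assoc ee ff a2'\<close>)
  then have "a * a = a" by (metis a2' mult.assoc)
  then have "a\<^sup>\<star> = a" by (rule sinv_idem)
  then have "e * f = a" unfolding a_def by simp
  then show ?thesis using \<open>a * a = a\<close> by simp
qed

text \<open>Both products are idempotent, so \<open>f * e\<close> is an inverse of
  \<open>e * f\<close>; but an idempotent is its own inverse.\<close>

lemma idem_commute:
  fixes e f :: "'s::inverse_semigroup"
  assumes e: "e * e = e" and f: "f * f = f"
  shows "e * f = f * e"
proof -
  have ee: "e * (e * u) = e * u" and ff: "f * (f * u) = f * u" for u
    using e f by (metis mult.assoc)+
  have "(e * f)\<^sup>\<star> = f * e"
    by (rule sinv_unique)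
      (use idem_mult_idem[OF e f] idem_mult_idem[OF f e] in \<open>simp_all add: mult.assoc ee ff\<close>)
  then show ?thesis using sinv_idem[OF idem_mult_idem[OF e f]] by simp
qed

lemma sinv_mult_idem: "s\<^sup>\<star> * s * (s\<^sup>\<star> * s) = s\<^sup>\<star> * s" "s * s\<^sup>\<star> * (s * s\<^sup>\<star>) = s * s\<^sup>\<star>"
  using sinv by (metis mult.assoc)+

lemma sinv_mult: "(s * t)\<^sup>\<star> = t\<^sup>\<star> * s\<^sup>\<star>"
proof (rule sinv_unique)
  have c: "t * t\<^sup>\<star> * (s\<^sup>\<star> * s) = s\<^sup>\<star> * s * (t * t\<^sup>\<star>)"
    by (intro idem_commute sinv_mult_idem)
  have "s * t * (t\<^sup>\<star> * s\<^sup>\<star>) * (s * t) = s * (t * t\<^sup>\<star> * (s\<^sup>\<star> * s)) * t" by (simp add: mult.assoc)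
  also have "\<dots> = s * s\<^sup>\<star> * s * (t * t\<^sup>\<star> * t)" unfolding c by (simp add: mult.assoc)
  finally show "s * t * (t\<^sup>\<star> * s\<^sup>\<star>) * (s * t) = s * t" by (simp add: sinv)
  have "t\<^sup>\<star> * s\<^sup>\<star> * (s * t) * (t\<^sup>\<star> * s\<^sup>\<star>) = t\<^sup>\<star> * (s\<^sup>\<star> * s * (t * t\<^sup>\<star>)) * s\<^sup>\<star>" by (simp add: mult.assoc)
  also have "\<dots> = t\<^sup>\<star> * t * t\<^sup>\<star> * (s\<^sup>\<star> * s * s\<^sup>\<star>)" unfolding c[symmetric] by (simp add: mult.assoc)
  finally show "t\<^sup>\<star> * s\<^sup>\<star> * (s * t) * (t\<^sup>\<star> * s\<^sup>\<star>) = t\<^sup>\<star> * s\<^sup>\<star>" by (simp add: sinv)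
qed

section \<open>Consequences of the Morita context axioms\<close>

context morita_context
begin

lemma rpair_ract_left: "rpair (ract x t) y = t\<^sup>\<star> * rpair x y"
  by (metis rpair_swap rpair_ract sinv_mult)

lemma lpair_lact_right: "lpair x (lact s y) = lpair x y * s\<^sup>\<star>"
  by (metis lpair_swap lpair_lact sinv_mult)

lemma lpair_ex: obtains x y where "s = lpair x y"
  using lpair_surj by (metis (mono_tags, lifting) case_prod_conv surjD surj_pair)

lemma rpair_ex: obtains x y where "t = rpair x y"
  using rpair_surj by (metis (mono_tags, lifting) case_prod_conv surjD surj_pair)

text \<open>Surjectivity allows \<open>s\<close> to be written as <u, v>, and <u, v> y = u [v, y]
  then trades the left action for a right one.\<close>

lemma rpair_lact: "rpair x (lact s y) = rpair (lact (s\<^sup>\<star>) x) y"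
proof -
  obtain u v where s: "s = lpair u v" by (rule lpair_ex)
  have "rpair x (lact s y) = rpair x u * rpair v y" unfolding s lpair_rpair rpair_ract ..
  also have "\<dots> = rpair (lact (s\<^sup>\<star>) x) y"
    unfolding s lpair_swap[symmetric] lpair_rpair rpair_ract_left rpair_swap[symmetric] ..
  finally show ?thesis .
qed

lemma lpair_idem: "lpair x x * lpair x x = lpair x x"
  by (metis lpair_lact lpair_self)

lemma rpair_idem: "rpair x x * rpair x x = rpair x x"
  by (metis rpair_ract rpair_self)

lemma lact_idem_commute:
  "e * e = e \<Longrightarrow> f * f = f \<Longrightarrow> lact e (lact f x) = lact f (lact e x)"
  by (metis lact_mult idem_commute)

text \<open>The dual module, on the same set: inverses turn left actions into right ones. Every
  construction that starts from T thereby becomes available for S.\<close>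

lemma morita_context_opposite:
  "morita_context (\<lambda>t x. ract x (t\<^sup>\<star>)) (\<lambda>x s. lact (s\<^sup>\<star>) x) rpair lpair"
proof
  show "surj (\<lambda>(x, y). rpair x y)" "surj (\<lambda>(x, y). lpair x y)"
    by (fact rpair_surj lpair_surj)+
  show "ract z ((rpair x y)\<^sup>\<star>) = lact ((lpair y z)\<^sup>\<star>) x" for x y z
    by (simp add: lpair_rpair lpair_swap[symmetric] rpair_swap[symmetric])
  show "rpair x y = (rpair y x)\<^sup>\<star>" "lpair x y = (lpair y x)\<^sup>\<star>" for x y
    by (fact rpair_swap lpair_swap)+
  show "lact ((lpair x x)\<^sup>\<star>) x = x" "ract x ((rpair x x)\<^sup>\<star>) = x" for x
    by (simp_all add: lpair_swap[symmetric] rpair_swap[symmetric] lpair_self rpair_self)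
qed (simp_all add: sinv_mult lact_mult ract_mult lact_ract_commute rpair_ract_left lpair_lact_right)

text \<open>A base point of the fibre of x |-> [x, x] over \<open>f\<close>; arbitrary when that
  fibre is empty.\<close>

definition fibre_base :: "'t \<Rightarrow> 'x"
  where "fibre_base f = (SOME x. rpair x x = f)"

text \<open>With b the base point of the fibre of x, <x, b> b = x [b, b] = x [x, x] = x. Hence <x,
  b> serves as a coordinate of x within its fibre.\<close>

lemma lact_fibre_base: "lact (lpair x (fibre_base (rpair x x))) (fibre_base (rpair x x)) = x"
proof -
  have "rpair (fibre_base (rpair x x)) (fibre_base (rpair x x)) = rpair x x"
    unfolding fibre_base_def by (rule someI) (rule refl)
  then show ?thesis by (simp add: lpair_rpair rpair_self)
qed

lemma fibre_coordinate_eqD: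
  assumes "rpair x x = rpair y y" "lpair x (fibre_base (rpair x x)) = lpair y (fibre_base (rpair y y))"
  shows "x = y"
  by (metis assms lact_fibre_base)

text \<open>The index \<open>rpair x x\<close> of the fibre together with the coordinate of
  \<open>x\<close> in it embeds the module into T x S.\<close>

lemma countable_module:
  assumes "countable (UNIV :: 's set)" "countable (UNIV :: 't set)"
  shows "countable (UNIV :: 'x set)"
proof (rule countable_image_inj_on)
  let ?\<iota> = "\<lambda>x. (rpair x x, lpair x (fibre_base (rpair x x)))"
  have "countable (UNIV :: ('t \<times> 's) set)"
    using countable_SIGMA[OF assms(2), of "\<lambda>_. UNIV"] assms(1) by simp
  then show "countable (range ?\<iota>)" by (rule countable_subset[OF subset_UNIV])
  show "inj ?\<iota>"
    by (rule injI) (use fibre_coordinate_eqD in blast)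
qed

end

section \<open>Square roots of positive operators\<close>

text \<open>The coefficients of the power series \<open>f(x) = 1 - \<surd>(1 - x)\<close>, read off from \<open>f\<^sup>2 = 2 f - x\<close>.\<close>

function sqrt_coeff :: "nat \<Rightarrow> real" where
  "sqrt_coeff n = (if n = 0 then 0 else if n = 1 then 1 / 2
    else (\<Sum>i\<in>{1..<n}. sqrt_coeff i * sqrt_coeff (n - i)) / 2)"
  by auto
termination by (relation less_than) auto

declare sqrt_coeff.simps [simp del]

lemma sqrt_coeff_0 [simp]: "sqrt_coeff 0 = 0"
  and sqrt_coeff_1 [simp]: "sqrt_coeff (Suc 0) = 1 / 2"
  by (simp_all add: sqrt_coeff.simps)

lemma sqrt_coeff_nonneg: "0 \<le> sqrt_coeff n"
proof (induction n rule: less_induct)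
  case (less n)
  then show ?case by (subst sqrt_coeff.simps) (auto intro!: sum_nonneg mult_nonneg_nonneg)
qed

text \<open>This is f^2 = 2 f - x read coefficientwise; the end terms of the convolution vanish
  because f has no constant term.\<close>

lemma sqrt_coeff_convolution:
  "(\<Sum>i\<le>k. sqrt_coeff i * sqrt_coeff (k - i)) = 2 * sqrt_coeff k - (if k = 1 then 1 else 0)"
proof -
  consider "k = 0" | "k = 1" | "k \<ge> 2" by linarith
  then show ?thesis
  proof cases
    case 3
    have "(\<Sum>i\<le>k. sqrt_coeff i * sqrt_coeff (k - i)) = (\<Sum>i\<in>{1..<k}. sqrt_coeff i * sqrt_coeff (k - i))"
    proof (rule sum.mono_neutral_right)
      have "i = 0 \<or> i = k" if "i \<in> {..k} - {1..<k}" for i using that by auto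
      then show "\<forall>i\<in>{..k} - {1..<k}. sqrt_coeff i * sqrt_coeff (k - i) = 0" by fastforce
    qed auto
    then show ?thesis using 3 sqrt_coeff.simps[of k] by simp
  qed auto
qed

text \<open>Let s_n be the n-th partial sum. Summing the convolution identity gives 2 s_{n+1} - 1 as
  a sum over i + j \<le> n + 1. Terms with an index n + 1 carry the zero coefficient of index 0, so
  the sum is at most s_n^2 \<le> 1.\<close>

lemma sum_sqrt_coeff_le: "(\<Sum>k\<le>n. sqrt_coeff k) \<le> 1"
proof (induction n)
  case (Suc n)
  have "(\<Sum>k\<le>Suc n. if k = 1 then 1 else (0::real)) = 1" by simp
  then have "2 * (\<Sum>k\<le>Suc n. sqrt_coeff k) - 1 = (\<Sum>k\<le>Suc n. \<Sum>i\<le>k. sqrt_coeff i * sqrt_coeff (k - i))"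
    unfolding sqrt_coeff_convolution sum_subtractf sum_distrib_left by simp
  also have "\<dots> = (\<Sum>(i, j)\<in>{(i, j). i + j \<le> Suc n}. sqrt_coeff i * sqrt_coeff j)"
    by (rule sum.triangle_reindex_eq[symmetric])
  also have "\<dots> = (\<Sum>(i, j)\<in>{(i, j). i + j \<le> Suc n} \<inter> {..n} \<times> {..n}. sqrt_coeff i * sqrt_coeff j)"
  proof (rule sum.mono_neutral_right)
    show "finite {(i, j). i + j \<le> Suc n}"
      by (rule finite_subset[of _ "{..Suc n} \<times> {..Suc n}"]) auto
    have "i = 0 \<or> j = 0" if "i + j \<le> Suc n" "\<not> (i \<le> n \<and> j \<le> n)" for i j using that by auto
    then show "\<forall>p\<in>{(i, j). i + j \<le> Suc n} - {(i, j). i + j \<le> Suc n} \<inter> {..n} \<times> {..n}.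
        (case p of (i, j) \<Rightarrow> sqrt_coeff i * sqrt_coeff j) = 0" by fastforce
  qed auto
  also have "\<dots> \<le> (\<Sum>(i, j)\<in>{..n} \<times> {..n}. sqrt_coeff i * sqrt_coeff j)"
    by (rule sum_mono2) (auto intro: mult_nonneg_nonneg sqrt_coeff_nonneg)
  also have "\<dots> = (\<Sum>k\<le>n. sqrt_coeff k) * (\<Sum>k\<le>n. sqrt_coeff k)"
    by (simp add: sum_product sum.cartesian_product)
  also have "\<dots> \<le> 1 * 1" using Suc by (intro mult_mono sum_nonneg sqrt_coeff_nonneg) auto
  finally show ?case by simp
qed simp

text \<open>The Cauchy product shows that the sum L satisfies L^2 = 2 L - 1, that is, (L - 1)^2 =
  0.\<close>

lemma sqrt_coeff_sums: "sqrt_coeff sums 1"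
proof -
  have s: "summable sqrt_coeff"
    by (rule bounded_imp_summable[of _ 1]) (simp_all add: sqrt_coeff_nonneg sum_sqrt_coeff_le)
  then have n: "summable (\<lambda>n. norm (sqrt_coeff n))" by (simp add: sqrt_coeff_nonneg)
  have "(\<lambda>k. 2 * sqrt_coeff k - (if k = 1 then 1 else 0)) sums (suminf sqrt_coeff * suminf sqrt_coeff)"
    using Cauchy_product_sums[OF n n] unfolding sqrt_coeff_convolution .
  moreover have "(\<lambda>k. 2 * sqrt_coeff k - (if k = 1 then 1 else 0)) sums (2 * suminf sqrt_coeff - 1)"
    using sums_single[of 1 "\<lambda>_. 1 :: real"] by (intro sums_diff sums_mult summable_sums s) simp
  ultimately have "suminf sqrt_coeff * suminf sqrt_coeff = 2 * suminf sqrt_coeff - 1"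
    by (rule sums_unique2)
  then have "(suminf sqrt_coeff - 1)\<^sup>2 = 0" by (simp add: power2_eq_square algebra_simps)
  then show ?thesis using summable_sums[OF s] by simp
qed

text \<open>With P = \<open>z * adj z\<close>, the root is 1 - f(1 - P) for the series f above,
  which converges in norm since 1 - P is a contraction. Only P, not \<open>z\<close>, is assumed to
  lie in \<open>C\<close>.\<close>

lemma contraction_self_adj_sqrt:
  fixes z :: "'h::chilbert_space bop"
  assumes C: "cstar_subalgebra C" and zz: "z * adj z \<in> C" and z: "norm z \<le> 1"
  obtains c where "c \<in> C" "adj c = c" "c * c = z * adj z"
proof -
  define P where "P = z * adj z"
  have PC: "P \<in> C" and adjP: "adj P = P" using zz by (simp_all add: P_def adj_mult adj_adj)
  define I :: "'h bop" where "I = bop_of (\<lambda>x. x)"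
  have I: "I \<bullet>\<^sub>o x = x" for x unfolding I_def by (rule bop_of_apply) auto
  have I1 [simp]: "I * T = T" and I2 [simp]: "T * I = T" for T by (rule bop_eqI; simp add: bop_mult I)+
  have adjI: "adj I = I" by (rule adj_bop_unique) (simp add: I)
  define q where "q n = ((*) (I - P) ^^ n) I" for n
  have q0 [simp]: "q 0 = I" and qS: "q (Suc n) = (I - P) * q n" for n by (simp_all add: q_def)
  have q_add: "q (m + n) = q m * q n" for m n by (induction m) (simp_all add: qS mult.assoc)
  have q1: "q 1 = I - P" using qS[of 0] by simp
  have q_adj: "adj (q n) = q n" for n
  proof (induction n)
    case (Suc n)
    have "adj (I - P) = I - P"
      by (simp add: linear_diff[OF bounded_linear.linear[OF bounded_linear_adj]] adjI adjP)
    then have "adj (q (Suc n)) = q n * q 1" using Suc by (simp add: qS adj_mult q1)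
    then show ?case by (simp add: q_add[symmetric])
  qed (simp add: adjI)
  \<comment> \<open>For y = \<open>adj z\<close> x the square of the norm of x - z y is |x|^2 - 2
    |y|^2 + |z y|^2, and |z y| \<le> |y|.\<close>
  have norm_IP: "norm (I - P) \<le> 1"
  proof (rule norm_bop_le)
    fix x
    define y where "y = adj z \<bullet>\<^sub>o x"
    have y: "cinner x (z \<bullet>\<^sub>o y) = of_real ((norm y)\<^sup>2)"
      unfolding cinner_self[symmetric] by (subst y_def) (simp add: cinner_adj_left)
    have "norm (z \<bullet>\<^sub>o y) \<le> norm y"
      using norm_bop_apply[of z y] z mult_right_mono[OF z, of "norm y"] by simp
    then have zy: "(norm (z \<bullet>\<^sub>o y))\<^sup>2 \<le> (norm y)\<^sup>2" by (intro power_mono) auto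
    have "(norm ((I - P) \<bullet>\<^sub>o x))\<^sup>2 = (norm (x + - (z \<bullet>\<^sub>o y)))\<^sup>2"
      by (simp add: bop_diff_left I P_def bop_mult y_def)
    also have "\<dots> = (norm x)\<^sup>2 - 2 * (norm y)\<^sup>2 + (norm (z \<bullet>\<^sub>o y))\<^sup>2"
      unfolding norm_add_sq cinner_minus_right y by simp
    also have "\<dots> \<le> (norm x)\<^sup>2" using zy zero_le_power2[of "norm y"] by linarith
    finally have "norm ((I - P) \<bullet>\<^sub>o x) \<le> norm x" by (rule power2_le_imp_le) simp
    then show "norm ((I - P) \<bullet>\<^sub>o x) \<le> 1 * norm x" by simp
  qed simp
  have norm_q: "norm (q n) \<le> 1" for n
  proof (induction n)
    case 0 show ?case by (simp, rule norm_bop_le) (simp_all add: I)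
  next
    case (Suc n)
    have "norm (q (Suc n)) \<le> norm (I - P) * norm (q n)" unfolding qS by (rule norm_mult_ineq)
    also have "\<dots> \<le> 1 * 1" using Suc norm_IP by (intro mult_mono) auto
    finally show ?case by simp
  qed
  define d where "d n = sqrt_coeff n *\<^sub>R q n" for n
  have sumd: "summable (\<lambda>n. norm (d n))"
  proof (rule summable_comparison_test')
    show "summable sqrt_coeff" using sqrt_coeff_sums by (rule sums_summable)
    show "norm (norm (d n)) \<le> sqrt_coeff n" if "n \<ge> 0" for n
      using mult_left_le[OF norm_q[of n] sqrt_coeff_nonneg[of n]] sqrt_coeff_nonneg[of n]
      by (simp add: d_def)
  qed
  then have d: "d sums suminf d" by (rule summable_sums[OF summable_norm_cancel])
  have "(\<Sum>i\<le>k. d i * d (k - i)) = 2 *\<^sub>R d k - (if k = 1 then q 1 else 0)" for k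
  proof -
    have "(\<Sum>i\<le>k. d i * d (k - i)) = (\<Sum>i\<le>k. (sqrt_coeff i * sqrt_coeff (k - i)) *\<^sub>R q k)"
      by (intro sum.cong refl) (simp add: d_def q_add[symmetric])
    also have "\<dots> = (2 * sqrt_coeff k - (if k = 1 then 1 else 0)) *\<^sub>R q k"
      by (simp add: scaleR_sum_left[symmetric] sqrt_coeff_convolution)
    finally show ?thesis by (auto simp: d_def scaleR_diff_left)
  qed
  then have "(\<lambda>k. 2 *\<^sub>R d k - (if k = 1 then q 1 else 0)) sums (suminf d * suminf d)"
    using Cauchy_product_sums[OF sumd sumd] by simp
  moreover have "(\<lambda>k. 2 *\<^sub>R d k - (if k = 1 then q 1 else 0)) sums (2 *\<^sub>R suminf d - q 1)"
    using sums_single[of 1 "\<lambda>_. q 1"] by (intro sums_diff sums_scaleR_right d) simp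
  ultimately have dd: "suminf d * suminf d = 2 *\<^sub>R suminf d - (I - P)"
    unfolding q1[symmetric] by (rule sums_unique2)
  define c where "c = I - suminf d"
  \<comment> \<open>Since the coefficients sum to 1, the identity is absorbed into the terms. Each
    \<open>I - q n\<close> is a polynomial in \<open>P\<close> without constant term, so it lies in
    \<open>C\<close> even when \<open>I\<close> does not.\<close>
  have cs: "(\<lambda>n. sqrt_coeff n *\<^sub>R (I - q n)) sums c"
    using sums_diff[OF bounded_linear.sums[OF bounded_linear_scaleR_left sqrt_coeff_sums, of I] d]
    by (simp add: c_def d_def scaleR_diff_right)
  have sub: "csubspace C" and cl: "closed C" and mult: "\<And>a b. a \<in> C \<Longrightarrow> b \<in> C \<Longrightarrow> a * b \<in> C"
    using C by (auto simp: cstar_subalgebra_def)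
  have IqC: "I - q n \<in> C" for n
  proof (induction n)
    case 0 show ?case using complex_vector.subspace_0[OF sub] by simp
  next
    case (Suc n)
    have e: "I - q (Suc n) = (I - q n) + (P - P * (I - q n))" by (simp add: qS algebra_simps)
    show ?case
      unfolding e
      by (rule complex_vector.subspace_add[OF sub Suc complex_vector.subspace_diff[OF sub PC mult[OF PC Suc]]])
  qed
  show thesis
  proof (rule that[of c])
    show "c \<in> C"
    proof (rule closed_sequentially[OF cl])
      show "(\<lambda>n. \<Sum>k<n. sqrt_coeff k *\<^sub>R (I - q k)) \<longlonglongrightarrow> c" using cs by (simp add: sums_def)
      show "(\<Sum>k<n. sqrt_coeff k *\<^sub>R (I - q k)) \<in> C" for n
        by (intro complex_vector.subspace_sum[OF sub])
          (simp add: scaleR_scaleC complex_vector.subspace_scale[OF sub IqC])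
    qed
    have "adj (d n) = d n" for n by (simp add: d_def scaleR_scaleC adj_scaleC q_adj)
    then have "d sums adj (suminf d)" using bounded_linear.sums[OF bounded_linear_adj d] by simp
    then have "adj (suminf d) = suminf d" using d by (rule sums_unique2)
    then show "adj c = c"
      by (simp add: c_def linear_diff[OF bounded_linear.linear[OF bounded_linear_adj]] adjI)
    show "c * c = z * adj z"
      using dd by (simp add: c_def P_def algebra_simps scaleR_2)
  qed
qed

text \<open>Elements of the bimodule lie outside the coefficient algebra, so \<open>z\<close> cannot
  serve as the witness for positivity; a square root found inside \<open>C\<close> does, after
  scaling \<open>z\<close> to a contraction.\<close>

lemma positive_in_mult_adj:
  fixes z :: "'h::chilbert_space bop"
  assumes C: "cstar_subalgebra C" and zz: "z * adj z \<in> C"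
  shows "positive_in C (z * adj z)"
proof -
  have sub: "csubspace C" using C by (simp add: cstar_subalgebra_def)
  define r where "r = norm z + 1"
  have r: "r > 0" by (simp add: r_def add_nonneg_pos)
  define w where "w = complex_of_real (inverse r) *\<^sub>C z"
  have w: "w * adj w = complex_of_real (inverse r * inverse r) *\<^sub>C (z * adj z)"
    by (simp add: w_def adj_scaleC mult_scaleC_left mult_scaleC_right scaleC_scaleC)
  have "norm w \<le> 1"
    using r by (simp add: w_def norm_scaleC norm_inverse) (simp add: r_def field_simps)
  moreover have "w * adj w \<in> C" unfolding w by (rule complex_vector.subspace_scale[OF sub zz])
  ultimately obtain c where c: "c \<in> C" "adj c = c" "c * c = w * adj w"
    using contraction_self_adj_sqrt[OF C] by blast
  show ?thesis
    unfolding positive_in_def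
  proof (intro bexI)
    show "complex_of_real r *\<^sub>C c \<in> C" by (rule complex_vector.subspace_scale[OF sub c(1)])
    show "z * adj z = adj (complex_of_real r *\<^sub>C c) * (complex_of_real r *\<^sub>C c)"
    proof -
      have "adj (complex_of_real r *\<^sub>C c) * (complex_of_real r *\<^sub>C c) =
          complex_of_real (r * r * (inverse r * inverse r)) *\<^sub>C (z * adj z)"
        by (simp add: adj_scaleC c mult_scaleC_left mult_scaleC_right scaleC_scaleC w)
      also have "r * r * (inverse r * inverse r) = 1" using r by (simp add: field_simps)
      finally show ?thesis by simp
    qed
  qed
qed

section \<open>Isometric identification of the algebras generated by two representations\<close>

lemma star_representationD:
  assumes "star_representation \<pi>"
  shows "\<pi> (s * t) = \<pi> s * \<pi> t" "\<pi> (s\<^sup>\<star>) = adj (\<pi> s)"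
  using assms by (auto simp: star_representation_def)

lemma star_representationI:
  assumes "\<And>s t. \<pi> (s * t) = \<pi> s * \<pi> t" "\<And>s. \<pi> (s\<^sup>\<star>) = adj (\<pi> s)"
  shows "star_representation \<pi>"
  unfolding star_representation_def partial_isometry_def
  by (simp add: assms[symmetric] sinv)

text \<open>Pairs of linear combinations with equal coefficients. A relation is used because the
  correspondence is a map only once norms have been compared.\<close>

inductive_set pair_span :: "('s \<Rightarrow> 'a::complex_vector) \<Rightarrow> ('s \<Rightarrow> 'b::complex_vector) \<Rightarrow> ('a \<times> 'b) set"
  for \<alpha> \<sigma> where
  zero: "(0, 0) \<in> pair_span \<alpha> \<sigma>"
| gen: "(\<alpha> s, \<sigma> s) \<in> pair_span \<alpha> \<sigma>"
| add: "(a, b) \<in> pair_span \<alpha> \<sigma> \<Longrightarrow> (a', b') \<in> pair_span \<alpha> \<sigma> \<Longrightarrow> (a + a', b + b') \<in> pair_span \<alpha> \<sigma>"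
| scale: "(a, b) \<in> pair_span \<alpha> \<sigma> \<Longrightarrow> (c *\<^sub>C a, c *\<^sub>C b) \<in> pair_span \<alpha> \<sigma>"

lemma pair_span_swapD: "(a, b) \<in> pair_span \<alpha> \<sigma> \<Longrightarrow> (b, a) \<in> pair_span \<sigma> \<alpha>"
  by (induction rule: pair_span.induct) (auto intro: pair_span.intros)

lemma closure_binop:
  fixes f :: "'a::topological_space \<Rightarrow> 'b::topological_space \<Rightarrow> 'c::topological_space"
  assumes "continuous_on UNIV (\<lambda>p. f (fst p) (snd p))" "\<And>x y. x \<in> A \<Longrightarrow> y \<in> B \<Longrightarrow> f x y \<in> closure C"
    and "x \<in> closure A" "y \<in> closure B"
  shows "f x y \<in> closure C"
proof -
  have "(\<lambda>p. f (fst p) (snd p)) ` closure (A \<times> B) \<subseteq> closure C"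
    by (rule image_closure_subset) (use assms(1,2) in \<open>auto intro: continuous_on_subset\<close>)
  then show ?thesis using assms(3,4) unfolding closure_Times by force
qed

text \<open>Used to pass the algebraic operations from a span of pairs to its closure, the graph of
  the extended map.\<close>

lemma closure_pair_binop:
  assumes "continuous_on UNIV (\<lambda>p. f (fst p) (snd p))" "continuous_on UNIV (\<lambda>p. g (fst p) (snd p))"
    and base: "\<And>a b a' b'. (a, b) \<in> P \<Longrightarrow> (a', b') \<in> Q \<Longrightarrow> (f a a', g b b') \<in> R"
    and "(a, b) \<in> closure P" "(a', b') \<in> closure Q"
  shows "(f a a', g b b') \<in> closure R"
proof -
  have "(f (fst (a, b)) (fst (a', b')), g (snd (a, b)) (snd (a', b'))) \<in> closure R"
  proof (rule closure_binop[OF _ _ assms(4,5)])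
    have "continuous_on UNIV (\<lambda>p. f (fst (fst p)) (fst (snd p)))"
      using continuous_on_compose2[OF assms(1), of UNIV "\<lambda>p. (fst (fst p), fst (snd p))"]
      by (simp add: continuous_intros)
    moreover have "continuous_on UNIV (\<lambda>p. g (snd (fst p)) (snd (snd p)))"
      using continuous_on_compose2[OF assms(2), of UNIV "\<lambda>p. (snd (fst p), snd (snd p))"]
      by (simp add: continuous_intros)
    ultimately show "continuous_on UNIV (\<lambda>p. (f (fst (fst p)) (fst (snd p)), g (snd (fst p)) (snd (snd p))))"
      by (rule continuous_on_Pair)
    show "(f (fst p) (fst q), g (snd p) (snd q)) \<in> closure R" if "p \<in> P" "q \<in> Q" for p q
      using base[of "fst p" "snd p" "fst q" "snd q"] that closure_subset by auto
  qed
  then show ?thesis by simp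
qed

lemma continuous_on_adj: "continuous_on S f \<Longrightarrow> continuous_on S (\<lambda>x. adj (f x :: 'a::cstar_algebra))"
  by (rule bounded_linear.continuous_on[OF bounded_linear_adj])

lemma continuous_on_scaleC: "continuous_on S f \<Longrightarrow> continuous_on S (\<lambda>x. c *\<^sub>C (f x :: 'a::cstar_algebra))"
  by (rule bounded_linear.continuous_on[OF bounded_linear_scaleC_cstar])

lemma csubspace_closure:
  fixes S :: "'a::cstar_algebra set"
  assumes "csubspace S"
  shows "csubspace (closure S)"
proof (rule complex_vector.subspaceI)
  show "0 \<in> closure S" using complex_vector.subspace_0[OF assms] closure_subset by blast
  show "x + y \<in> closure S" if "x \<in> closure S" "y \<in> closure S" for x y
    by (rule closure_binop[OF _ _ that])
      (auto intro!: continuous_intros subsetD[OF closure_subset] complex_vector.subspace_add[OF assms])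
  show "c *\<^sub>C x \<in> closure S" if "x \<in> closure S" for c x
    by (rule closure_binop[OF _ _ that that, of "\<lambda>x _. c *\<^sub>C x"])
      (auto intro!: continuous_intros continuous_on_scaleC subsetD[OF closure_subset] complex_vector.subspace_scale[OF assms])
qed

text \<open>The map between the generated algebras that takes \<open>\<alpha> s\<close> to \<open>\<sigma> s\<close>.\<close>

definition rep_ext :: "('s \<Rightarrow> 'a::cstar_algebra) \<Rightarrow> ('s \<Rightarrow> 'b::cstar_algebra) \<Rightarrow> 'a \<Rightarrow> 'b"
  where "rep_ext \<alpha> \<sigma> a = (THE b. (a, b) \<in> closure (pair_span \<alpha> \<sigma>))"

text \<open>Equality of norms on linear combinations makes the correspondence extend to an isometric
  *-isomorphism between the generated algebras.\<close>

locale isometric_pair =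
  fixes \<alpha> :: "'s::inverse_semigroup \<Rightarrow> 'h::chilbert_space bop"
    and \<sigma> :: "'s \<Rightarrow> 'k::chilbert_space bop"
  assumes rep_dom: "star_representation \<alpha>" and rep_cod: "star_representation \<sigma>"
    and norm_pair_span: "(a, b) \<in> pair_span \<alpha> \<sigma> \<Longrightarrow> norm b = norm a"

lemma isometric_pair_swap: "isometric_pair \<alpha> \<sigma> \<Longrightarrow> isometric_pair \<sigma> \<alpha>"
  unfolding isometric_pair_def by (metis pair_span_swapD)

context isometric_pair
begin

lemma graph_add: "(a, b) \<in> closure (pair_span \<alpha> \<sigma>) \<Longrightarrow> (a', b') \<in> closure (pair_span \<alpha> \<sigma>) \<Longrightarrow>
    (a + a', b + b') \<in> closure (pair_span \<alpha> \<sigma>)"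
  by (rule closure_pair_binop[of "(+)" "(+)"]) (auto intro!: continuous_intros intro: pair_span.add)

lemma graph_mult:
  assumes "(a, b) \<in> closure (pair_span \<alpha> \<sigma>)" "(a', b') \<in> closure (pair_span \<alpha> \<sigma>)"
  shows "(a * a', b * b') \<in> closure (pair_span \<alpha> \<sigma>)"
proof -
  have "(a * a', b * b') \<in> pair_span \<alpha> \<sigma>"
    if "(a, b) \<in> pair_span \<alpha> \<sigma>" "(a', b') \<in> pair_span \<alpha> \<sigma>" for a b a' b'
  proof -
    have gen: "(\<alpha> s * a', \<sigma> s * b') \<in> pair_span \<alpha> \<sigma>" for s
      using that(2)
    proof induction
      case (gen t) show ?case using pair_span.gen[of \<alpha> "s * t" \<sigma>]
        by (simp add: star_representationD[OF rep_dom] star_representationD[OF rep_cod])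
    qed (auto intro: pair_span.intros simp: distrib_left mult_scaleC_right)
    show ?thesis
      using that(1) gen by induction (auto intro: pair_span.intros simp: distrib_right mult_scaleC_left)
  qed
  then show ?thesis
    using assms by (intro closure_pair_binop[of "(*)" "(*)"]) (auto intro!: continuous_intros)
qed

lemma graph_scale:
  assumes "(a, b) \<in> closure (pair_span \<alpha> \<sigma>)"
  shows "(c *\<^sub>C a, c *\<^sub>C b) \<in> closure (pair_span \<alpha> \<sigma>)"
  by (rule closure_pair_binop[of "\<lambda>a _. c *\<^sub>C a" "\<lambda>b _. c *\<^sub>C b", OF _ _ _ assms assms])
    (auto intro!: continuous_intros continuous_on_scaleC intro: pair_span.scale)

lemma graph_adj:
  assumes "(a, b) \<in> closure (pair_span \<alpha> \<sigma>)"
  shows "(adj a, adj b) \<in> closure (pair_span \<alpha> \<sigma>)"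
proof -
  have "(adj a, adj b) \<in> pair_span \<alpha> \<sigma>" if "(a, b) \<in> pair_span \<alpha> \<sigma>" for a b
    using that
  proof induction
    case (gen s) show ?case using pair_span.gen[of \<alpha> "s\<^sup>\<star>" \<sigma>]
      by (simp add: star_representationD[OF rep_dom] star_representationD[OF rep_cod])
  qed (auto intro: pair_span.intros simp: adj_add adj_scaleC adj_zero)
  then show ?thesis
    by (intro closure_pair_binop[of "\<lambda>a _. adj a" "\<lambda>b _. adj b", OF _ _ _ assms assms])
      (auto intro!: continuous_intros continuous_on_adj)
qed

lemma graph_gen: "(\<alpha> s, \<sigma> s) \<in> closure (pair_span \<alpha> \<sigma>)"
  using closure_subset pair_span.gen by fast

lemma graph_norm:
  assumes "(a, b) \<in> closure (pair_span \<alpha> \<sigma>)"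
  shows "norm b = norm a"
proof -
  have "closed {p :: 'h bop \<times> 'k bop. norm (snd p) = norm (fst p)}"
    by (intro closed_Collect_eq continuous_intros)
  then have "closure (pair_span \<alpha> \<sigma>) \<subseteq> {p. norm (snd p) = norm (fst p)}"
    by (intro closure_minimal) (use norm_pair_span in auto)
  then show ?thesis using assms by auto
qed

lemma graph_diff: "(a, b) \<in> closure (pair_span \<alpha> \<sigma>) \<Longrightarrow> (a', b') \<in> closure (pair_span \<alpha> \<sigma>) \<Longrightarrow>
    (a - a', b - b') \<in> closure (pair_span \<alpha> \<sigma>)"
  using graph_add[OF _ graph_scale[of a' b' "- 1"]] by (simp add: scaleC_minus1)

text \<open>If \<open>b\<close> and \<open>b'\<close> both correspond to \<open>a\<close>, then
  \<open>b' - b\<close> corresponds to 0 and so has norm 0.\<close>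

lemma rep_ext_eqI:
  assumes "(a, b) \<in> closure (pair_span \<alpha> \<sigma>)"
  shows "rep_ext \<alpha> \<sigma> a = b"
  unfolding rep_ext_def
proof (rule the_equality)
  show "(a, b) \<in> closure (pair_span \<alpha> \<sigma>)" by (rule assms)
  show "b' = b" if "(a, b') \<in> closure (pair_span \<alpha> \<sigma>)" for b'
    using graph_norm[OF graph_diff[OF that assms]] by simp
qed

text \<open>The domain of the closed graph is itself a C*-subalgebra. It is closed because a
  convergent sequence of first components has Cauchy second components, by isometry.\<close>

lemma fst_graph: "fst ` closure (pair_span \<alpha> \<sigma>) = cstar_generated (range \<alpha>)"
proof
  have sub: "cstar_subalgebra (cstar_generated (range \<alpha>))" by (rule cstar_subalgebra_generated)
  have "a \<in> cstar_generated (range \<alpha>)" if "(a, b) \<in> pair_span \<alpha> \<sigma>" for a b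
    using that
  proof induction
    case (gen s) show ?case using subset_cstar_generated[of "range \<alpha>"] by auto
  qed (use sub in \<open>auto simp: cstar_subalgebra_def complex_vector.subspace_def\<close>)
  then have "fst ` pair_span \<alpha> \<sigma> \<subseteq> cstar_generated (range \<alpha>)" by auto
  moreover have "closed (cstar_generated (range \<alpha>))" using sub by (simp add: cstar_subalgebra_def)
  ultimately show "fst ` closure (pair_span \<alpha> \<sigma>) \<subseteq> cstar_generated (range \<alpha>)"
    by (intro image_closure_subset continuous_intros)
  have I: "a \<in> fst ` closure (pair_span \<alpha> \<sigma>)" if "(a, b) \<in> closure (pair_span \<alpha> \<sigma>)" for a b
    using that by force
  have "cstar_subalgebra (fst ` closure (pair_span \<alpha> \<sigma>))"
    unfolding cstar_subalgebra_def complex_vector.subspace_def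
  proof (intro conjI ballI allI)
    show "0 \<in> fst ` closure (pair_span \<alpha> \<sigma>)"
      by (rule I[of 0 0]) (rule subsetD[OF closure_subset pair_span.zero])
    show "closed (fst ` closure (pair_span \<alpha> \<sigma>))"
      unfolding closed_sequential_limits
    proof (intro allI impI, elim conjE)
      fix f a assume "\<forall>n. f n \<in> fst ` closure (pair_span \<alpha> \<sigma>)" and lim: "f \<longlonglongrightarrow> a"
      then have "\<forall>n. \<exists>b. (f n, b) \<in> closure (pair_span \<alpha> \<sigma>)" by force
      from choice[OF this] obtain g where g: "\<And>n. (f n, g n) \<in> closure (pair_span \<alpha> \<sigma>)" by blast
      have "dist (g m) (g n) = dist (f m) (f n)" for m n
        unfolding dist_norm by (rule graph_norm[OF graph_diff[OF g g]])
      then have "Cauchy g" using LIMSEQ_imp_Cauchy[OF lim] by (simp add: Cauchy_def)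
      then obtain b where "g \<longlonglongrightarrow> b" using Cauchy_convergent convergentD by blast
      then have "(\<lambda>n. (f n, g n)) \<longlonglongrightarrow> (a, b)" using lim by (intro tendsto_Pair)
      then have "(a, b) \<in> closure (pair_span \<alpha> \<sigma>)"
        by (rule closed_sequentially[OF closed_closure, rotated]) (rule g)
      then show "a \<in> fst ` closure (pair_span \<alpha> \<sigma>)" by (rule I)
    qed
    fix a a' c assume "a \<in> fst ` closure (pair_span \<alpha> \<sigma>)"
    then obtain b where b: "(a, b) \<in> closure (pair_span \<alpha> \<sigma>)" by auto
    show "c *\<^sub>C a \<in> fst ` closure (pair_span \<alpha> \<sigma>)" by (rule I[OF graph_scale[OF b]])
    show "adj a \<in> fst ` closure (pair_span \<alpha> \<sigma>)" by (rule I[OF graph_adj[OF b]])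
    assume "a' \<in> fst ` closure (pair_span \<alpha> \<sigma>)"
    then obtain b' where b': "(a', b') \<in> closure (pair_span \<alpha> \<sigma>)" by auto
    show "a + a' \<in> fst ` closure (pair_span \<alpha> \<sigma>)" by (rule I[OF graph_add[OF b b']])
    show "a * a' \<in> fst ` closure (pair_span \<alpha> \<sigma>)" by (rule I[OF graph_mult[OF b b']])
  qed
  moreover have "range \<alpha> \<subseteq> fst ` closure (pair_span \<alpha> \<sigma>)" using I graph_gen by auto
  ultimately show "cstar_generated (range \<alpha>) \<subseteq> fst ` closure (pair_span \<alpha> \<sigma>)"
    unfolding cstar_generated_def by blast
qed

lemma rep_ext_graph: "a \<in> cstar_generated (range \<alpha>) \<Longrightarrow> (a, rep_ext \<alpha> \<sigma> a) \<in> closure (pair_span \<alpha> \<sigma>)"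
  unfolding fst_graph[symmetric] using rep_ext_eqI by force

lemma generated_subset_closure: "cstar_generated (range \<alpha>) \<subseteq> closure (fst ` pair_span \<alpha> \<sigma>)"
  unfolding fst_graph[symmetric]
  by (intro image_closure_subset continuous_intros closure_subset closed_closure)

lemma graph_swap:
  assumes "(a, b) \<in> closure (pair_span \<alpha> \<sigma>)"
  shows "(b, a) \<in> closure (pair_span \<sigma> \<alpha>)"
proof -
  have "prod.swap ` closure (pair_span \<alpha> \<sigma>) \<subseteq> closure (pair_span \<sigma> \<alpha>)"
  proof (rule image_closure_subset)
    show "prod.swap ` pair_span \<alpha> \<sigma> \<subseteq> closure (pair_span \<sigma> \<alpha>)"
      using closure_subset[of "pair_span \<sigma> \<alpha>"] by (auto dest: pair_span_swapD)
  qed (auto intro: continuous_on_swap)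
  then show ?thesis using assms by force
qed

lemma rep_ext_closed: "a \<in> cstar_generated (range \<alpha>) \<Longrightarrow> rep_ext \<alpha> \<sigma> a \<in> cstar_generated (range \<sigma>)"
  and rep_ext_inverse: "a \<in> cstar_generated (range \<alpha>) \<Longrightarrow> rep_ext \<sigma> \<alpha> (rep_ext \<alpha> \<sigma> a) = a"
proof -
  interpret sw: isometric_pair \<sigma> \<alpha> using isometric_pair_axioms by (rule isometric_pair_swap)
  assume "a \<in> cstar_generated (range \<alpha>)"
  then have g: "(rep_ext \<alpha> \<sigma> a, a) \<in> closure (pair_span \<sigma> \<alpha>)" by (intro graph_swap rep_ext_graph)
  then show "rep_ext \<alpha> \<sigma> a \<in> cstar_generated (range \<sigma>)" unfolding sw.fst_graph[symmetric] by force
  show "rep_ext \<sigma> \<alpha> (rep_ext \<alpha> \<sigma> a) = a" by (rule sw.rep_ext_eqI[OF g])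
qed

lemma rep_ext_gen: "rep_ext \<alpha> \<sigma> (\<alpha> s) = \<sigma> s"
  by (rule rep_ext_eqI[OF graph_gen])

lemma rep_ext_add: "a \<in> cstar_generated (range \<alpha>) \<Longrightarrow> a' \<in> cstar_generated (range \<alpha>) \<Longrightarrow>
    rep_ext \<alpha> \<sigma> (a + a') = rep_ext \<alpha> \<sigma> a + rep_ext \<alpha> \<sigma> a'"
  by (intro rep_ext_eqI graph_add rep_ext_graph)

lemma rep_ext_mult: "a \<in> cstar_generated (range \<alpha>) \<Longrightarrow> a' \<in> cstar_generated (range \<alpha>) \<Longrightarrow>
    rep_ext \<alpha> \<sigma> (a * a') = rep_ext \<alpha> \<sigma> a * rep_ext \<alpha> \<sigma> a'"
  by (intro rep_ext_eqI graph_mult rep_ext_graph)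

lemma rep_ext_scaleC: "a \<in> cstar_generated (range \<alpha>) \<Longrightarrow> rep_ext \<alpha> \<sigma> (c *\<^sub>C a) = c *\<^sub>C rep_ext \<alpha> \<sigma> a"
  by (intro rep_ext_eqI graph_scale rep_ext_graph)

lemma rep_ext_adj: "a \<in> cstar_generated (range \<alpha>) \<Longrightarrow> rep_ext \<alpha> \<sigma> (adj a) = adj (rep_ext \<alpha> \<sigma> a)"
  by (intro rep_ext_eqI graph_adj rep_ext_graph)

lemma norm_rep_ext: "a \<in> cstar_generated (range \<alpha>) \<Longrightarrow> norm (rep_ext \<alpha> \<sigma> a) = norm a"
  by (intro graph_norm rep_ext_graph)

lemma positive_in_rep_ext:
  assumes "positive_in (cstar_generated (range \<alpha>)) a"
  shows "positive_in (cstar_generated (range \<sigma>)) (rep_ext \<alpha> \<sigma> a)"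
proof -
  from assms obtain c where c: "c \<in> cstar_generated (range \<alpha>)" "a = adj c * c"
    unfolding positive_in_def by blast
  moreover have "adj c \<in> cstar_generated (range \<alpha>)"
    using cstar_subalgebra_generated[of "range \<alpha>"] c(1) by (simp add: cstar_subalgebra_def)
  ultimately have "rep_ext \<alpha> \<sigma> a = adj (rep_ext \<alpha> \<sigma> c) * rep_ext \<alpha> \<sigma> c"
    by (simp add: rep_ext_mult rep_ext_adj)
  then show ?thesis unfolding positive_in_def using rep_ext_closed[OF c(1)] by blast
qed

end

section \<open>Imprimitivity bimodules of operators\<close>

lemma cstar_mult_adj_eq_0: "a * adj a = 0 \<Longrightarrow> a = (0 :: 'a::cstar_algebra)"
  using norm_adj_mult_self[of "adj a"] by (simp add: adj_adj norm_adj)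

lemma cstar_adj_mult_eq_0: "adj a * a = 0 \<Longrightarrow> a = (0 :: 'a::cstar_algebra)"
  using norm_adj_mult_self[of a] by simp

lemma adj_diff: "adj (a - b) = adj a - adj (b :: 'a::cstar_algebra)"
  by (rule linear_diff[OF bounded_linear.linear[OF bounded_linear_adj]])

text \<open>Transfers completeness from a closed set of operators to the set that encodes
  it.\<close>

lemma mcomplete_of_isometry:
  fixes dec :: "'u \<Rightarrow> 'k::banach"
  assumes bij: "bij_betw dec X Z" and Z: "closed Z" and d: "\<And>u v. d u v = norm (dec u - dec v)"
  shows "Metric_space.mcomplete X d"
proof -
  have inj: "inj_on dec X" and im: "dec ` X = Z" using bij by (auto simp: bij_betw_def)
  interpret Metric_space X d
  proof
    show "d x z \<le> d x y + d y z" for x y z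
      using norm_triangle_ineq[of "dec x - dec y" "dec y - dec z"] by (simp add: d)
    show "d x y = 0 \<longleftrightarrow> x = y" if "x \<in> X" "y \<in> X" for x y
      using inj_onD[OF inj _ that] by (auto simp: d)
  qed (simp_all add: d norm_minus_commute)
  show ?thesis
    unfolding mcomplete_def
  proof (intro allI impI)
    fix f assume f: "MCauchy f"
    then have fX: "f n \<in> X" for n by (auto simp: MCauchy_def)
    have "Cauchy (\<lambda>n. dec (f n))"
    proof (rule metric_CauchyI)
      fix e :: real assume "0 < e"
      then obtain N where "\<forall>n n'. N \<le> n \<longrightarrow> N \<le> n' \<longrightarrow> norm (dec (f n) - dec (f n')) < e"
        using f unfolding MCauchy_def d by presburger
      then show "\<exists>M. \<forall>m\<ge>M. \<forall>n\<ge>M. dist (dec (f m)) (dec (f n)) < e"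
        by (auto simp: dist_norm intro!: exI[of _ N])
    qed
    then obtain l where l: "(\<lambda>n. dec (f n)) \<longlonglongrightarrow> l" using Cauchy_convergent convergentD by blast
    have "l \<in> Z" by (rule closed_sequentially[OF Z _ l]) (use fX im in blast)
    then obtain x where x: "x \<in> X" "dec x = l" using im by blast
    have "limitin mtopology f x sequentially"
      unfolding limit_metric_sequentially d x(2) using x(1) fX l
      by (simp add: lim_sequentially dist_norm)
    then show "\<exists>x. limitin mtopology f x sequentially" ..
  qed
qed

context morita_context
begin

section \<open>The representation induced by a family of operators\<close>

context
  fixes \<theta> :: "'x \<Rightarrow> 'k::chilbert_space bop"
    and \<tau> :: "'t \<Rightarrow> 'k bop"
  assumes \<tau>: "star_representation \<tau>" and \<theta>\<tau>: "\<And>x y. adj (\<theta> x) * \<theta> y = \<tau> (rpair x y)"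
begin

text \<open>The difference \<open>D\<close> of the two sides satisfies \<open>D\<^sup>* D = 0\<close>.\<close>

lemma module_map_right: "\<theta> x * \<tau> t = \<theta> (ract x t)"
proof -
  let ?D = "\<theta> x * \<tau> t - \<theta> (ract x t)"
  have "adj ?D * ?D = adj (\<tau> t) * (adj (\<theta> x) * \<theta> x) * \<tau> t - adj (\<tau> t) * (adj (\<theta> x) * \<theta> (ract x t))
      - (adj (\<theta> (ract x t)) * \<theta> x) * \<tau> t + adj (\<theta> (ract x t)) * \<theta> (ract x t)"
    by (simp add: adj_diff adj_mult algebra_simps)
  also have "\<dots> = 0"
    unfolding \<theta>\<tau> star_representationD(2)[OF \<tau>, symmetric] star_representationD(1)[OF \<tau>, symmetric]
    by (simp add: rpair_ract rpair_ract_left mult.assoc)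
  finally have "?D = 0" by (rule cstar_adj_mult_eq_0)
  then show ?thesis by simp
qed

lemma module_map_triple: "\<theta> x * adj (\<theta> y) * \<theta> z = \<theta> (lact (lpair x y) z)"
  by (simp add: mult.assoc \<theta>\<tau> module_map_right lpair_rpair)

text \<open>The difference M of the two sides annihilates every \<open>\<theta> z\<close>, by the
  triple product formula. As \<open>adj M\<close> is a difference of products that begin with some
  \<open>\<theta> y\<close>, it follows that \<open>M * adj M = 0\<close>.\<close>

lemma module_map_mult_adj_cong:
  assumes "lpair x y = lpair x' y'"
  shows "\<theta> x * adj (\<theta> y) = \<theta> x' * adj (\<theta> y')"
proof -
  let ?M = "\<theta> x * adj (\<theta> y) - \<theta> x' * adj (\<theta> y')"
  have "?M * \<theta> z = 0" for z
    using assms by (simp add: left_diff_distrib module_map_triple)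
  then have "?M * \<theta> y * adj (\<theta> x) - ?M * \<theta> y' * adj (\<theta> x') = 0" by simp
  then have "?M * adj ?M = 0"
    unfolding adj_diff adj_mult adj_adj right_diff_distrib mult.assoc .
  then have "?M = 0" by (rule cstar_mult_adj_eq_0)
  then show ?thesis by simp
qed

text \<open>By the preceding congruence \<open>\<theta> x * adj (\<theta> y)\<close> depends only on
  <x, y>, and every element of S has this form.\<close>

lemma induced_representation:
  obtains \<sigma> :: "'s \<Rightarrow> 'k bop" where "star_representation \<sigma>" "\<And>x y. \<theta> x * adj (\<theta> y) = \<sigma> (lpair x y)"
proof -
  have "\<forall>s. \<exists>T. \<forall>x y. lpair x y = s \<longrightarrow> \<theta> x * adj (\<theta> y) = T"
  proof
    fix s
    obtain u v where "s = lpair u v" by (rule lpair_ex)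
    then show "\<exists>T. \<forall>x y. lpair x y = s \<longrightarrow> \<theta> x * adj (\<theta> y) = T"
      using module_map_mult_adj_cong by blast
  qed
  from choice[OF this] obtain \<sigma> where \<sigma>: "\<theta> x * adj (\<theta> y) = \<sigma> (lpair x y)" for x y by blast
  show thesis
  proof (rule that[OF star_representationI \<sigma>])
    fix s t
    obtain x y where s: "s = lpair x y" by (rule lpair_ex)
    obtain u v where t: "t = lpair u v" by (rule lpair_ex)
    have "\<sigma> s * \<sigma> t = \<theta> x * adj (\<theta> y) * \<theta> u * adj (\<theta> v)"
      unfolding s t \<sigma>[symmetric] by (simp add: mult.assoc)
    also have "\<dots> = \<sigma> (s * t)" unfolding module_map_triple unfolding \<sigma> lpair_lact s t ..
    finally show "\<sigma> (s * t) = \<sigma> s * \<sigma> t" ..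
    have "\<sigma> (s\<^sup>\<star>) = \<theta> y * adj (\<theta> x)" unfolding s lpair_swap[symmetric] \<sigma> ..
    then show "\<sigma> (s\<^sup>\<star>) = adj (\<sigma> s)" unfolding s \<sigma>[symmetric] by (simp add: adj_mult adj_adj)
  qed
qed

end

text \<open>The bimodule lives on \<open>'k\<close>, where \<open>\<sigma>\<close> and
  \<open>\<tau>\<close> generate copies of the two algebras. Actions are transported along the
  isomorphisms \<open>\<Phi>\<close>, \<open>\<Psi>\<close> and inner products back along their
  inverses. The prescribed carrier type requires operators to be encoded as sequences.\<close>

theorem strongly_morita_equivalent_of_module_map:
  fixes \<theta> :: "'x \<Rightarrow> 'k::chilbert_space bop"
    and \<alpha> :: "'s \<Rightarrow> 'h::chilbert_space bop" and \<beta> :: "'t \<Rightarrow> 'g::chilbert_space bop"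
  assumes countable: "countable (UNIV :: 'x set)"
    and \<alpha>\<sigma>: "isometric_pair \<alpha> \<sigma>" and \<beta>\<tau>: "isometric_pair \<beta> \<tau>"
    and \<theta>\<sigma>: "\<And>x y. \<theta> x * adj (\<theta> y) = \<sigma> (lpair x y)"
    and \<theta>\<tau>: "\<And>x y. adj (\<theta> x) * \<theta> y = \<tau> (rpair x y)"
  shows "strongly_morita_equivalent (cstar_generated (range \<alpha>)) (cstar_generated (range \<beta>))"
proof -
  interpret S: isometric_pair \<alpha> \<sigma> by fact
  interpret S': isometric_pair \<sigma> \<alpha> using \<alpha>\<sigma> by (rule isometric_pair_swap)
  interpret T: isometric_pair \<beta> \<tau> by fact
  interpret T': isometric_pair \<tau> \<beta> using \<beta>\<tau> by (rule isometric_pair_swap)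
  define A where "A = cstar_generated (range \<alpha>)"
  define A' where "A' = cstar_generated (range \<sigma>)"
  define B where "B = cstar_generated (range \<beta>)"
  define B' where "B' = cstar_generated (range \<tau>)"
  define \<Phi> where "\<Phi> = rep_ext \<alpha> \<sigma>"
  define \<Phi>' where "\<Phi>' = rep_ext \<sigma> \<alpha>"
  define \<Psi> where "\<Psi> = rep_ext \<beta> \<tau>"
  define \<Psi>' where "\<Psi>' = rep_ext \<tau> \<beta>"
  note defs = A_def A'_def B_def B'_def \<Phi>_def \<Phi>'_def \<Psi>_def \<Psi>'_def
  have alg: "cstar_subalgebra A" "cstar_subalgebra A'" "cstar_subalgebra B" "cstar_subalgebra B'"
    unfolding defs by (rule cstar_subalgebra_generated)+
  note sub = alg[unfolded cstar_subalgebra_def, THEN conjunct1]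
  have cl: "closed A" "closed A'" "closed B" "closed B'"
    and adjC: "\<And>a. a \<in> A \<Longrightarrow> adj a \<in> A" "\<And>a. a \<in> B \<Longrightarrow> adj a \<in> B"
    and multC: "\<And>a a'. a \<in> A \<Longrightarrow> a' \<in> A \<Longrightarrow> a * a' \<in> A" "\<And>b b'. b \<in> B \<Longrightarrow> b' \<in> B \<Longrightarrow> b * b' \<in> B"
    using alg by (auto simp: cstar_subalgebra_def)
  \<comment> \<open>In this list and the next, item 6 says that the primed map undoes the unprimed
    one, and item 12 the converse.\<close>
  note \<Phi> = S.rep_ext_add[folded defs] S.rep_ext_mult[folded defs] S.rep_ext_scaleC[folded defs]
    S.rep_ext_adj[folded defs] S.rep_ext_closed[folded defs] S.rep_ext_inverse[folded defs]
    S'.rep_ext_add[folded defs] S'.rep_ext_mult[folded defs] S'.rep_ext_scaleC[folded defs]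
    S'.rep_ext_adj[folded defs] S'.rep_ext_closed[folded defs] S'.rep_ext_inverse[folded defs]
    S'.norm_rep_ext[folded defs]
  note \<Psi> = T.rep_ext_add[folded defs] T.rep_ext_mult[folded defs] T.rep_ext_scaleC[folded defs]
    T.rep_ext_adj[folded defs] T.rep_ext_closed[folded defs] T.rep_ext_inverse[folded defs]
    T'.rep_ext_add[folded defs] T'.rep_ext_mult[folded defs] T'.rep_ext_scaleC[folded defs]
    T'.rep_ext_adj[folded defs] T'.rep_ext_closed[folded defs] T'.rep_ext_inverse[folded defs]
    T'.norm_rep_ext[folded defs]
  have \<sigma>\<theta>: "\<sigma> s * \<theta> x = \<theta> (lact s x)" for s x
  proof -
    obtain u v where s: "s = lpair u v" by (rule lpair_ex)
    show ?thesis unfolding s \<theta>\<sigma>[symmetric] by (rule module_map_triple[OF T.rep_cod \<theta>\<tau>])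
  qed
  note \<theta>\<tau>' = module_map_right[OF T.rep_cod \<theta>\<tau>]
  define Z0 where "Z0 = cspan (range \<theta>)"
  define Z where "Z = closure Z0"
  have Z0: "csubspace Z0" unfolding Z0_def by (rule complex_vector.subspace_span)
  have Zsub: "csubspace Z" unfolding Z_def by (rule csubspace_closure[OF Z0])
  have Zcl: "closed Z" unfolding Z_def by simp
  have \<theta>Z0: "\<theta> x \<in> Z0" for x unfolding Z0_def by (rule complex_vector.span_base) simp
  have \<theta>Z: "\<theta> x \<in> Z" for x unfolding Z_def using \<theta>Z0 closure_subset by blast
  have Z_induct: "P z" if "z \<in> Z0" "P 0" "\<And>x. P (\<theta> x)"
      "\<And>y z. P y \<Longrightarrow> P z \<Longrightarrow> P (y + z)" "\<And>c z. P z \<Longrightarrow> P (c *\<^sub>C z)" for P z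
    using that(1) unfolding Z0_def
  proof (induction rule: complex_vector.span_induct_alt)
    case (step c x y)
    then show ?case using that(3,4,5) by auto
  qed (rule that(2))
  have \<Phi>Z: "\<Phi> a * z \<in> Z" if "a \<in> A" "z \<in> Z" for a z
  proof -
    have *: "b * z \<in> Z0" if "(a, b) \<in> pair_span \<alpha> \<sigma>" "z \<in> Z0" for a b z
      using that
    proof (induction rule: pair_span.induct)
      case (gen s)
      from gen show ?case
        by (rule Z_induct)
          (use Z0 in \<open>auto simp: \<sigma>\<theta> \<theta>Z0 distrib_left mult_scaleC_right complex_vector.subspace_def\<close>)
    qed (use Z0 in \<open>auto simp: distrib_right mult_scaleC_left complex_vector.subspace_def\<close>)
    have g: "(a, \<Phi> a) \<in> closure (pair_span \<alpha> \<sigma>)"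
      using S.rep_ext_graph[of a] that(1) by (simp add: defs)
    have "snd (a, \<Phi> a) * z \<in> Z"
      unfolding Z_def
      by (rule closure_binop[OF _ _ g that(2)[unfolded Z_def]])
        (auto intro!: continuous_intros subsetD[OF closure_subset *])
    then show ?thesis by simp
  qed
  have Z\<Psi>: "z * \<Psi> b \<in> Z" if "b \<in> B" "z \<in> Z" for b z
  proof -
    have *: "z * b \<in> Z0" if "(a, b) \<in> pair_span \<beta> \<tau>" "z \<in> Z0" for a b z
      using that
    proof (induction rule: pair_span.induct)
      case (gen t)
      from gen show ?case
        by (rule Z_induct)
          (use Z0 in \<open>auto simp: \<theta>\<tau>' \<theta>Z0 distrib_right mult_scaleC_left complex_vector.subspace_def\<close>)
    qed (use Z0 in \<open>auto simp: distrib_left mult_scaleC_right complex_vector.subspace_def\<close>)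
    have g: "(b, \<Psi> b) \<in> closure (pair_span \<beta> \<tau>)"
      using T.rep_ext_graph[of b] that(1) by (simp add: defs)
    have "z * snd (b, \<Psi> b) \<in> Z"
      unfolding Z_def
      by (rule closure_binop[OF _ _ that(2)[unfolded Z_def] g])
        (auto intro!: continuous_intros subsetD[OF closure_subset *])
    then show ?thesis by simp
  qed
  have ZZA: "z * adj w \<in> A'" if "z \<in> Z" "w \<in> Z" for z w
  proof -
    have gen: "\<theta> x * adj (\<theta> y) \<in> A'" for x y
      using subset_cstar_generated[of "range \<sigma>"] by (auto simp: \<theta>\<sigma> A'_def)
    have base: "\<theta> x * adj w \<in> A'" if "w \<in> Z0" for x w
      using that by (rule Z_induct)
        (use sub(2) gen in \<open>auto simp: adj_zero adj_add adj_scaleC distrib_left mult_scaleC_right complex_vector.subspace_def\<close>)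
    have *: "z * adj w \<in> A'" if "z \<in> Z0" "w \<in> Z0" for z w
      using that(1) by (rule Z_induct)
        (use sub(2) base[OF that(2)] in \<open>auto simp: distrib_right mult_scaleC_left complex_vector.subspace_def\<close>)
    have "z * adj w \<in> closure A'"
      by (rule closure_binop[of "\<lambda>z w. z * adj w", OF _ _ that[unfolded Z_def]])
        (auto intro!: continuous_intros continuous_on_adj subsetD[OF closure_subset *])
    then show ?thesis using cl(2) by simp
  qed
  have ZZB: "adj z * w \<in> B'" if "z \<in> Z" "w \<in> Z" for z w
  proof -
    have gen: "adj (\<theta> x) * \<theta> y \<in> B'" for x y
      using subset_cstar_generated[of "range \<tau>"] by (auto simp: \<theta>\<tau> B'_def)
    have base: "adj (\<theta> x) * w \<in> B'" if "w \<in> Z0" for x w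
      using that by (rule Z_induct)
        (use sub(4) gen in \<open>auto simp: distrib_left mult_scaleC_right complex_vector.subspace_def\<close>)
    have *: "adj z * w \<in> B'" if "z \<in> Z0" "w \<in> Z0" for z w
      using that(1) by (rule Z_induct)
        (use sub(4) base[OF that(2)] in \<open>auto simp: adj_zero adj_add adj_scaleC distrib_right mult_scaleC_left complex_vector.subspace_def\<close>)
    have "adj z * w \<in> closure B'"
      by (rule closure_binop[of "\<lambda>z w. adj z * w", OF _ _ that[unfolded Z_def]])
        (auto intro!: continuous_intros continuous_on_adj subsetD[OF closure_subset *])
    then show ?thesis using cl(4) by simp
  qed
  define \<xi> :: "nat \<Rightarrow> 'x" where "\<xi> = from_nat_into UNIV"
  have \<xi>: "\<exists>n. \<xi> n = x" for x
    unfolding \<xi>_def using from_nat_into_surj[OF countable, of x] by auto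
  \<comment> \<open>By linearity and continuity such a \<open>z\<close> also satisfies
    \<open>z * adj z = 0\<close>. So an operator in \<open>Z\<close> is determined by its products
    with the \<open>adj (\<theta> x)\<close>.\<close>
  have Z_zero: "z = 0" if "z \<in> Z" "\<And>x. z * adj (\<theta> x) = 0" for z
  proof -
    have "z * adj w = 0" if "w \<in> Z0" for w
      using that by (rule Z_induct)
        (auto simp: adj_zero adj_add adj_scaleC distrib_left mult_scaleC_right \<open>\<And>x. z * adj (\<theta> x) = 0\<close>)
    then have "(\<lambda>w. z * adj w) ` Z \<subseteq> {0}"
      unfolding Z_def by (intro image_closure_subset) (auto intro!: continuous_intros continuous_on_adj)
    then have "z * adj z = 0" using that(1) by auto
    then show ?thesis by (rule cstar_mult_adj_eq_0)
  qed
  \<comment> \<open>The products with \<open>adj (\<theta> x)\<close> lie in the copy of the left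
    algebra, so \<open>\<Phi>'\<close> turns them into a sequence over it, indexed by the
    enumeration \<open>\<xi>\<close>. The second component is padding.\<close>
  define enc :: "'k bop \<Rightarrow> nat \<Rightarrow> 'h bop \<times> 'g bop"
    where "enc z = (\<lambda>n. (\<Phi>' (z * adj (\<theta> (\<xi> n))), 0))" for z
  have inj: "inj_on enc Z"
  proof (rule inj_onI)
    fix z w assume zw: "z \<in> Z" "w \<in> Z" "enc z = enc w"
    have "(z - w) * adj (\<theta> x) = 0" for x
    proof -
      obtain n where n: "\<xi> n = x" using \<xi> by blast
      have "\<Phi>' (z * adj (\<theta> x)) = \<Phi>' (w * adj (\<theta> x))"
        using fun_cong[OF zw(3), of n] by (simp add: enc_def n)
      then have "z * adj (\<theta> x) = w * adj (\<theta> x)"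
        using \<Phi>(12)[OF ZZA[OF zw(1) \<theta>Z]] \<Phi>(12)[OF ZZA[OF zw(2) \<theta>Z]] by metis
      then show ?thesis by (simp add: left_diff_distrib)
    qed
    then have "z - w = 0" by (rule Z_zero[OF complex_vector.subspace_diff[OF Zsub zw(1,2)]])
    then show "z = w" by simp
  qed
  define X where "X = enc ` Z"
  \<comment> \<open>The default 0 keeps \<open>dec u\<close> in \<open>Z\<close> for every
    \<open>u\<close>, so most of the bimodule identities below need no membership
    hypotheses.\<close>
  define dec where "dec u = (if u \<in> X then inv_into Z enc u else 0)" for u
  have dec: "dec u \<in> Z" for u
    using complex_vector.subspace_0[OF Zsub] by (auto simp: dec_def X_def intro: inv_into_into)
  have enc: "enc z \<in> X" if "z \<in> Z" for z using that by (simp add: X_def)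
  have dec_enc: "dec (enc z) = z" if "z \<in> Z" for z
    using enc[OF that] inj that by (simp add: dec_def)
  have enc_dec: "enc (dec u) = u" if "u \<in> X" for u
    using that by (simp add: dec_def f_inv_into_f X_def)
  have bij: "bij_betw dec X Z"
    by (rule bij_betw_byWitness[of _ enc]) (use dec enc dec_enc enc_dec in auto)
  note Zadd = complex_vector.subspace_add[OF Zsub] and Zscale = complex_vector.subspace_scale[OF Zsub]
    and Zdiff = complex_vector.subspace_diff[OF Zsub] and Z0 = complex_vector.subspace_0[OF Zsub]
  define add where "add u v = enc (dec u + dec v)" for u v
  define scale where "scale c u = enc (c *\<^sub>C dec u)" for c u
  define lmul where "lmul a u = enc (\<Phi> a * dec u)" for a u
  define rmul where "rmul u b = enc (dec u * \<Psi> b)" for u b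
  define linner where "linner u v = \<Phi>' (dec u * adj (dec v))" for u v
  define rinner where "rinner u v = \<Psi>' (adj (dec u) * dec v)" for u v
  have decs: "dec (add u v) = dec u + dec v" "dec (scale c u) = c *\<^sub>C dec u" "dec (enc 0) = 0" for u v c
    unfolding add_def scale_def by (intro dec_enc Zadd Zscale Z0 dec)+
  have dec_lmul: "dec (lmul a u) = \<Phi> a * dec u" if "a \<in> A" for a u
    unfolding lmul_def by (intro dec_enc \<Phi>Z that dec)
  have dec_rmul: "dec (rmul u b) = dec u * \<Psi> b" if "b \<in> B" for b u
    unfolding rmul_def by (intro dec_enc Z\<Psi> that dec)
  have encs: "add u v \<in> X" "scale c u \<in> X" "enc 0 \<in> X" for u v c
    unfolding add_def scale_def by (intro enc Zadd Zscale Z0 dec)+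
  have enc_lmul: "lmul a u \<in> X" if "a \<in> A" for a u
    unfolding lmul_def by (intro enc \<Phi>Z that dec)
  have enc_rmul: "rmul u b \<in> X" if "b \<in> B" for b u
    unfolding rmul_def by (intro enc Z\<Psi> that dec)
  have deqI: "u = v \<longleftrightarrow> dec u = dec v" if "u \<in> X" "v \<in> X" for u v using that enc_dec by metis
  have csp: "complex_space_on X add (enc 0) scale"
    by standard (auto simp: encs deqI decs algebra_simps scaleC_add_right scaleC_add_left scaleC_scaleC scaleC_minus1)
  have diff: "dec (complex_space_on.diff add scale u v) = dec u - dec v" for u v
    by (simp add: complex_space_on.diff_def[OF csp] decs scaleC_minus1)
  \<comment> \<open>By isometry and the C*-identity, both inner products induce the operator norm,
    in which \<open>Z\<close> is complete.\<close>
  have linner_norm: "sqrt (norm (linner (complex_space_on.diff add scale u v) (complex_space_on.diff add scale u v)))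
      = norm (dec u - dec v)" for u v
  proof -
    have "norm (\<Phi>' ((dec u - dec v) * adj (dec u - dec v))) = norm ((dec u - dec v) * adj (dec u - dec v))"
      by (intro \<Phi> ZZA Zdiff dec)
    also have "\<dots> = (norm (dec u - dec v))\<^sup>2"
      using norm_adj_mult_self[of "adj (dec u - dec v)"] by (simp add: adj_adj norm_adj)
    finally show ?thesis by (simp add: linner_def diff)
  qed
  have rinner_norm: "sqrt (norm (rinner (complex_space_on.diff add scale u v) (complex_space_on.diff add scale u v)))
      = norm (dec u - dec v)" for u v
  proof -
    have "norm (\<Psi>' (adj (dec u - dec v) * (dec u - dec v))) = norm (adj (dec u - dec v) * (dec u - dec v))"
      by (intro \<Psi> ZZB Zdiff dec)
    then show ?thesis by (simp add: rinner_def diff norm_adj_mult_self)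
  qed
  have linner_closed: "linner u v \<in> A" for u v
    unfolding linner_def by (intro \<Phi> ZZA dec)
  have rinner_closed: "rinner u v \<in> B" for u v
    unfolding rinner_def by (intro \<Psi> ZZB dec)
  have \<Phi>linner: "\<Phi> (linner u v) = dec u * adj (dec v)" for u v
    unfolding linner_def by (intro \<Phi> ZZA dec)
  have \<Psi>rinner: "\<Psi> (rinner u v) = adj (dec u) * dec v" for u v
    unfolding rinner_def by (intro \<Psi> ZZB dec)
  \<comment> \<open>Identities between inner products are checked as identities of operators on
    \<open>'k\<close>, by injectivity of \<open>\<Phi>\<close> and \<open>\<Psi>\<close>.\<close>
  have AeqI: "a = a'" if "a \<in> A" "a' \<in> A" "\<Phi> a = \<Phi> a'" for a a' using that \<Phi>(6) by metis
  have BeqI: "b = b'" if "b \<in> B" "b' \<in> B" "\<Psi> b = \<Psi> b'" for b b' using that \<Psi>(6) by metis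
  \<comment> \<open>Surjectivity of the pairing makes every generator \<open>\<alpha> s\<close> a
    single inner product.\<close>
  have lfull: "closure (cspan {linner x y |x y. x \<in> X \<and> y \<in> X}) = A"
  proof
    have "cspan {linner x y |x y. x \<in> X \<and> y \<in> X} \<subseteq> A"
      by (rule complex_vector.span_minimal) (use linner_closed sub(1) in auto)
    then show "closure (cspan {linner x y |x y. x \<in> X \<and> y \<in> X}) \<subseteq> A" using cl(1) by (intro closure_minimal)
    have "a \<in> cspan {linner x y |x y. x \<in> X \<and> y \<in> X}" if "(a, b) \<in> pair_span \<alpha> \<sigma>" for a b
      using that
    proof induction
      case (gen s)
      obtain u v where s: "s = lpair u v" by (rule lpair_ex)
      have "\<alpha> s = linner (enc (\<theta> u)) (enc (\<theta> v))"
        unfolding linner_def dec_enc[OF \<theta>Z] \<theta>\<sigma> s by (simp add: \<Phi>'_def S'.rep_ext_gen)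
      then show ?case using enc[OF \<theta>Z] by (intro complex_vector.span_base) blast
    qed (auto intro: complex_vector.span_zero complex_vector.span_add complex_vector.span_scale)
    then have "fst ` pair_span \<alpha> \<sigma> \<subseteq> cspan {linner x y |x y. x \<in> X \<and> y \<in> X}" by auto
    from closure_mono[OF this] show "A \<subseteq> closure (cspan {linner x y |x y. x \<in> X \<and> y \<in> X})"
      using S.generated_subset_closure unfolding A_def by (rule subset_trans[rotated])
  qed
  have rfull: "closure (cspan {rinner x y |x y. x \<in> X \<and> y \<in> X}) = B"
  proof
    have "cspan {rinner x y |x y. x \<in> X \<and> y \<in> X} \<subseteq> B"
      by (rule complex_vector.span_minimal) (use rinner_closed sub(3) in auto)
    then show "closure (cspan {rinner x y |x y. x \<in> X \<and> y \<in> X}) \<subseteq> B" using cl(3) by (intro closure_minimal)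
    have "a \<in> cspan {rinner x y |x y. x \<in> X \<and> y \<in> X}" if "(a, b) \<in> pair_span \<beta> \<tau>" for a b
      using that
    proof induction
      case (gen t)
      obtain u v where t: "t = rpair u v" by (rule rpair_ex)
      have "\<beta> t = rinner (enc (\<theta> u)) (enc (\<theta> v))"
        unfolding rinner_def dec_enc[OF \<theta>Z] \<theta>\<tau> t by (simp add: \<Psi>'_def T'.rep_ext_gen)
      then show ?case using enc[OF \<theta>Z] by (intro complex_vector.span_base) blast
    qed (auto intro: complex_vector.span_zero complex_vector.span_add complex_vector.span_scale)
    then have "fst ` pair_span \<beta> \<tau> \<subseteq> cspan {rinner x y |x y. x \<in> X \<and> y \<in> X}" by auto
    from closure_mono[OF this] show "B \<subseteq> closure (cspan {rinner x y |x y. x \<in> X \<and> y \<in> X})"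
      using T.generated_subset_closure unfolding B_def by (rule subset_trans[rotated])
  qed
  have "imprimitivity_bimodule A B X add (enc 0) scale lmul rmul linner rinner"
    unfolding imprimitivity_bimodule_def imprimitivity_bimodule_axioms_def
  proof (intro conjI allI impI csp alg lfull rfull)
    show "Metric_space.mcomplete X (\<lambda>x y. sqrt (norm (linner (complex_space_on.diff add scale x y)
          (complex_space_on.diff add scale x y))))"
      by (rule mcomplete_of_isometry[OF bij Zcl linner_norm])
    show "Metric_space.mcomplete X (\<lambda>x y. sqrt (norm (rinner (complex_space_on.diff add scale x y)
          (complex_space_on.diff add scale x y))))"
      by (rule mcomplete_of_isometry[OF bij Zcl rinner_norm])
    show "positive_in A (linner x x)" for x
      unfolding linner_def defs
      by (intro S'.positive_in_rep_ext positive_in_mult_adj cstar_subalgebra_generated)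
        (rule ZZA[OF dec dec, unfolded A'_def])
    show "positive_in B (rinner x x)" for x
      using T'.positive_in_rep_ext[OF positive_in_mult_adj[of _ "adj (dec x)"], folded defs] alg(4) ZZB[OF dec dec]
      by (simp add: rinner_def adj_adj)
    show "x = enc 0" if "x \<in> X" "linner x x = 0" for x
    proof -
      have "dec x * adj (dec x) = 0"
        using \<Phi>linner[of x x] that(2) \<Phi>(3)[of 0 0] complex_vector.subspace_0[OF sub(1)] by simp
      then have "dec x = 0" by (rule cstar_mult_adj_eq_0)
      then show ?thesis using that(1) by (simp add: deqI encs decs)
    qed
    show "x = enc 0" if "x \<in> X" "rinner x x = 0" for x
    proof -
      have "adj (dec x) * dec x = 0"
        using \<Psi>rinner[of x x] that(2) \<Psi>(3)[of 0 0] complex_vector.subspace_0[OF sub(3)] by simp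
      then have "dec x = 0" by (rule cstar_adj_mult_eq_0)
      then show ?thesis using that(1) by (simp add: deqI encs decs)
    qed
    show "linner x y \<in> A" "rinner x y \<in> B" for x y by (fact linner_closed rinner_closed)+
    show "lmul a x \<in> X" if "a \<in> A" for a x by (rule enc_lmul[OF that])
    show "rmul x b \<in> X" if "b \<in> B" for b x by (rule enc_rmul[OF that])
    fix a a' x y and c :: complex
    assume a: "a \<in> A"
    note aA = complex_vector.subspace_scale[OF sub(1) a]
    show "lmul (c *\<^sub>C a) x = scale c (lmul a x)"
      by (simp add: deqI enc_lmul encs a aA dec_lmul decs \<Phi> mult_scaleC_left)
    show "lmul a (add x y) = add (lmul a x) (lmul a y)"
      by (simp add: deqI enc_lmul encs a dec_lmul decs distrib_left)
    show "lmul a (scale c x) = scale c (lmul a x)"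
      by (simp add: deqI enc_lmul encs a dec_lmul decs mult_scaleC_right)
    show "linner (lmul a x) y = a * linner x y"
      by (rule AeqI) (simp_all add: linner_closed multC a \<Phi> \<Phi>linner dec_lmul mult.assoc)
    show "rinner (lmul a x) y = rinner x (lmul (adj a) y)"
      by (rule BeqI) (simp_all add: rinner_closed a \<Psi>rinner dec_lmul adjC \<Phi> adj_mult mult.assoc)
    show "lmul a (rmul x b) = rmul (lmul a x) b" if "b \<in> B" for b
      by (simp add: deqI enc_lmul enc_rmul a that dec_lmul dec_rmul mult.assoc)
    assume a': "a' \<in> A"
    show "lmul (a + a') x = add (lmul a x) (lmul a' x)"
      by (simp add: deqI enc_lmul encs a a' complex_vector.subspace_add[OF sub(1)] dec_lmul decs \<Phi> distrib_right)
    show "lmul (a * a') x = lmul a (lmul a' x)"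
      by (simp add: deqI enc_lmul a a' multC dec_lmul \<Phi> mult.assoc)
  next
    fix b b' x y and c :: complex
    assume b: "b \<in> B"
    note bB = complex_vector.subspace_scale[OF sub(3) b]
    show "rmul (add x y) b = add (rmul x b) (rmul y b)"
      by (simp add: deqI enc_rmul encs b dec_rmul decs distrib_right)
    show "rmul (scale c x) b = scale c (rmul x b)"
      by (simp add: deqI enc_rmul encs b dec_rmul decs mult_scaleC_left)
    show "rmul x (c *\<^sub>C b) = scale c (rmul x b)"
      by (simp add: deqI enc_rmul encs b bB dec_rmul decs \<Psi> mult_scaleC_right)
    show "rinner x (rmul y b) = rinner x y * b"
      by (rule BeqI) (simp_all add: rinner_closed multC b \<Psi> \<Psi>rinner dec_rmul mult.assoc)
    show "linner (rmul x b) y = linner x (rmul y (adj b))"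
      by (rule AeqI) (simp_all add: linner_closed b \<Phi>linner dec_rmul adjC \<Psi> adj_mult adj_adj mult.assoc)
    assume b': "b' \<in> B"
    show "rmul x (b + b') = add (rmul x b) (rmul x b')"
      by (simp add: deqI enc_rmul encs b b' complex_vector.subspace_add[OF sub(3)] dec_rmul decs \<Psi> distrib_left)
    show "rmul x (b * b') = rmul (rmul x b) b'"
      by (simp add: deqI enc_rmul b b' multC dec_rmul \<Psi> mult.assoc)
  next
    fix x y z and c :: complex
    show "linner (add x y) z = linner x z + linner y z"
      by (rule AeqI) (simp_all add: linner_closed complex_vector.subspace_add[OF sub(1)] \<Phi> \<Phi>linner decs distrib_right)
    show "linner (scale c x) y = c *\<^sub>C linner x y"
      by (rule AeqI) (simp_all add: linner_closed complex_vector.subspace_scale[OF sub(1)] \<Phi> \<Phi>linner decs mult_scaleC_left)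
    show "linner y x = adj (linner x y)"
      by (rule AeqI) (simp_all add: linner_closed adjC \<Phi> \<Phi>linner adj_mult adj_adj)
    show "rinner x (add y z) = rinner x y + rinner x z"
      by (rule BeqI) (simp_all add: rinner_closed complex_vector.subspace_add[OF sub(3)] \<Psi> \<Psi>rinner decs distrib_left)
    show "rinner x (scale c y) = c *\<^sub>C rinner x y"
      by (rule BeqI) (simp_all add: rinner_closed complex_vector.subspace_scale[OF sub(3)] \<Psi> \<Psi>rinner decs mult_scaleC_right)
    show "rinner y x = adj (rinner x y)"
      by (rule BeqI) (simp_all add: rinner_closed adjC \<Psi> \<Psi>rinner adj_mult adj_adj)
    show "lmul (linner x y) z = rmul x (rinner y z)"
      by (simp add: deqI enc_lmul enc_rmul linner_closed rinner_closed dec_lmul dec_rmul \<Phi>linner \<Psi>rinner mult.assoc)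
  qed
  then show ?thesis unfolding strongly_morita_equivalent_def A_def B_def by blast
qed

end

section \<open>Operators on \<open>\<ell>\<^sup>2\<close> given by partial bijections, and block operators\<close>

lemma cinner_delta_right: "cinner f (delta i) = cnj (ell2_apply f i)"
  using cinner_commute[of f "delta i"] by (simp add: cinner_delta)

text \<open>The Riesz vector of the functional has all coordinates 0. This plays the part of density
  of the span of the basis vectors.\<close>

lemma functional_zero_on_delta:
  fixes \<phi> :: "'i ell2 \<Rightarrow> complex"
  assumes "bounded_linear \<phi>" "\<And>c x. \<phi> (c *\<^sub>C x) = c * \<phi> x" "\<And>i. \<phi> (delta i) = 0"
  shows "\<phi> x = 0"
proof -
  obtain y where y: "\<And>x. \<phi> x = cinner y x"
    using riesz_representation[OF assms(1,2)] by blast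
  have "ell2_apply y i = 0" for i
    using assms(3)[of i] y[of "delta i"] by (simp add: cinner_delta_right)
  then have "y = 0" by (intro ell2_eqI) simp
  then show ?thesis by (simp add: y)
qed

text \<open>For bi-unique \<open>R\<close> this is the partial isometry taking
  \<open>delta i\<close> to \<open>delta j\<close> if \<open>R i j\<close>, and to 0 if
  \<open>i\<close> is outside the domain. With relations, products and adjoints of operators become
  composition and converse.\<close>

definition rel_op :: "('i \<Rightarrow> 'j \<Rightarrow> bool) \<Rightarrow> 'i ell2 \<Rightarrow> 'j ell2"
  where "rel_op R v = Abs_ell2 (\<lambda>j. if \<exists>i. R i j then ell2_apply v (THE i. R i j) else 0)"

context
  fixes R :: "'i \<Rightarrow> 'j \<Rightarrow> bool"
  assumes R: "bi_unique R"
begin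

lemma bi_unique_the: "R i j \<Longrightarrow> (THE i. R i j) = i"
  using R unfolding bi_unique_def by blast

lemma rel_op_aux:
  shows rel_op_apply_raw: "ell2_apply (rel_op R v) j = (if \<exists>i. R i j then ell2_apply v (THE i. R i j) else 0)"
    and norm_rel_op: "norm (rel_op R v) \<le> norm v"
proof -
  define g where "g j = (THE i. R i j)" for j
  define J where "J = {j. \<exists>i. R i j}"
  define F where "F j = (if \<exists>i. R i j then ell2_apply v (g j) else 0)" for j
  have gR: "R (g j) j" if "j \<in> J" for j using that bi_unique_the by (auto simp: J_def g_def)
  have inj: "inj_on g J" using gR R unfolding bi_unique_def inj_on_def by metis
  have s1: "(\<lambda>i. (cmod (ell2_apply v i))\<^sup>2) summable_on (g ` J)"
    using ell2_apply_summable by (rule summable_on_subset_banach) simp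
  then have s2: "(\<lambda>j. (cmod (ell2_apply v (g j)))\<^sup>2) summable_on J"
    using summable_on_reindex[OF inj, of "\<lambda>r. (cmod (ell2_apply v r))\<^sup>2"] by (simp add: o_def)
  have "((\<lambda>j. (cmod (F j))\<^sup>2) summable_on UNIV)"
    using s2 by (subst summable_on_cong_neutral[where T = J]) (auto simp: F_def J_def)
  then have F: "ell2_apply (Abs_ell2 F) = F" by (simp add: Abs_ell2_inverse)
  have RF: "rel_op R v = Abs_ell2 F" unfolding rel_op_def F_def[abs_def] g_def ..
  show "ell2_apply (rel_op R v) j = (if \<exists>i. R i j then ell2_apply v (THE i. R i j) else 0)"
    unfolding RF F by (simp add: F_def g_def)
  have "(norm (rel_op R v))\<^sup>2 = (\<Sum>\<^sub>\<infinity>j. (cmod (F j))\<^sup>2)" unfolding RF ell2_norm_sq F ..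
  also have "\<dots> = (\<Sum>\<^sub>\<infinity>j\<in>J. (cmod (ell2_apply v (g j)))\<^sup>2)"
    by (rule infsum_cong_neutral) (auto simp: F_def J_def)
  also have "\<dots> = (\<Sum>\<^sub>\<infinity>i\<in>g ` J. (cmod (ell2_apply v i))\<^sup>2)"
    using infsum_reindex[OF inj, of "\<lambda>r. (cmod (ell2_apply v r))\<^sup>2"] by (simp add: o_def)
  also have "\<dots> \<le> (norm v)\<^sup>2"
    unfolding ell2_norm_sq by (rule infsum_mono2[OF s1 ell2_apply_summable]) auto
  finally show "norm (rel_op R v) \<le> norm v" by (rule power2_le_imp_le) simp
qed

lemma rel_op_apply: "R i j \<Longrightarrow> ell2_apply (rel_op R v) j = ell2_apply v i"
  unfolding rel_op_apply_raw using bi_unique_the by auto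

lemma rel_op_outside: "(\<And>i. \<not> R i j) \<Longrightarrow> ell2_apply (rel_op R v) j = 0"
  unfolding rel_op_apply_raw by simp

lemma rel_op_add: "rel_op R (u + v) = rel_op R u + rel_op R v"
  by (rule ell2_eqI) (simp add: rel_op_apply_raw)

lemma rel_op_scaleC: "rel_op R (c *\<^sub>C v) = c *\<^sub>C rel_op R v"
  by (rule ell2_eqI) (simp add: rel_op_apply_raw)

lemma bounded_linear_rel_op: "bounded_linear (rel_op R)"
  by (rule bounded_linear_intro[of _ 1]) (simp_all add: rel_op_add rel_op_scaleC scaleR_scaleC norm_rel_op)

lemma rel_op_zero: "rel_op R 0 = 0"
  using rel_op_scaleC[of 0 0] by simp

lemma rel_op_delta: "R i j \<Longrightarrow> rel_op R (delta i) = delta j"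
proof (rule ell2_eqI)
  fix k assume i: "R i j"
  show "ell2_apply (rel_op R (delta i)) k = ell2_apply (delta j) k"
  proof (cases "\<exists>l. R l k")
    case True
    then obtain l where l: "R l k" ..
    then have "l = i \<longleftrightarrow> k = j" using i R unfolding bi_unique_def by blast
    then show ?thesis by (simp add: rel_op_apply[OF l] delta.rep_eq)
  next
    case False
    then have "k \<noteq> j" using i by blast
    then show ?thesis using False by (simp add: rel_op_outside delta.rep_eq)
  qed
qed

lemma rel_op_delta_outside: "(\<And>j. \<not> R i j) \<Longrightarrow> rel_op R (delta i) = 0"
proof (rule ell2_eqI)
  fix k assume i: "\<And>j. \<not> R i j"
  show "ell2_apply (rel_op R (delta i)) k = ell2_apply 0 k"
  proof (cases "\<exists>l. R l k")
    case True
    then obtain l where l: "R l k" ..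
    then have "l \<noteq> i" using i by blast
    then show ?thesis by (simp add: rel_op_apply[OF l] delta.rep_eq)
  qed (simp add: rel_op_outside)
qed

end

text \<open>Both sides are bounded and linear in \<open>v\<close>, so basis vectors suffice.\<close>

lemma cinner_rel_op:
  assumes R: "bi_unique R"
  shows "cinner (rel_op R u) v = cinner u (rel_op R\<inverse>\<inverse> v)"
proof -
  have R': "bi_unique R\<inverse>\<inverse>" using R by simp
  have "cinner (rel_op R u) v - cinner u (rel_op R\<inverse>\<inverse> v) = 0"
  proof (rule functional_zero_on_delta[of "\<lambda>v. cinner (rel_op R u) v - cinner u (rel_op R\<inverse>\<inverse> v)"])
    show "bounded_linear (\<lambda>v. cinner (rel_op R u) v - cinner u (rel_op R\<inverse>\<inverse> v))"
      by (intro bounded_linear_sub bounded_linear_cinner_right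
          bounded_linear_compose[OF bounded_linear_cinner_right bounded_linear_rel_op[OF R']])
    show "cinner (rel_op R u) (c *\<^sub>C v) - cinner u (rel_op R\<inverse>\<inverse> (c *\<^sub>C v)) =
        c * (cinner (rel_op R u) v - cinner u (rel_op R\<inverse>\<inverse> v))" for c v
      by (simp add: cinner_scaleC_right rel_op_scaleC[OF R'] right_diff_distrib)
    show "cinner (rel_op R u) (delta j) - cinner u (rel_op R\<inverse>\<inverse> (delta j)) = 0" for j
    proof (cases "\<exists>i. R i j")
      case True
      then obtain i where i: "R i j" ..
      then have "rel_op R\<inverse>\<inverse> (delta j) = delta i" by (intro rel_op_delta[OF R']) simp
      then show ?thesis by (simp add: cinner_delta_right rel_op_apply[OF R i])
    next
      case False
      then have "rel_op R\<inverse>\<inverse> (delta j) = 0" by (intro rel_op_delta_outside[OF R']) simp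
      then show ?thesis using False by (simp add: cinner_delta_right rel_op_outside[OF R])
    qed
  qed
  then show ?thesis by simp
qed

lemma rel_op_OO:
  assumes R: "bi_unique R" and S: "bi_unique S"
  shows "rel_op (R OO S) v = rel_op S (rel_op R v)"
proof (rule ell2_eqI)
  have RS: "bi_unique (R OO S)" using R S by (rule bi_unique_OO)
  fix k
  show "ell2_apply (rel_op (R OO S) v) k = ell2_apply (rel_op S (rel_op R v)) k"
  proof (cases "\<exists>j. S j k")
    case True
    then obtain j where j: "S j k" ..
    show ?thesis
    proof (cases "\<exists>i. R i j")
      case True
      then obtain i where i: "R i j" ..
      then have "(R OO S) i k" using j by blast
      then show ?thesis by (simp add: rel_op_apply[OF RS] rel_op_apply[OF S j] rel_op_apply[OF R i])
    next
      case False
      then have "\<not> (R OO S) i k" for i using j S unfolding bi_unique_def by blast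
      then show ?thesis using False by (simp add: rel_op_outside[OF RS] rel_op_apply[OF S j] rel_op_outside[OF R])
    qed
  next
    case False
    then have "\<not> (R OO S) i k" for i by blast
    then show ?thesis using False by (simp add: rel_op_outside[OF RS] rel_op_outside[OF S])
  qed
qed

definition rel_bop :: "('i \<Rightarrow> 'i \<Rightarrow> bool) \<Rightarrow> 'i ell2 bop"
  where "rel_bop R = bop_of (rel_op R)"

lemma rel_bop_apply: "bi_unique R \<Longrightarrow> rel_bop R \<bullet>\<^sub>o v = rel_op R v"
  unfolding rel_bop_def by (rule bop_of_apply) (simp_all add: bounded_linear_rel_op rel_op_scaleC)

lemma rel_bop_mult: "bi_unique R \<Longrightarrow> bi_unique S \<Longrightarrow> rel_bop S * rel_bop R = rel_bop (R OO S)"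
  by (rule bop_eqI) (simp add: bop_mult rel_bop_apply rel_op_OO bi_unique_OO)

lemma adj_rel_bop: "bi_unique R \<Longrightarrow> adj (rel_bop R) = rel_bop R\<inverse>\<inverse>"
  by (rule adj_bop_unique) (simp add: rel_bop_apply cinner_rel_op)

text \<open>For injective \<open>f\<close>, \<open>push f\<close> is an isometry and
  \<open>pull f\<close> its adjoint.\<close>

abbreviation push :: "('i \<Rightarrow> 'k) \<Rightarrow> 'i ell2 \<Rightarrow> 'k ell2"
  where "push f \<equiv> rel_op (\<lambda>i k. k = f i)"

abbreviation pull :: "('i \<Rightarrow> 'k) \<Rightarrow> 'k ell2 \<Rightarrow> 'i ell2"
  where "pull f \<equiv> rel_op (\<lambda>k i. k = f i)"

lemma bi_unique_push: "inj f \<Longrightarrow> bi_unique (\<lambda>i k. k = f i)"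
  and bi_unique_pull: "inj f \<Longrightarrow> bi_unique (\<lambda>k i. k = f i)"
  unfolding bi_unique_def by (auto dest: injD)

lemma pull_apply: "inj f \<Longrightarrow> ell2_apply (pull f v) i = ell2_apply v (f i)"
  by (rule rel_op_apply[OF bi_unique_pull]) simp_all

lemma push_apply: "inj f \<Longrightarrow> ell2_apply (push f v) (f i) = ell2_apply v i"
  by (rule rel_op_apply[OF bi_unique_push]) simp_all

lemma push_outside: "inj f \<Longrightarrow> k \<notin> range f \<Longrightarrow> ell2_apply (push f v) k = 0"
  by (rule rel_op_outside[OF bi_unique_push]) auto

lemma pull_push: "inj f \<Longrightarrow> pull f (push f v) = v"
  by (rule ell2_eqI) (simp add: pull_apply push_apply)

lemma pull_push_disjoint: "inj f \<Longrightarrow> inj g \<Longrightarrow> range f \<inter> range g = {} \<Longrightarrow> pull g (push f v) = 0"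
  by (rule ell2_eqI, subst pull_apply) (auto intro!: push_outside)

lemma cinner_push: "inj f \<Longrightarrow> cinner (push f u) v = cinner u (pull f v)"
  using cinner_rel_op[OF bi_unique_push, of f u v] by (simp add: conversep_iff[abs_def])

lemma cinner_pull: "inj f \<Longrightarrow> cinner (pull f u) v = cinner u (push f v)"
  unfolding cinner_commute[of "pull f u"] cinner_commute[of u] by (simp add: cinner_push)

lemma norm_push: "inj f \<Longrightarrow> norm (push f v) = norm v"
proof -
  assume "inj f"
  then have "cinner (push f v) (push f v) = cinner v v" by (simp add: cinner_push pull_push)
  then have "(norm (push f v))\<^sup>2 = (norm v)\<^sup>2" unfolding cinner_self of_real_eq_iff .
  then show ?thesis by (rule power2_eq_imp_eq) auto
qed

text \<open>The operator matrix with the single entry \<open>T\<close>, from the copy of the space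
  embedded by \<open>g\<close> to the copy embedded by \<open>f\<close>.\<close>

definition block :: "('i \<Rightarrow> 'k) \<Rightarrow> ('i \<Rightarrow> 'k) \<Rightarrow> 'i ell2 bop \<Rightarrow> 'k ell2 bop"
  where "block f g T = bop_of (\<lambda>v. push f (T \<bullet>\<^sub>o pull g v))"

lemma block_apply: "inj f \<Longrightarrow> inj g \<Longrightarrow> block f g T \<bullet>\<^sub>o v = push f (T \<bullet>\<^sub>o pull g v)"
  unfolding block_def
  by (rule bop_of_apply)
    (auto intro!: bounded_linear_compose[OF bounded_linear_rel_op[OF bi_unique_push]]
      bounded_linear_compose[OF bounded_linear_bop] bounded_linear_rel_op[OF bi_unique_pull]
      simp: rel_op_scaleC[OF bi_unique_push] rel_op_scaleC[OF bi_unique_pull] bop_scaleC)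

lemma block_mult: "inj f \<Longrightarrow> inj g \<Longrightarrow> inj h \<Longrightarrow> block f g T * block g h U = block f h (T * U)"
  by (rule bop_eqI) (simp add: bop_mult block_apply pull_push)

lemma block_mult_disjoint:
  assumes inj: "inj f" "inj g" "inj k" "inj h" and disj: "range g \<inter> range k = {}"
  shows "block f g T * block k h U = 0"
proof (rule bop_eqI)
  fix v
  have "pull g (push k w) = 0" for w using disj by (intro pull_push_disjoint inj) auto
  then show "(block f g T * block k h U) \<bullet>\<^sub>o v = 0 \<bullet>\<^sub>o v"
    by (simp add: bop_mult block_apply inj rel_op_zero[OF bi_unique_push])
qed

lemma block_add: "inj f \<Longrightarrow> inj g \<Longrightarrow> block f g (T + U) = block f g T + block f g U"
  by (rule bop_eqI) (simp add: bop_add_left block_apply rel_op_add[OF bi_unique_push])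

lemma block_scaleC: "inj f \<Longrightarrow> inj g \<Longrightarrow> block f g (c *\<^sub>C T) = c *\<^sub>C block f g T"
  by (rule bop_eqI) (simp add: bop_scaleC_left block_apply rel_op_scaleC[OF bi_unique_push])

lemma block_zero: "inj f \<Longrightarrow> inj g \<Longrightarrow> block f g 0 = 0"
  by (rule bop_eqI) (simp add: block_apply rel_op_zero[OF bi_unique_push])

lemma adj_block: "inj f \<Longrightarrow> inj g \<Longrightarrow> adj (block f g T) = block g f (adj T)"
  by (rule adj_bop_unique) (simp add: block_apply cinner_push cinner_adj_left cinner_pull)

lemma norm_block:
  assumes inj: "inj f"
  shows "norm (block f f T) = norm T"
proof (rule antisym)
  show "norm (block f f T) \<le> norm T"
  proof (rule norm_bop_le)
    fix v
    have "norm (block f f T \<bullet>\<^sub>o v) \<le> norm T * norm (pull f v)"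
      by (simp add: block_apply inj norm_push norm_bop_apply)
    also have "\<dots> \<le> norm T * norm v"
      by (intro mult_left_mono norm_rel_op bi_unique_pull inj) simp
    finally show "norm (block f f T \<bullet>\<^sub>o v) \<le> norm T * norm v" .
  qed simp
  show "norm T \<le> norm (block f f T)"
  proof (rule norm_bop_le)
    fix v
    have "norm (T \<bullet>\<^sub>o v) = norm (block f f T \<bullet>\<^sub>o push f v)"
      by (simp add: block_apply inj norm_push pull_push)
    also have "\<dots> \<le> norm (block f f T) * norm v"
      using norm_bop_apply[of "block f f T" "push f v"] by (simp add: norm_push inj)
    finally show "norm (T \<bullet>\<^sub>o v) \<le> norm (block f f T) * norm v" .
  qed simp
qed

lemma star_representation_block:
  assumes "inj f" "star_representation \<beta>"
  shows "star_representation (\<lambda>t. block f f (\<beta> t))"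
  using assms by (intro star_representationI) (simp_all add: star_representationD block_mult adj_block)

lemma isometric_pair_block:
  assumes f: "inj f" and \<beta>: "star_representation \<beta>"
  shows "isometric_pair \<beta> (\<lambda>t. block f f (\<beta> t))"
proof
  fix a b assume "(a, b) \<in> pair_span \<beta> (\<lambda>t. block f f (\<beta> t))"
  then have "b = block f f a"
    by induction (simp_all add: f block_zero block_add block_scaleC)
  then show "norm b = norm a" by (simp add: norm_block f)
qed (use assms star_representation_block in auto)

section \<open>Direct sums of operators and representations\<close>

definition oplus :: "'i ell2 bop \<Rightarrow> 'j ell2 bop \<Rightarrow> ('i + 'j) ell2 bop"
  where "oplus a b = block Inl Inl a + block Inr Inr b"

lemma oplus_mult: "oplus a b * oplus a' b' = oplus (a * a') (b * b')"
proof -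
  have "block Inl Inl a * block Inr Inr b' = 0" "block Inr Inr b * block Inl Inl a' = 0"
    by (rule block_mult_disjoint; auto)+
  then show ?thesis
    by (simp add: oplus_def distrib_left distrib_right block_mult)
qed

lemma oplus_add: "oplus a b + oplus a' b' = oplus (a + a') (b + b')"
  by (simp add: oplus_def block_add add_ac)

lemma oplus_scaleC: "c *\<^sub>C oplus a b = oplus (c *\<^sub>C a) (c *\<^sub>C b)"
  by (simp add: oplus_def block_scaleC scaleC_add_right)

lemma oplus_zero: "oplus 0 0 = 0"
  by (simp add: oplus_def block_zero)

lemma adj_oplus: "adj (oplus a b) = oplus (adj a) (adj b)"
  by (simp add: oplus_def adj_add adj_block)

lemma pull_push_sum [simp]: "pull Inl (push Inr v) = 0" "pull Inr (push Inl u) = 0"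
  by (rule pull_push_disjoint; auto)+

lemma norm_sum_ell2: "(norm (push Inl u + push Inr v))\<^sup>2 = (norm u)\<^sup>2 + (norm v)\<^sup>2"
proof -
  have "cinner (push Inl u) (push Inr v) = 0" by (simp add: cinner_push)
  then show ?thesis by (simp add: norm_add_sq norm_push)
qed

lemma sum_ell2_decompose: "push Inl (pull Inl v) + push Inr (pull Inr v) = v"
proof (rule ell2_eqI)
  fix k show "ell2_apply (push Inl (pull Inl v) + push Inr (pull Inr v)) k = ell2_apply v k"
    by (cases k) (auto simp: push_apply pull_apply intro!: push_outside)
qed

lemma norm_oplus: "norm (oplus a b) = max (norm a) (norm b)"
proof (rule antisym)
  have op: "oplus a b \<bullet>\<^sub>o v = push Inl (a \<bullet>\<^sub>o pull Inl v) + push Inr (b \<bullet>\<^sub>o pull Inr v)" for v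
    by (simp add: oplus_def bop_add_left block_apply)
  define C where "C = max (norm a) (norm b)"
  have C0: "0 \<le> C" by (simp add: C_def le_max_iff_disj)
  show "norm (oplus a b) \<le> max (norm a) (norm b)"
    unfolding C_def[symmetric]
  proof (rule norm_bop_le)
    fix v :: "('a + 'b) ell2"
    have "norm (a \<bullet>\<^sub>o pull Inl v) \<le> C * norm (pull Inl v)"
      by (rule order_trans[OF norm_bop_apply]) (simp add: C_def mult_right_mono)
    then have 1: "(norm (a \<bullet>\<^sub>o pull Inl v))\<^sup>2 \<le> (C * norm (pull Inl v))\<^sup>2" by (rule power_mono) simp
    have "norm (b \<bullet>\<^sub>o pull Inr v) \<le> C * norm (pull Inr v)"
      by (rule order_trans[OF norm_bop_apply]) (simp add: C_def mult_right_mono)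
    then have 2: "(norm (b \<bullet>\<^sub>o pull Inr v))\<^sup>2 \<le> (C * norm (pull Inr v))\<^sup>2" by (rule power_mono) simp
    have "(norm (oplus a b \<bullet>\<^sub>o v))\<^sup>2 \<le> C\<^sup>2 * ((norm (pull Inl v))\<^sup>2 + (norm (pull Inr v))\<^sup>2)"
      unfolding op norm_sum_ell2 using 1 2 by (simp add: power_mult_distrib distrib_left)
    also have "\<dots> = (C * norm v)\<^sup>2"
      using norm_sum_ell2[of "pull Inl v" "pull Inr v"] by (simp add: sum_ell2_decompose power_mult_distrib)
    finally show "norm (oplus a b \<bullet>\<^sub>o v) \<le> C * norm v"
      by (rule power2_le_imp_le) (simp add: C0)
  qed (rule C0)
  have "norm a \<le> norm (oplus a b)"
  proof (rule norm_bop_le)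
    fix u
    have "oplus a b \<bullet>\<^sub>o push Inl u = push Inl (a \<bullet>\<^sub>o u)"
      by (simp add: op pull_push rel_op_zero[OF bi_unique_push])
    then show "norm (a \<bullet>\<^sub>o u) \<le> norm (oplus a b) * norm u"
      using norm_bop_apply[of "oplus a b" "push Inl u"] by (simp add: norm_push)
  qed simp
  moreover have "norm b \<le> norm (oplus a b)"
  proof (rule norm_bop_le)
    fix u
    have "oplus a b \<bullet>\<^sub>o push Inr u = push Inr (b \<bullet>\<^sub>o u)"
      by (simp add: op pull_push rel_op_zero[OF bi_unique_push])
    then show "norm (b \<bullet>\<^sub>o u) \<le> norm (oplus a b) * norm u"
      using norm_bop_apply[of "oplus a b" "push Inr u"] by (simp add: norm_push)
  qed simp
  ultimately show "max (norm a) (norm b) \<le> norm (oplus a b)" by simp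
qed

lemma pair_span_oplus:
  "(a, b) \<in> pair_span \<alpha> (\<lambda>s. oplus (\<sigma> s) (\<tau> s)) \<Longrightarrow>
    \<exists>b1 b2. b = oplus b1 b2 \<and> (a, b1) \<in> pair_span \<alpha> \<sigma> \<and> (a, b2) \<in> pair_span \<alpha> \<tau>"
proof (induction rule: pair_span.induct)
  case zero then show ?case using oplus_zero pair_span.zero by metis
next
  case gen then show ?case by (blast intro: pair_span.gen)
next
  case (add a b a' b')
  then show ?case by (fastforce simp: oplus_add intro: pair_span.add)
next
  case (scale a b c)
  then show ?case by (fastforce simp: oplus_scaleC intro: pair_span.scale)
qed

text \<open>It will be applied with one summand isometric to \<open>\<alpha>\<close> and the other
  merely dominated by it.\<close>

lemma isometric_pair_oplus:
  assumes \<alpha>: "star_representation \<alpha>" and \<sigma>: "star_representation \<sigma>" and \<tau>: "star_representation \<tau>"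
    and norms: "\<And>a b c. (a, b) \<in> pair_span \<alpha> \<sigma> \<Longrightarrow> (a, c) \<in> pair_span \<alpha> \<tau> \<Longrightarrow> max (norm b) (norm c) = norm a"
  shows "isometric_pair \<alpha> (\<lambda>s. oplus (\<sigma> s) (\<tau> s))"
proof
  show "star_representation (\<lambda>s. oplus (\<sigma> s) (\<tau> s))"
    by (rule star_representationI)
      (simp_all add: oplus_mult adj_oplus star_representationD[OF \<sigma>] star_representationD[OF \<tau>])
  show "norm b = norm a" if "(a, b) \<in> pair_span \<alpha> (\<lambda>s. oplus (\<sigma> s) (\<tau> s))" for a b
    using pair_span_oplus[OF that] norms by (auto simp: norm_oplus)
qed (rule \<alpha>)

text \<open>The module map \<open>\<theta>\<close> intertwines \<open>\<sigma>\<close> and \<open>\<tau>\<close>, where \<open>\<tau>\<close> generates the same algebra as \<open>\<beta>\<close>, while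
  \<open>\<sigma>\<close> (the representation induced from \<open>\<tau>\<close>) is only known to be dominated by \<open>\<alpha>\<close>.\<close>

definition induced_pair ::
    "('x \<Rightarrow> 'x \<Rightarrow> 's) \<Rightarrow> ('x \<Rightarrow> 'x \<Rightarrow> 't) \<Rightarrow>
     ('s::inverse_semigroup \<Rightarrow> 'h::chilbert_space bop) \<Rightarrow> ('t::inverse_semigroup \<Rightarrow> 'g::chilbert_space bop) \<Rightarrow>
     ('x \<Rightarrow> 'k::chilbert_space bop) \<Rightarrow> ('s \<Rightarrow> 'k bop) \<Rightarrow> ('t \<Rightarrow> 'k bop) \<Rightarrow> bool"
  where "induced_pair lp rp \<alpha> \<beta> \<theta> \<sigma> \<tau> \<longleftrightarrow>
    star_representation \<sigma> \<and> isometric_pair \<beta> \<tau> \<and>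
    (\<forall>x y. \<theta> x * adj (\<theta> y) = \<sigma> (lp x y)) \<and> (\<forall>x y. adj (\<theta> x) * \<theta> y = \<tau> (rp x y)) \<and>
    (\<forall>a b. (a, b) \<in> pair_span \<alpha> \<sigma> \<longrightarrow> norm b \<le> norm a)"

text \<open>Inducing in both directions and taking the direct sum makes both sides isometric.\<close>

theorem (in morita_context) strongly_morita_equivalent_of_induced_pairs:
  fixes \<theta>1 :: "'x \<Rightarrow> 'i ell2 bop" and \<theta>2 :: "'x \<Rightarrow> 'j ell2 bop"
  assumes countable: "countable (UNIV :: 'x set)"
    and 1: "induced_pair lpair rpair \<alpha> \<beta> \<theta>1 \<sigma>1 \<tau>1"
    and 2: "induced_pair rpair lpair \<beta> \<alpha> \<theta>2 \<sigma>2 \<tau>2"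
  shows "strongly_morita_equivalent (cstar_generated (range \<alpha>)) (cstar_generated (range \<beta>))"
proof (rule strongly_morita_equivalent_of_module_map[OF countable])
  have \<sigma>1: "star_representation \<sigma>1" and \<tau>1: "isometric_pair \<beta> \<tau>1"
    and \<theta>1: "\<And>x y. \<theta>1 x * adj (\<theta>1 y) = \<sigma>1 (lpair x y)" "\<And>x y. adj (\<theta>1 x) * \<theta>1 y = \<tau>1 (rpair x y)"
    and le1: "\<And>a b. (a, b) \<in> pair_span \<alpha> \<sigma>1 \<Longrightarrow> norm b \<le> norm a"
    using 1 by (auto simp: induced_pair_def)
  have \<sigma>2: "star_representation \<sigma>2" and \<tau>2: "isometric_pair \<alpha> \<tau>2"
    and \<theta>2: "\<And>x y. \<theta>2 x * adj (\<theta>2 y) = \<sigma>2 (rpair x y)" "\<And>x y. adj (\<theta>2 x) * \<theta>2 y = \<tau>2 (lpair x y)"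
    and le2: "\<And>a b. (a, b) \<in> pair_span \<beta> \<sigma>2 \<Longrightarrow> norm b \<le> norm a"
    using 2 by (auto simp: induced_pair_def)
  interpret T1: isometric_pair \<beta> \<tau>1 by fact
  interpret T2: isometric_pair \<alpha> \<tau>2 by fact
  \<comment> \<open>The second family comes from the opposite direction; taking adjoints exchanges
    the roles of its two product formulas.\<close>
  let ?\<theta> = "\<lambda>x. oplus (\<theta>1 x) (adj (\<theta>2 x))"
  show "isometric_pair \<alpha> (\<lambda>s. oplus (\<sigma>1 s) (\<tau>2 s))"
    by (rule isometric_pair_oplus[OF T2.rep_dom \<sigma>1 T2.rep_cod])
      (metis le1 T2.norm_pair_span max.absorb2)
  show "isometric_pair \<beta> (\<lambda>t. oplus (\<tau>1 t) (\<sigma>2 t))"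
    by (rule isometric_pair_oplus[OF T1.rep_dom T1.rep_cod \<sigma>2])
      (metis le2 T1.norm_pair_span max.absorb1)
  show "?\<theta> x * adj (?\<theta> y) = oplus (\<sigma>1 (lpair x y)) (\<tau>2 (lpair x y))" for x y
    by (simp add: adj_oplus adj_adj oplus_mult \<theta>1 \<theta>2)
  show "adj (?\<theta> x) * ?\<theta> y = oplus (\<tau>1 (rpair x y)) (\<sigma>2 (rpair x y))" for x y
    by (simp add: adj_oplus adj_adj oplus_mult \<theta>1 \<theta>2)
qed

section \<open>Inducing an arbitrary representation\<close>

lemma adj_sum: "adj (sum f A) = (\<Sum>i\<in>A. adj (f i :: 'a::cstar_algebra))"
  by (rule linear_sum[OF bounded_linear.linear[OF bounded_linear_adj]])

lemma block_sum: "inj f \<Longrightarrow> inj g \<Longrightarrow> block f g (sum T A) = (\<Sum>i\<in>A. block f g (T i))"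
  by (induction A rule: infinite_finite_induct) (simp_all add: block_zero block_add)

context morita_context
begin

text \<open>In the induced space \<open>X \<otimes> H\<close> let \<open>P\<^sub>j\<close> be the projection onto \<open>\<xi>\<^sub>j \<otimes> H\<close>, on which \<open>\<langle>\<xi>\<^sub>j, \<xi>\<^sub>j\<rangle>\<close> acts
  as the identity; these projections commute. The operator \<open>gram \<beta> \<xi> i x y\<close> is the compression
  of \<open>\<Prod>j<i. (1 - P\<^sub>j)\<close> along \<open>h \<mapsto> x \<otimes> h\<close> and \<open>h \<mapsto> y \<otimes> h\<close>.\<close>

primrec gram :: "('t \<Rightarrow> 'b::ab_group_add) \<Rightarrow> (nat \<Rightarrow> 'x) \<Rightarrow> nat \<Rightarrow> 'x \<Rightarrow> 'x \<Rightarrow> 'b" where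
  "gram \<beta> \<xi> 0 x y = \<beta> (rpair x y)"
| "gram \<beta> \<xi> (Suc i) x y = gram \<beta> \<xi> i x y - gram \<beta> \<xi> i x (lact (lpair (\<xi> i) (\<xi> i)) y)"

text \<open>An idempotent of S acts as a self-adjoint operator that commutes with all the
  projections P_j.\<close>

lemma gram_lact_idem: "e * e = e \<Longrightarrow> gram \<beta> \<xi> i x (lact e y) = gram \<beta> \<xi> i (lact e x) y"
proof (induction i arbitrary: x y)
  case (Suc i)
  then show ?case by (simp add: lact_idem_commute[OF lpair_idem Suc.prems])
qed (simp add: rpair_lact sinv_idem)

lemma gram_projection: "j < i \<Longrightarrow> gram \<beta> \<xi> i x (lact (lpair (\<xi> j) (\<xi> j)) y) = 0"
proof (induction i arbitrary: y)
  case (Suc i)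
  show ?case
  proof (cases "j = i")
    case True
    then show ?thesis by (simp add: lact_mult[symmetric] lpair_idem)
  next
    case False
    then have "j < i" using Suc.prems by simp
    then show ?thesis using Suc.IH by (simp add: lact_idem_commute[OF lpair_idem lpair_idem, of "\<xi> i" "\<xi> j"])
  qed
qed simp

text \<open>Write T_x for h |-> x \<otimes> h. The product T_u \<open>adj\<close> T_v is the action
  of <u, v> on the induced space.\<close>

lemma gram_mult_right:
  fixes \<beta> :: "'t \<Rightarrow> 'h::chilbert_space bop"
  assumes \<beta>: "star_representation \<beta>"
  shows "gram \<beta> \<xi> i x u * \<beta> (rpair v y) = gram \<beta> \<xi> i x (lact (lpair u v) y)"
proof (induction i arbitrary: u)
  case 0
  show ?case by (simp add: lpair_rpair rpair_ract star_representationD[OF \<beta>])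
next
  case (Suc i)
  then show ?case by (simp add: left_diff_distrib lpair_lact lact_mult)
qed

text \<open>With Q_i the product of the 1 - P_j for j < i, the left side is \<open>adj\<close> T_x
  Q_i (T_u \<open>adj\<close> T_u) Q_k T_y. The middle factor is the action of <u, u>, which
  commutes with Q_k, and Q_i Q_k = Q_i.\<close>

lemma gram_mult:
  fixes \<beta> :: "'t \<Rightarrow> 'h::chilbert_space bop"
  assumes \<beta>: "star_representation \<beta>" and "k \<le> i"
  shows "gram \<beta> \<xi> i x u * gram \<beta> \<xi> k u y = gram \<beta> \<xi> i x (lact (lpair u u) y)"
  using assms(2)
proof (induction k arbitrary: y)
  case 0
  show ?case by (simp add: gram_mult_right[OF \<beta>])
next
  case (Suc k)
  have "gram \<beta> \<xi> i x (lact (lpair u u) (lact (lpair (\<xi> k) (\<xi> k)) y)) = 0"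
    using Suc.prems by (simp add: lact_idem_commute[OF lpair_idem lpair_idem, of u "\<xi> k"] gram_projection)
  then show ?case using Suc by (simp add: right_diff_distrib)
qed

lemma adj_gram:
  fixes \<beta> :: "'t \<Rightarrow> 'h::chilbert_space bop"
  assumes \<beta>: "star_representation \<beta>"
  shows "adj (gram \<beta> \<xi> i x y) = gram \<beta> \<xi> i y x"
proof (induction i arbitrary: x y)
  case 0
  show ?case by (simp add: star_representationD[OF \<beta>, symmetric] rpair_swap[symmetric])
next
  case (Suc i)
  then show ?case by (simp add: adj_diff gram_lact_idem[OF lpair_idem])
qed

text \<open>Gram-Schmidt: x \<otimes> h is split along the ranges of Q_i P_i, where P_i projects
  onto \<xi>_i \<otimes> H. Copy 0 of H is the source, and copy i + 1 receives the i-th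
  component.\<close>

lemma module_map_exists:
  fixes \<beta> :: "'t \<Rightarrow> 'j ell2 bop"
  assumes countable: "countable (UNIV :: 'x set)" and \<beta>: "star_representation \<beta>"
  obtains \<theta> :: "'x \<Rightarrow> (nat \<times> 'j) ell2 bop"
    where "\<And>x y. adj (\<theta> x) * \<theta> y = block (Pair 0) (Pair 0) (\<beta> (rpair x y))"
proof -
  define \<xi> :: "nat \<Rightarrow> 'x" where "\<xi> = from_nat_into UNIV"
  have "\<exists>n. \<xi> n = x" for x
    unfolding \<xi>_def using from_nat_into_surj[OF countable, of x] by auto
  then obtain m where m: "\<And>x. \<xi> (m x) = x" by metis
  \<comment> \<open>Once the enumeration has passed \<open>y\<close>, the space y \<otimes> H has
    been projected away, so every vector has only finitely many components.\<close>
  have vanish: "gram \<beta> \<xi> n x y = 0" if "m y < n" for n x y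
    using gram_projection[OF that, of \<beta> \<xi> x y] by (simp add: m lpair_self)
  \<comment> \<open>The i-th component of x \<otimes> h, expressed as a vector of H by means of the
    adjoint of h |-> \<xi>_i \<otimes> h.\<close>
  define c where "c i x = gram \<beta> \<xi> i (\<xi> i) x" for i x
  have c_mult: "adj (c i x) * c i y = gram \<beta> \<xi> i x y - gram \<beta> \<xi> (Suc i) x y" for i x y
    by (simp add: c_def adj_gram[OF \<beta>] gram_mult[OF \<beta>])
  have inj: "inj (Pair n)" for n :: nat by (simp add: inj_def)
  define \<theta> :: "'x \<Rightarrow> (nat \<times> 'j) ell2 bop"
    where "\<theta> x = (\<Sum>i\<le>m x. block (Pair (Suc i)) (Pair 0) (c i x))" for x
  \<comment> \<open>The terms past \<open>m x\<close> vanish, so \<open>\<theta> x\<close> and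
    \<open>\<theta> y\<close> can be summed up to a common bound.\<close>
  have \<theta>: "\<theta> x = (\<Sum>i<N. block (Pair (Suc i)) (Pair 0) (c i x))" if "m x < N" for x N
    unfolding \<theta>_def
  proof (rule sum.mono_neutral_left)
    show "\<forall>i\<in>{..<N} - {..m x}. block (Pair (Suc i)) (Pair 0) (c i x) = 0"
      by (auto simp: c_def vanish block_zero inj)
  qed (use that in auto)
  show thesis
  proof (rule that)
    fix x y
    define N where "N = Suc (max (m x) (m y))"
    have N: "m x < N" "m y < N" by (auto simp: N_def)
    have blocks: "block (Pair 0) (Pair (Suc i)) (adj (c i x)) * block (Pair (Suc j)) (Pair 0) (c j y) =
        (if i = j then block (Pair 0) (Pair 0) (adj (c i x) * c i y) else 0)" for i j
      by (auto simp: block_mult inj intro!: block_mult_disjoint)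
    have "adj (\<theta> x) * \<theta> y = (\<Sum>i<N. \<Sum>j<N. block (Pair 0) (Pair (Suc i)) (adj (c i x)) * block (Pair (Suc j)) (Pair 0) (c j y))"
      unfolding \<theta>[OF N(1)] \<theta>[OF N(2)] adj_sum sum_product by (simp add: adj_block inj)
    also have "\<dots> = (\<Sum>i<N. block (Pair 0) (Pair 0) (adj (c i x) * c i y))"
      unfolding blocks by simp
    also have "\<dots> = block (Pair 0) (Pair 0) (\<Sum>i<N. gram \<beta> \<xi> i x y - gram \<beta> \<xi> (Suc i) x y)"
      by (simp add: block_sum inj c_mult)
    also have "(\<Sum>i<N. gram \<beta> \<xi> i x y - gram \<beta> \<xi> (Suc i) x y) = gram \<beta> \<xi> 0 x y - gram \<beta> \<xi> N x y"
      by (rule sum_lessThan_telescope')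
    also have "\<dots> = \<beta> (rpair x y)" by (simp add: vanish[OF N(2)])
    finally show "adj (\<theta> x) * \<theta> y = block (Pair 0) (Pair 0) (\<beta> (rpair x y))" .
  qed
qed

lemma induced_pair_universal:
  fixes \<beta> :: "'t \<Rightarrow> 'j ell2 bop"
  assumes countable: "countable (UNIV :: 'x set)" and \<beta>: "star_representation \<beta>"
  obtains \<theta> :: "'x \<Rightarrow> (nat \<times> 'j) ell2 bop" and \<sigma> \<tau>
    where "induced_pair lpair rpair universal_rep \<beta> \<theta> \<sigma> \<tau>"
proof -
  obtain \<theta> :: "'x \<Rightarrow> (nat \<times> 'j) ell2 bop"
    where \<theta>: "\<And>x y. adj (\<theta> x) * \<theta> y = block (Pair 0) (Pair 0) (\<beta> (rpair x y))"
    using module_map_exists[OF assms] by blast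
  have inj: "inj (Pair (0::nat))" by (simp add: inj_def)
  note \<tau> = isometric_pair_block[OF inj \<beta>]
  obtain \<sigma> where \<sigma>: "star_representation \<sigma>" "\<And>x y. \<theta> x * adj (\<theta> y) = \<sigma> (lpair x y)"
    using induced_representation[OF isometric_pair.rep_cod[OF \<tau>] \<theta>] by blast
  have "norm b \<le> norm a" if "(a, b) \<in> pair_span universal_rep \<sigma>" for a b
  proof -
    \<comment> \<open>For \<open>universal_rep\<close> the rules of \<open>pair_span\<close> are
      those of \<open>rep_graph\<close>, whose norm bound is universality.\<close>
    have "(a, b) \<in> rep_graph \<sigma>" using that by induction (auto intro: rep_graph.intros)
    then show ?thesis by (rule rep_graph_bound[OF \<sigma>(1)])
  qed
  then show thesis
    using \<sigma> \<tau> \<theta> by (intro that[of \<theta> \<sigma>]) (auto simp: induced_pair_def)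
qed

end

section \<open>Inducing the left regular representation\<close>

text \<open>The condition on \<open>t\<close> is equivalent to t t^* \<le> s^* s, the domain in the
  regular representation.\<close>

definition left_mult_rel :: "'s::inverse_semigroup \<Rightarrow> 's \<Rightarrow> 's \<Rightarrow> bool"
  where "left_mult_rel s t r \<longleftrightarrow> s\<^sup>\<star> * s * t = t \<and> r = s * t"

lemma bi_unique_left_mult_rel: "bi_unique (left_mult_rel s)"
  unfolding bi_unique_def left_mult_rel_def by (metis mult.assoc)

lemma left_regular_rep_eq: "left_regular_rep s = rel_bop (left_mult_rel s)"
proof (rule bop_eq_on_delta)
  fix t
  have dom: "s\<^sup>\<star> * s * (t * t\<^sup>\<star>) = t * t\<^sup>\<star> \<longleftrightarrow> s\<^sup>\<star> * s * t = t"
    by (metis sinv(1) mult.assoc)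
  show "left_regular_rep s \<bullet>\<^sub>o delta t = rel_bop (left_mult_rel s) \<bullet>\<^sub>o delta t"
    unfolding left_regular_rep_delta dom rel_bop_apply[OF bi_unique_left_mult_rel]
    by (auto simp: left_mult_rel_def rel_op_delta[OF bi_unique_left_mult_rel]
        rel_op_delta_outside[OF bi_unique_left_mult_rel])
qed

text \<open>The point is that the domains agree: if (s t)^* (s t) fixes \<open>u\<close>, then t^* t
  fixes \<open>u\<close> and s^* s fixes \<open>t * u\<close>, since idempotents commute.\<close>

lemma left_mult_rel_mult: "left_mult_rel t OO left_mult_rel s = left_mult_rel (s * t)"
proof (intro ext iffI)
  fix u r
  assume "(left_mult_rel t OO left_mult_rel s) u r"
  then have "t\<^sup>\<star> * t * u = u" "s\<^sup>\<star> * s * (t * u) = t * u" "r = s * (t * u)"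
    by (auto simp: left_mult_rel_def)
  then show "left_mult_rel (s * t) u r"
    by (simp add: left_mult_rel_def sinv_mult mult.assoc)
next
  fix u r
  assume "left_mult_rel (s * t) u r"
  then have u: "t\<^sup>\<star> * s\<^sup>\<star> * s * t * u = u" and r: "r = s * (t * u)"
    by (auto simp: left_mult_rel_def sinv_mult mult.assoc)
  have "t\<^sup>\<star> * t * u = t\<^sup>\<star> * t * t\<^sup>\<star> * (s\<^sup>\<star> * s * t * u)" using u by (metis mult.assoc)
  also have "\<dots> = u" unfolding sinv using u by (simp add: mult.assoc)
  finally have 1: "t\<^sup>\<star> * t * u = u" .
  have "t * u = t * t\<^sup>\<star> * (s\<^sup>\<star> * s) * (t * u)" using u by (metis mult.assoc)
  also have "t * t\<^sup>\<star> * (s\<^sup>\<star> * s) = s\<^sup>\<star> * s * (t * t\<^sup>\<star>)" by (intro idem_commute sinv_mult_idem)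
  also have "s\<^sup>\<star> * s * (t * t\<^sup>\<star>) * (t * u) = s\<^sup>\<star> * s * (t * u)"
    using sinv(1)[of t] by (metis mult.assoc)
  finally have "s\<^sup>\<star> * s * (t * u) = t * u" ..
  then show "(left_mult_rel t OO left_mult_rel s) u r"
    using 1 r by (auto simp: left_mult_rel_def OO_def)
qed

lemma left_mult_rel_sinv: "left_mult_rel (s\<^sup>\<star>) = (left_mult_rel s)\<inverse>\<inverse>"
proof (intro ext iffI)
  fix u r
  have 1: "s\<^sup>\<star> * s * (s\<^sup>\<star> * u) = s\<^sup>\<star> * u" and 2: "s * s\<^sup>\<star> * (s * r) = s * r"
    using sinv by (metis mult.assoc)+
  show "(left_mult_rel s)\<inverse>\<inverse> u r" if "left_mult_rel (s\<^sup>\<star>) u r"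
    using that 1 by (simp add: left_mult_rel_def mult.assoc)
  show "left_mult_rel (s\<^sup>\<star>) u r" if "(left_mult_rel s)\<inverse>\<inverse> u r"
    using that 2 by (simp add: left_mult_rel_def mult.assoc)
qed

lemma star_representation_left_regular_rep: "star_representation left_regular_rep"
  by (rule star_representationI)
    (simp_all add: left_regular_rep_eq rel_bop_mult adj_rel_bop bi_unique_left_mult_rel
      left_mult_rel_mult left_mult_rel_sinv)

lemma block_rel_bop:
  assumes f: "inj f" and R: "bi_unique R"
  shows "block f f (rel_bop R) = rel_bop (\<lambda>k l. \<exists>i j. k = f i \<and> l = f j \<and> R i j)"
proof (rule bop_eqI)
  fix v
  have eq: "(\<lambda>k l. \<exists>i j. k = f i \<and> l = f j \<and> R i j) = (\<lambda>k i. k = f i) OO R OO (\<lambda>i k. k = f i)"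
    by (auto simp: fun_eq_iff OO_def)
  show "block f f (rel_bop R) \<bullet>\<^sub>o v = rel_bop (\<lambda>k l. \<exists>i j. k = f i \<and> l = f j \<and> R i j) \<bullet>\<^sub>o v"
    unfolding eq
    by (simp add: block_apply rel_bop_apply rel_op_OO bi_unique_OO bi_unique_push bi_unique_pull f R)
qed

section \<open>The module as partial bijections of T + X, and comparison with the regular
  representation\<close>

context morita_context
begin

text \<open>\<open>T\<close> is embedded in \<open>T + X\<close>, and \<open>x\<close> acts by the partial bijection \<open>t \<mapsto> x t\<close> from \<open>T\<close> to \<open>X\<close>.\<close>

definition ract_rel :: "'x \<Rightarrow> 't + 'x \<Rightarrow> 't + 'x \<Rightarrow> bool"
  where "ract_rel x k l \<longleftrightarrow> (\<exists>t. k = Inl t \<and> l = Inr (ract x t) \<and> rpair x x * t = t)"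

text \<open>On the domain, \<open>t\<close> is recovered as [x, x t] = [x, x] t = t.\<close>

lemma bi_unique_ract_rel: "bi_unique (ract_rel x)"
proof -
  have "t = t'" if "ract x t = ract x t'" "rpair x x * t = t" "rpair x x * t' = t'" for t t'
    using that by (metis rpair_ract)
  then show ?thesis unfolding bi_unique_def ract_rel_def by fastforce
qed

lemma lpair_self_mult: "lpair x x * lpair x y = lpair x y"
  by (metis lpair_lact lpair_self)

lemma rpair_self_mult: "rpair x x * rpair x y = rpair x y"
  by (metis rpair_ract rpair_self rpair_ract_left rpair_swap)

text \<open>For the converse put t' = [x, y] t. Then x t' = <x, x> (y t) and y t = <y, y> (x t'),
  and commuting idempotents force x t' = y t.\<close>

lemma ract_rel_right:
  "(ract_rel y OO (ract_rel x)\<inverse>\<inverse>) k l \<longleftrightarrow> (\<exists>i j. k = Inl i \<and> l = Inl j \<and> left_mult_rel (rpair x y) i j)"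
  (is "?L \<longleftrightarrow> ?R")
proof
  assume ?L
  then obtain t t' where kl: "k = Inl t" "l = Inl t'" and t: "rpair y y * t = t" and t': "rpair x x * t' = t'"
    and eq: "ract y t = ract x t'"
    by (auto simp: ract_rel_def OO_def)
  have "rpair x y * t = t'" using eq t' by (metis rpair_ract)
  moreover have "rpair y x * t' = t" using eq t by (metis rpair_ract)
  ultimately show ?R using kl by (auto simp: left_mult_rel_def rpair_swap[symmetric] mult.assoc)
next
  assume ?R
  then obtain t where kl: "k = Inl t" "l = Inl (rpair x y * t)" and t: "rpair y x * (rpair x y * t) = t"
    by (auto simp: left_mult_rel_def rpair_swap[symmetric] mult.assoc)
  define t' where "t' = rpair x y * t"
  have yt: "rpair y y * t = t" using t rpair_self_mult[of y x] by (metis mult.assoc)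
  have xt: "rpair x x * t' = t'" unfolding t'_def using rpair_self_mult[of x y] by (metis mult.assoc)
  have 1: "ract x t' = lact (lpair x x) (ract y t)"
    unfolding t'_def ract_mult lpair_rpair[symmetric] lact_ract_commute ..
  have "ract y t = ract y (rpair y x * t')" using t by (simp add: t'_def)
  also have "\<dots> = lact (lpair y y) (ract x t')"
    unfolding ract_mult lpair_rpair[symmetric] lact_ract_commute ..
  finally have 2: "ract y t = lact (lpair y y) (ract x t')" .
  have "ract y t = lact (lpair y y) (lact (lpair x x) (ract y t))" using 1 2 by simp
  also have "\<dots> = lact (lpair x x) (lact (lpair y y) (ract y t))"
    by (rule lact_idem_commute[OF lpair_idem lpair_idem])
  also have "lact (lpair y y) (ract y t) = ract y t" by (metis lact_ract_commute lpair_self)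
  finally have "ract y t = ract x t'" using 1 by simp
  then show ?L using kl xt yt unfolding t'_def[symmetric] by (auto simp: ract_rel_def OO_def)
qed

text \<open>The induced action of S by partial bijections of X; it is undefined on the summand T, so
  the operators vanish there.\<close>

definition lact_rel :: "'s \<Rightarrow> 't + 'x \<Rightarrow> 't + 'x \<Rightarrow> bool"
  where "lact_rel s k l \<longleftrightarrow> (\<exists>z. k = Inr z \<and> l = Inr (lact s z) \<and> lact (s\<^sup>\<star> * s) z = z)"

lemma bi_unique_lact_rel: "bi_unique (lact_rel s)"
proof -
  have "z = z'" if "lact s z = lact s z'" "lact (s\<^sup>\<star> * s) z = z" "lact (s\<^sup>\<star> * s) z' = z'" for z z'
    using that unfolding lact_mult by metis
  then show ?thesis unfolding bi_unique_def lact_rel_def by fastforce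
qed

lemma ract_rel_left: "(ract_rel y)\<inverse>\<inverse> OO ract_rel x = lact_rel (lpair x y)"
proof (intro ext iffI)
  fix k l
  assume "((ract_rel y)\<inverse>\<inverse> OO ract_rel x) k l"
  then obtain t where kl: "k = Inr (ract y t)" "l = Inr (ract x t)" and t: "rpair y y * t = t" "rpair x x * t = t"
    by (auto simp: ract_rel_def OO_def)
  have 1: "lact (lpair x y) (ract y t) = ract x t" by (metis lpair_rpair ract_mult lact_ract_commute t(1))
  have 2: "lact (lpair y x) (ract x t) = ract y t" by (metis lpair_rpair ract_mult lact_ract_commute t(2))
  show "lact_rel (lpair x y) k l"
    using kl 1 2 by (auto simp: lact_rel_def lpair_swap[symmetric] lact_mult)
next
  fix k l
  assume "lact_rel (lpair x y) k l"
  then obtain z where kl: "k = Inr z" "l = Inr (lact (lpair x y) z)"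
    and z: "lact (lpair y x) (lact (lpair x y) z) = z"
    by (auto simp: lact_rel_def lpair_swap[symmetric] lact_mult)
  \<comment> \<open>The witness: y [y, z] = <y, y> z, which is z because z lies in the range of <y,
    x>.\<close>
  define t where "t = rpair y z"
  have yt: "rpair y y * t = t" unfolding t_def by (rule rpair_self_mult)
  have xt: "ract x t = lact (lpair x y) z" by (simp add: t_def lpair_rpair)
  have "ract y t = lact (lpair y y) z" by (simp add: t_def lpair_rpair)
  also have "\<dots> = z" using z by (metis lact_mult lpair_self_mult)
  finally have yz: "ract y t = z" .
  have "z = ract y (rpair x (ract x t))" unfolding lpair_rpair[symmetric] xt by (simp add: z)
  then have "t = rpair y y * (rpair x x * t)" unfolding t_def by (metis rpair_ract t_def)
  also have "\<dots> = rpair x x * (rpair y y * t)" 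
    unfolding mult.assoc[symmetric] idem_commute[OF rpair_idem[of y] rpair_idem[of x]] ..
  finally have "rpair x x * t = t" using yt by simp
  then show "((ract_rel y)\<inverse>\<inverse> OO ract_rel x) k l"
    using kl yt xt yz by (auto simp: ract_rel_def OO_def)
qed

text \<open>The fibre of \<open>x \<mapsto> [x, x]\<close> over \<open>f\<close> embeds \<open>S\<close>-equivariantly into \<open>S\<close> via its base point.\<close>

definition fibre_rel :: "'t \<Rightarrow> 't + 'x \<Rightarrow> 's \<Rightarrow> bool"
  where "fibre_rel f k s \<longleftrightarrow> (\<exists>x. k = Inr x \<and> rpair x x = f \<and> s = lpair x (fibre_base f))"

lemma bi_unique_fibre_rel: "bi_unique (fibre_rel f)"
  unfolding bi_unique_def fibre_rel_def by (auto intro!: fibre_coordinate_eqD)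

text \<open>On its domain \<open>s\<close> preserves fibres, as [s z, s z] = [z, s^* s z] = [z, z].
  The domains correspond because z is recovered from its coordinate by acting on the base
  point.\<close>

lemma fibre_rel_equivariant: "lact_rel s OO fibre_rel f = fibre_rel f OO left_mult_rel s"
proof (intro ext iffI)
  fix k r
  assume "(lact_rel s OO fibre_rel f) k r"
  then obtain z where k: "k = Inr z" and z: "lact (s\<^sup>\<star> * s) z = z"
    and f: "rpair (lact s z) (lact s z) = f" and r: "r = lpair (lact s z) (fibre_base f)"
    by (auto simp: lact_rel_def fibre_rel_def OO_def)
  have "rpair z z = f" using f z by (metis rpair_lact lact_mult rpair_swap)
  moreover have "s\<^sup>\<star> * s * lpair z (fibre_base f) = lpair z (fibre_base f)" by (metis lpair_lact z)
  ultimately show "(fibre_rel f OO left_mult_rel s) k r"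
    using k r by (auto simp: left_mult_rel_def fibre_rel_def OO_def lpair_lact)
next
  fix k r
  assume "(fibre_rel f OO left_mult_rel s) k r"
  then obtain z where k: "k = Inr z" and f: "rpair z z = f"
    and u: "s\<^sup>\<star> * s * lpair z (fibre_base f) = lpair z (fibre_base f)" and r: "r = s * lpair z (fibre_base f)"
    by (auto simp: left_mult_rel_def fibre_rel_def OO_def)
  have z: "lact (s\<^sup>\<star> * s) z = z" using u f lact_fibre_base[of z] by (metis lact_mult)
  have "rpair (lact s z) (lact s z) = f" using f z by (metis rpair_lact lact_mult rpair_swap)
  then show "(lact_rel s OO fibre_rel f) k r"
    using k r z by (auto simp: lact_rel_def fibre_rel_def OO_def lpair_lact)
qed

text \<open>All fibre embeddings together: X is embedded in T x S, so l2 of X maps isometrically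
  into the Hilbert sum of copies of l2 of S indexed by T.\<close>

definition total_fibre_rel :: "'t + 'x \<Rightarrow> 't \<times> 's \<Rightarrow> bool"
  where "total_fibre_rel k p \<longleftrightarrow> fibre_rel (fst p) k (snd p)"

lemma bi_unique_total_fibre_rel: "bi_unique total_fibre_rel"
  unfolding bi_unique_def total_fibre_rel_def fibre_rel_def by (auto intro!: fibre_coordinate_eqD)

lemma ell2_slice_total_fibre_rel: "ell2_slice f (rel_op total_fibre_rel v) = rel_op (fibre_rel f) v"
proof (rule ell2_eqI)
  fix s
  show "ell2_apply (ell2_slice f (rel_op total_fibre_rel v)) s = ell2_apply (rel_op (fibre_rel f) v) s"
    unfolding ell2_slice.rep_eq rel_op_apply_raw[OF bi_unique_total_fibre_rel]
      rel_op_apply_raw[OF bi_unique_fibre_rel] by (simp add: total_fibre_rel_def)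
qed

lemma induced_regular_bound:
  assumes "(a, b) \<in> pair_span left_regular_rep (\<lambda>s. rel_bop (lact_rel s))"
  shows "norm b \<le> norm a"
proof (rule norm_bop_le)
  fix v
  \<comment> \<open>The fibre embeddings intertwine \<open>b\<close> with \<open>a\<close>. The
    second conjunct puts \<open>b \<bullet>\<^sub>o v\<close> in the part over X, where the total
    embedding loses no norm.\<close>
  have eqv: "rel_op (fibre_rel f) (b \<bullet>\<^sub>o v) = a \<bullet>\<^sub>o rel_op (fibre_rel f) v \<and> ell2_apply (b \<bullet>\<^sub>o v) (Inl t) = 0" for f t
    using assms
  proof induction
    case zero
    show ?case by (simp add: rel_op_zero[OF bi_unique_fibre_rel])
  next
    case (gen s)
    have "ell2_apply (rel_op (lact_rel s) v) (Inl t) = 0"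
      by (rule rel_op_outside[OF bi_unique_lact_rel]) (simp add: lact_rel_def)
    then show ?case
      by (simp add: rel_bop_apply bi_unique_lact_rel bi_unique_fibre_rel left_regular_rep_eq bi_unique_left_mult_rel
          fibre_rel_equivariant flip: rel_op_OO)
  next
    case (add a b a' b')
    then show ?case by (simp add: bop_add_left rel_op_add[OF bi_unique_fibre_rel])
  next
    case (scale a b c)
    then show ?case by (simp add: bop_scaleC_left rel_op_scaleC[OF bi_unique_fibre_rel])
  qed
  let ?W = "rel_op total_fibre_rel"
  have "rel_op total_fibre_rel\<inverse>\<inverse> (?W (b \<bullet>\<^sub>o v)) = b \<bullet>\<^sub>o v"
  proof (rule ell2_eqI)
    fix k
    have W': "bi_unique total_fibre_rel\<inverse>\<inverse>" using bi_unique_total_fibre_rel by simp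
    show "ell2_apply (rel_op total_fibre_rel\<inverse>\<inverse> (?W (b \<bullet>\<^sub>o v))) k = ell2_apply (b \<bullet>\<^sub>o v) k"
    proof (cases k)
      case (Inl t)
      then show ?thesis
        using eqv by (simp add: rel_op_outside[OF W'] total_fibre_rel_def fibre_rel_def)
    next
      case (Inr x)
      then have p: "total_fibre_rel k (rpair x x, lpair x (fibre_base (rpair x x)))"
        by (simp add: total_fibre_rel_def fibre_rel_def)
      then have "total_fibre_rel\<inverse>\<inverse> (rpair x x, lpair x (fibre_base (rpair x x))) k" by simp
      then show ?thesis
        by (simp add: rel_op_apply[OF W'] rel_op_apply[OF bi_unique_total_fibre_rel p])
    qed
  qed
  then have "norm (b \<bullet>\<^sub>o v) \<le> norm (?W (b \<bullet>\<^sub>o v))"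
    using norm_rel_op[of "total_fibre_rel\<inverse>\<inverse>" "?W (b \<bullet>\<^sub>o v)"] bi_unique_total_fibre_rel by simp
  also have "\<dots> \<le> norm a * norm (?W v)"
  \<comment> \<open>The bound holds in each slice and is summed over the fibres.\<close>
  proof (rule power2_le_imp_le)
    show "(norm (?W (b \<bullet>\<^sub>o v)))\<^sup>2 \<le> (norm a * norm (?W v))\<^sup>2"
      unfolding power_mult_distrib
    proof (rule has_sum_mono)
      show "((\<lambda>f. (norm (ell2_slice f (?W (b \<bullet>\<^sub>o v))))\<^sup>2) has_sum (norm (?W (b \<bullet>\<^sub>o v)))\<^sup>2) UNIV"
        by (rule ell2_slice_norm)
      show "((\<lambda>f. (norm a)\<^sup>2 * (norm (ell2_slice f (?W v)))\<^sup>2) has_sum ((norm a)\<^sup>2 * (norm (?W v))\<^sup>2)) UNIV"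
        by (rule has_sum_cmult_right[OF ell2_slice_norm])
      show "(norm (ell2_slice f (?W (b \<bullet>\<^sub>o v))))\<^sup>2 \<le> (norm a)\<^sup>2 * (norm (ell2_slice f (?W v)))\<^sup>2" for f
        unfolding ell2_slice_total_fibre_rel power_mult_distrib[symmetric]
        using eqv by (intro power_mono) (simp_all add: norm_bop_apply)
    qed
  qed simp
  also have "\<dots> \<le> norm a * norm v"
    by (intro mult_left_mono norm_rel_op bi_unique_total_fibre_rel) simp
  finally show "norm (b \<bullet>\<^sub>o v) \<le> norm a * norm v" .
qed simp

lemma induced_pair_regular:
  obtains \<theta> :: "'x \<Rightarrow> ('t + 'x) ell2 bop" and \<sigma> \<tau>
    where "induced_pair lpair rpair left_regular_rep left_regular_rep \<theta> \<sigma> \<tau>"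
proof -
  let ?\<theta> = "\<lambda>x. rel_bop (ract_rel x)" and ?\<tau> = "\<lambda>t. block Inl Inl (left_regular_rep t) :: ('t + 'x) ell2 bop"
  have \<theta>: "adj (?\<theta> x) * ?\<theta> y = ?\<tau> (rpair x y)" for x y
    unfolding left_regular_rep_eq block_rel_bop[OF inj_Inl bi_unique_left_mult_rel] ract_rel_right[symmetric]
    by (simp add: adj_rel_bop bi_unique_ract_rel rel_bop_mult)
  note \<tau> = isometric_pair_block[OF inj_Inl star_representation_left_regular_rep]
  obtain \<sigma> where \<sigma>: "star_representation \<sigma>" "\<And>x y. ?\<theta> x * adj (?\<theta> y) = \<sigma> (lpair x y)"
    using induced_representation[OF isometric_pair.rep_cod[OF \<tau>] \<theta>] by blast
  \<comment> \<open>The abstract construction fixes \<open>\<sigma>\<close> only on values of the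
    pairing; surjectivity identifies it everywhere.\<close>
  have "\<sigma> s = rel_bop (lact_rel s)" for s
  proof -
    obtain x y where s: "s = lpair x y" by (rule lpair_ex)
    show ?thesis
      unfolding s \<sigma>(2)[symmetric] ract_rel_left[symmetric]
      by (simp add: adj_rel_bop bi_unique_ract_rel rel_bop_mult)
  qed
  then have "norm b \<le> norm a" if "(a, b) \<in> pair_span left_regular_rep \<sigma>" for a b
    using induced_regular_bound[of a b] that by presburger
  then show thesis
    using \<sigma> \<tau> \<theta> by (intro that[of ?\<theta> \<sigma> ?\<tau>]) (simp add: induced_pair_def)
qed

end

theorem corollary4p8:
  fixes lact :: "'s::inverse_semigroup \<Rightarrow> 'x \<Rightarrow> 'x"
    and ract :: "'x \<Rightarrow> 't::inverse_semigroup \<Rightarrow> 'x"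
    and lpair :: "'x \<Rightarrow> 'x \<Rightarrow> 's"
    and rpair :: "'x \<Rightarrow> 'x \<Rightarrow> 't"
  assumes "countable (UNIV :: 's set)"
    and "countable (UNIV :: 't set)"
    and "morita_context lact ract lpair rpair"
  shows "strongly_morita_equivalent (full_cstar TYPE('s)) (full_cstar TYPE('t)) \<and>
    strongly_morita_equivalent (reduced_cstar TYPE('s)) (reduced_cstar TYPE('t))"
proof -
  interpret morita_context lact ract lpair rpair by fact
  \<comment> \<open>Inducing in the opposite context starts from representations of S and supplies
    the second family of operators.\<close>
  interpret opposite: morita_context "\<lambda>t x. ract x (t\<^sup>\<star>)" "\<lambda>x s. lact (s\<^sup>\<star>) x" rpair lpair
    by (rule morita_context_opposite)
  have X: "countable (UNIV :: 'x set)" using assms(1,2) by (rule countable_module)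
  note rep = star_representation_universal_rep
  obtain \<theta>1 :: "'x \<Rightarrow> (nat \<times> ('t \<Rightarrow> ('t \<times> nat) ell2 bop) \<times> 't \<times> nat) ell2 bop" and \<sigma>1 \<tau>1
    where 1: "induced_pair lpair rpair universal_rep universal_rep \<theta>1 \<sigma>1 \<tau>1"
    by (rule induced_pair_universal[OF X rep])
  obtain \<theta>2 :: "'x \<Rightarrow> (nat \<times> ('s \<Rightarrow> ('s \<times> nat) ell2 bop) \<times> 's \<times> nat) ell2 bop" and \<sigma>2 \<tau>2
    where 2: "induced_pair rpair lpair universal_rep universal_rep \<theta>2 \<sigma>2 \<tau>2"
    by (rule opposite.induced_pair_universal[OF X rep])
  obtain \<theta>3 :: "'x \<Rightarrow> ('t + 'x) ell2 bop" and \<sigma>3 \<tau>3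
    where 3: "induced_pair lpair rpair left_regular_rep left_regular_rep \<theta>3 \<sigma>3 \<tau>3"
    by (rule induced_pair_regular)
  obtain \<theta>4 :: "'x \<Rightarrow> ('s + 'x) ell2 bop" and \<sigma>4 \<tau>4
    where 4: "induced_pair rpair lpair left_regular_rep left_regular_rep \<theta>4 \<sigma>4 \<tau>4"
    by (rule opposite.induced_pair_regular)
  show ?thesis
    unfolding full_cstar_def reduced_cstar_def
    by (intro conjI strongly_morita_equivalent_of_induced_pairs[OF X 1 2]
        strongly_morita_equivalent_of_induced_pairs[OF X 3 4])
qed

end
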